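(* Let $n_1,n_2,\ldots$ be a lacunary sequence of positive integers, and let $\psi:\mathbb{N}\to[0,1]$ with $\sum_{t=1}^\infty\psi(t)=\infty$. Then there exists $\mathcal{G}\subseteq\mathcal{B}$ with Hausdorff dimension $\dim_{\mathrm{H}}(\mathcal{G})=2$ such that if $(\beta,\delta)\in\mathcal{G}$ then the inequality $$\|n_t\beta-\delta\|\le\psi(t)$$ has infinitely many solutions $t\in\mathbb{N}$.
   Context: For $x\in\mathbb{R}$, $\|x\|$ denotes the distance from $x$ to the nearest integer. A sequence $(n_t)$ of positive integers is lacunary if there is $c>1$ with $n_{t+1}\ge c\, n_t$ for all $t\ge1$. $\mathbf{Bad} = \{\alpha \in \mathbb{R} : \inf_{n\in\mathbb{N}} n\|n\alpha\| > 0\}$, $\mathbf{Bad}_\gamma = \{\alpha\in\mathbb{R} : \inf_{n\in\mathbb{N}} n\|n\alpha-\gamma\|>0\}$ for $\gamma\in\mathbb{R}$, and $\mathcal{B} = \{(\alpha,\gamma)\in\mathbb{R}^2 : \alpha\in\mathbf{Bad}\cap\mathbf{Bad}_\gamma\}$. *)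

theory Defs
  imports "HOL-Analysis.Analysis"
begin

section \<open>Hausdorff dimension\<close>

text \<open>
  The cost \<open>(diam U)\<^sup>s\<close> of a covering set, with the usual conventions: the empty set costs nothing
  (so that finite covers are included among covers indexed by \<^typ>\<open>nat\<close>), and for \<open>s = 0\<close> every
  nonempty set costs 1.  The latter needs its own case because \<open>0 powr 0 = 0\<close> in HOL.
\<close>

definition hausdorff_cost :: "real \<Rightarrow> 'a::metric_space set \<Rightarrow> ennreal" where
  "hausdorff_cost s U =
     (if U = {} then 0 else if s = 0 then 1 else ennreal (diameter U powr s))"

text \<open>Boundedness is required explicitly because \<^const>\<open>diameter\<close> is unspecified on unbounded sets.\<close>

definition hausdorff_premeasure :: "real \<Rightarrow> real \<Rightarrow> 'a::metric_space set \<Rightarrow> ennreal" where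
  "hausdorff_premeasure s r E =
     (INF U \<in> {U :: nat \<Rightarrow> 'a set. E \<subseteq> (\<Union>i. U i) \<and> (\<forall>i. bounded (U i) \<and> diameter (U i) \<le> r)}.
        \<Sum>i. hausdorff_cost s (U i))"

definition hausdorff_measure :: "real \<Rightarrow> 'a::metric_space set \<Rightarrow> ennreal" where
  "hausdorff_measure s E = (SUP r \<in> {0<..}. hausdorff_premeasure s r E)"

definition hausdorff_dim :: "'a::metric_space set \<Rightarrow> ennreal" where
  "hausdorff_dim E = (INF s \<in> {s. 0 \<le> s \<and> hausdorff_measure s E = 0}. ennreal s)"


section \<open>Diophantine approximation\<close>

definition dist_int :: "real \<Rightarrow> real" where
  "dist_int x = infdist x \<int>"

text \<open>
  Sequences are indexed by \<open>t \<ge> 1\<close>, as \<open>\<nat>\<close> denotes the positive integers here; values at index 0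
  are irrelevant.  Likewise the infima below run over \<open>n \<ge> 1\<close>.
\<close>

definition lacunary :: "(nat \<Rightarrow> nat) \<Rightarrow> bool" where
  "lacunary n \<longleftrightarrow> (\<exists>c::real. c > 1 \<and> (\<forall>t\<ge>1. real (n (t + 1)) \<ge> c * real (n t)))"

definition Bad :: "real set" where
  "Bad = {\<alpha>. (INF n\<in>{1::nat..}. real n * dist_int (real n * \<alpha>)) > 0}"

definition Bad_inhom :: "real \<Rightarrow> real set" where
  "Bad_inhom \<gamma> = {\<alpha>. (INF n\<in>{1::nat..}. real n * dist_int (real n * \<alpha> - \<gamma>)) > 0}"

definition Bad_pairs :: "(real \<times> real) set" where
  "Bad_pairs = {(\<alpha>, \<gamma>). \<alpha> \<in> Bad \<inter> Bad_inhom \<gamma>}"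

end

theory Submission
  imports Defs
begin

text \<open>
  Divergence of \<open>\<Sum> \<psi> t\<close> forces \<open>\<psi> t \<ge> 1 / t\<^sup>2\<close> for infinitely many \<open>t\<close>, and lacunarity makes
  \<open>n t\<close> exponentially large in \<open>t\<close>.  At such \<open>t\<close> the tolerance \<open>\<psi> t\<close> is larger than any fixed negative
  power of \<open>n t\<close>, so a single constraint \<open>dist_int (n t * \<beta> - \<delta>) \<le> \<psi> t\<close> prescribes only a small
  proportion of the digits of \<open>(\<beta>, \<delta>)\<close> available at that scale.  It may therefore be imposed at a sparse
  sequence of \<open>t\<close>, and the set of solutions is bounded below by a Cantor set of dimension as close to 2 as
  desired.

  The Cantor set is a tree of boxes.  A box at scale \<open>X\<close> has sides \<open>1 / X\<^sup>2\<close> in \<open>\<beta>\<close> and \<open>1 / X\<close> in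
  \<open>\<delta>\<close>: the condition \<open>q * \<bar>q * \<beta> - p\<bar> \<ge> c\<close> concerns \<open>\<beta>\<close> at scale \<open>1 / q\<^sup>2\<close>, whereas for given \<open>\<beta>\<close>
  the condition \<open>q * \<bar>q * \<beta> - p - \<delta>\<bar> \<ge> c\<close> concerns \<open>\<delta>\<close> at scale \<open>1 / q\<close>.  For \<open>q\<close> of the order of \<open>X\<close>
  each condition has at most one relevant pair \<open>(p, q)\<close> (\<open>hom_step_window\<close>, \<open>inhom_step_window\<close>), so a
  free step from \<open>X\<close> to \<open>X * R\<close> loses only boundedly many of the \<open>R\<^sup>2\<close> children in \<open>\<beta>\<close> and of the \<open>R\<close>
  children in \<open>\<delta>\<close>.  There is even room to keep only children that are far apart, and then the
  dimension can be read off from a coding of the branches by \<open>[0, 1)\<^sup>2\<close> that never contracts distances too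
  much (\<open>hausdorff_measure_pos_of_expanding\<close>, \<open>separated_tree_coding\<close>).

  The difficulty is a forced step, which has to bring \<open>n * \<beta>\<close> close to \<open>\<delta>\<close> modulo 1 without worsening the
  constant in the bad approximability of \<open>\<beta>\<close> (\<open>forced_hom_step\<close>).  Between two Farey neighbours inside the
  given interval, consider the numbers \<open>\<beta>\<^sub>w(x)\<close> whose continued fraction goes on with a word
  \<open>w \<in> {1, 2}\<^sup>l\<close> and then with a number \<open>x\<close> from a set \<open>S \<subseteq> [0, 1]\<close> of good cells.  All of these are badly
  approximable as far as needed.  Suppose that \<open>n * \<beta>\<^sub>w(x)\<close> misses the target for all \<open>w\<close> and all \<open>x \<in> S\<close>.
  Then the averages over \<open>w\<close> of \<open>cos (2 * pi * h * (n * \<beta>\<^sub>w(x) - \<delta>))\<close> are biased on \<open>S\<close> for some frequency \<open>h \<ge> 1\<close>.  Their mean square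
  over all of \<open>[0, 1]\<close> is of order \<open>2\<^sup>-\<^sup>l\<close>, because different words give phases with different derivatives
  (\<open>words_separated\<close>, \<open>mobius_phase_integral\<close>), whereas \<open>S\<close>, being almost of full dimension, is much larger
  than that (\<open>good_cells_measure\<close>).  This contradiction is the mechanism by which Kaufman's measures on
  badly approximable numbers have decaying Fourier transform, reduced to what a single step requires.
\<close>


section \<open>Hausdorff dimension in the plane\<close>

lemma outer_measure_cover_interval:
  fixes x \<rho> :: "nat \<Rightarrow> real" and I :: "nat set"
  assumes cov: "{0..<1} \<subseteq> (\<Union>i\<in>I. {x i - \<rho> i .. x i + \<rho> i})" and pos: "\<And>i. i \<in> I \<Longrightarrow> 0 \<le> \<rho> i"
  shows "1 \<le> (\<Sum>i. if i \<in> I then ennreal (2 * \<rho> i) else 0)"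
proof -
  define V where "V i = (if i \<in> I then {x i - \<rho> i .. x i + \<rho> i} else {})" for i :: nat
  have "1 = emeasure lborel {0..<1::real}" by simp
  also have "\<dots> \<le> emeasure lborel (\<Union>i. V i)"
    by (rule emeasure_mono) (use cov in \<open>auto simp: V_def\<close>)
  also have "\<dots> \<le> (\<Sum>i. emeasure lborel (V i))"
    by (rule emeasure_subadditive_countably) (auto simp: V_def)
  also have "\<dots> = (\<Sum>i. if i \<in> I then ennreal (2 * \<rho> i) else 0)"
    by (rule suminf_cong) (use pos in \<open>auto simp: V_def\<close>)
  finally show ?thesis .
qed

text \<open>
  Fubini's theorem takes the place of a mass distribution.  The first coordinates \<open>\<xi>\<close> of the codes of points
  in a set of diameter \<open>r\<close> lie in an interval of length \<open>2 * C * r powr \<sigma>\<close>, and for each \<open>\<xi>\<close> so do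
  the second ones; the set thus accounts for at most \<open>4 * C\<^sup>2 * r powr (2 * \<sigma>)\<close> of the unit square.
  Measuring the enclosing intervals instead of the preimages keeps measurability of \<open>g\<close> out of the argument.
\<close>

lemma hausdorff_measure_pos_of_expanding:
  fixes g :: "real \<Rightarrow> real \<Rightarrow> real \<times> real"
  assumes C: "C > 0" and s: "\<sigma> > 0"
    and fst_exp: "\<And>\<xi> \<xi>' \<eta> \<eta>'. {\<xi>, \<xi>', \<eta>, \<eta>'} \<subseteq> {0..<1} \<Longrightarrow>
         \<bar>\<xi> - \<xi>'\<bar> \<le> C * dist (g \<xi> \<eta>) (g \<xi>' \<eta>') powr \<sigma>"
    and snd_exp: "\<And>\<xi> \<eta> \<eta>'. {\<xi>, \<eta>, \<eta>'} \<subseteq> {0..<1} \<Longrightarrow>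
         \<bar>\<eta> - \<eta>'\<bar> \<le> C * dist (g \<xi> \<eta>) (g \<xi> \<eta>') powr \<sigma>"
    and range: "\<And>\<xi> \<eta>. {\<xi>, \<eta>} \<subseteq> {0..<1} \<Longrightarrow> g \<xi> \<eta> \<in> G"
    and t: "0 \<le> t" "t \<le> 2 * \<sigma>"
  shows "hausdorff_measure t G \<noteq> 0"
proof -
  have key: "ennreal (1 / (4 * C\<^sup>2)) \<le> (\<Sum>i. hausdorff_cost t (U i))"
    if cov: "G \<subseteq> (\<Union>i. U i)" and bd: "\<And>i. bounded (U i)" and d1: "\<And>i. diameter (U i) \<le> 1"
    for U :: "nat \<Rightarrow> (real \<times> real) set"
  proof -
    define \<rho> where "\<rho> i = C * diameter (U i) powr \<sigma>" for i
    have \<rho>0: "\<rho> i \<ge> 0" for i using C by (simp add: \<rho>_def)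
    define A where "A i = {\<xi> \<in> {0..<1}. \<exists>\<eta>\<in>{0..<1}. g \<xi> \<eta> \<in> U i}" for i
    define z where "z i = (SOME \<xi>. \<xi> \<in> A i)" for i
    define B where "B i = (if A i = {} then {} else {z i - \<rho> i .. z i + \<rho> i})" for i
    have dU: "dist p q powr \<sigma> \<le> diameter (U i) powr \<sigma>" if "p \<in> U i" "q \<in> U i" for p q i
      by (rule powr_mono2) (use s diameter_bounded_bound[OF bd that] in auto)
    have AB: "A i \<subseteq> B i" for i
    proof
      fix \<xi> assume xi: "\<xi> \<in> A i"
      hence "z i \<in> A i" unfolding z_def by (rule someI)
      with xi obtain \<eta> \<eta>' where h: "{\<xi>, z i, \<eta>, \<eta>'} \<subseteq> {0..<1}" "g \<xi> \<eta> \<in> U i" "g (z i) \<eta>' \<in> U i"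
        by (auto simp: A_def)
      have "\<bar>\<xi> - z i\<bar> \<le> C * dist (g \<xi> \<eta>) (g (z i) \<eta>') powr \<sigma>" by (rule fst_exp[OF h(1)])
      also have "\<dots> \<le> \<rho> i" unfolding \<rho>_def using C dU[OF h(2,3)] by simp
      finally show "\<xi> \<in> B i" using xi by (auto simp: B_def abs_le_iff)
    qed
    have fibre: "1 \<le> (\<Sum>i. ennreal (2 * \<rho> i) * indicator (B i) \<xi>)" if xi: "\<xi> \<in> {0..<1}" for \<xi>
    proof -
      define I where "I = {i. \<exists>\<eta>\<in>{0..<1}. g \<xi> \<eta> \<in> U i}"
      define y where "y i = (SOME \<eta>. \<eta> \<in> {0..<1} \<and> g \<xi> \<eta> \<in> U i)" for i
      have "{0..<1} \<subseteq> (\<Union>i\<in>I. {y i - \<rho> i .. y i + \<rho> i})"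
      proof
        fix \<eta> :: real assume eta: "\<eta> \<in> {0..<1}"
        from range[of \<xi> \<eta>] eta xi cov obtain i where i: "g \<xi> \<eta> \<in> U i" by auto
        hence iI: "i \<in> I" using eta by (auto simp: I_def)
        hence "\<exists>\<eta>. \<eta> \<in> {0..<1} \<and> g \<xi> \<eta> \<in> U i" by (auto simp: I_def)
        hence y: "y i \<in> {0..<1} \<and> g \<xi> (y i) \<in> U i" unfolding y_def by (rule someI_ex)
        have "\<bar>\<eta> - y i\<bar> \<le> C * dist (g \<xi> \<eta>) (g \<xi> (y i)) powr \<sigma>"
          by (rule snd_exp) (use xi eta y in auto)
        also have "\<dots> \<le> \<rho> i" unfolding \<rho>_def using C dU[OF i, of "g \<xi> (y i)"] y by simp
        finally have "\<eta> \<in> {y i - \<rho> i .. y i + \<rho> i}" by (auto simp: abs_le_iff)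
        thus "\<eta> \<in> (\<Union>i\<in>I. {y i - \<rho> i .. y i + \<rho> i})" using iI by blast
      qed
      from outer_measure_cover_interval[OF this \<rho>0]
      have "1 \<le> (\<Sum>i. if i \<in> I then ennreal (2 * \<rho> i) else 0)" .
      also have "\<dots> \<le> (\<Sum>i. ennreal (2 * \<rho> i) * indicator (B i) \<xi>)"
      proof (rule suminf_le)
        fix i
        show "(if i \<in> I then ennreal (2 * \<rho> i) else 0) \<le> ennreal (2 * \<rho> i) * indicator (B i) \<xi>"
          using AB[of i] xi by (auto simp: I_def A_def indicator_def)
      qed auto
      finally show ?thesis .
    qed
    have "1 = (\<integral>\<^sup>+\<xi>. indicator {0..<1::real} \<xi> \<partial>lborel)" by simp
    also have "\<dots> \<le> (\<integral>\<^sup>+\<xi>. (\<Sum>i. ennreal (2 * \<rho> i) * indicator (B i) \<xi>) \<partial>lborel)"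
      by (rule nn_integral_mono) (use fibre in \<open>auto simp: indicator_def\<close>)
    also have "\<dots> = (\<Sum>i. \<integral>\<^sup>+\<xi>. ennreal (2 * \<rho> i) * indicator (B i) \<xi> \<partial>lborel)"
      by (rule nn_integral_suminf) (auto simp: B_def)
    also have "\<dots> \<le> (\<Sum>i. ennreal (4 * C\<^sup>2) * hausdorff_cost t (U i))"
    proof (rule suminf_le)
      fix i
      show "(\<integral>\<^sup>+\<xi>. ennreal (2 * \<rho> i) * indicator (B i) \<xi> \<partial>lborel) \<le> ennreal (4 * C\<^sup>2) * hausdorff_cost t (U i)"
      proof (cases "A i = {}")
        case False
        hence ne: "U i \<noteq> {}" by (auto simp: A_def)
        have dd: "0 \<le> diameter (U i)" using diameter_ge_0[OF bd] .
        have "(\<integral>\<^sup>+\<xi>. ennreal (2 * \<rho> i) * indicator (B i) \<xi> \<partial>lborel) = ennreal (2 * \<rho> i) * emeasure lborel (B i)"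
          by (rule nn_integral_cmult_indicator) (auto simp: B_def)
        also have "\<dots> = ennreal (2 * \<rho> i) * ennreal (2 * \<rho> i)" using False \<rho>0[of i] by (simp add: B_def)
        also have "\<dots> = ennreal ((2 * \<rho> i) * (2 * \<rho> i))" by (rule ennreal_mult[symmetric]) (use \<rho>0[of i] in auto)
        also have "(2 * \<rho> i) * (2 * \<rho> i) = 4 * C\<^sup>2 * diameter (U i) powr (2 * \<sigma>)"
          by (simp add: \<rho>_def power2_eq_square powr_add[symmetric] mult_ac)
        also have "ennreal \<dots> = ennreal (4 * C\<^sup>2) * ennreal (diameter (U i) powr (2 * \<sigma>))"
          by (simp add: ennreal_mult)
        also have "\<dots> \<le> ennreal (4 * C\<^sup>2) * hausdorff_cost t (U i)"
        proof (rule mult_left_mono)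
          have "diameter (U i) powr (2 * \<sigma>) \<le> diameter (U i) powr t" if "t \<noteq> 0"
            using dd d1[of i] t by (cases "diameter (U i) = 0") (auto intro: powr_mono')
          moreover have "diameter (U i) powr (2 * \<sigma>) \<le> 1" using dd d1[of i] s
            by (intro powr_le1) auto
          ultimately show "ennreal (diameter (U i) powr (2 * \<sigma>)) \<le> hausdorff_cost t (U i)"
            using ne by (auto simp: hausdorff_cost_def intro: ennreal_leI)
        qed simp
        finally show ?thesis .
      qed (simp add: B_def)
    qed auto
    also have "\<dots> = ennreal (4 * C\<^sup>2) * (\<Sum>i. hausdorff_cost t (U i))" by simp
    finally have *: "1 \<le> ennreal (4 * C\<^sup>2) * (\<Sum>i. hausdorff_cost t (U i))" .
    have "ennreal (1 / (4 * C\<^sup>2)) * 1 \<le> ennreal (1 / (4 * C\<^sup>2)) * (ennreal (4 * C\<^sup>2) * (\<Sum>i. hausdorff_cost t (U i)))"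
      by (rule mult_left_mono[OF *]) simp
    also have "\<dots> = (\<Sum>i. hausdorff_cost t (U i))"
      using C by (simp add: mult.assoc[symmetric] ennreal_mult'[symmetric])
    finally show ?thesis by simp
  qed
  have "0 < ennreal (1 / (4 * C\<^sup>2))" using C by simp
  also have "\<dots> \<le> hausdorff_premeasure t 1 G"
    unfolding hausdorff_premeasure_def by (rule INF_greatest) (use key in auto)
  also have "\<dots> \<le> hausdorff_measure t G"
    unfolding hausdorff_measure_def by (rule SUP_upper) auto
  finally show ?thesis by simp
qed

text \<open>
  A grid of \<open>m\<^sup>2\<close> squares costs at most a constant times \<open>m powr (2 - s)\<close>.
\<close>

lemma hausdorff_measure_unit_square:
  fixes E :: "(real \<times> real) set"
  assumes E: "E \<subseteq> {0..1} \<times> {0..1}" and s: "s > 2"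
  shows "hausdorff_measure s E = 0"
proof -
  have pre: "hausdorff_premeasure s r E = 0" if r: "r > 0" for r
  proof -
    define sq where "sq m i = {real (i mod m) / m .. (real (i mod m) + 1) / m} \<times> {real (i div m) / m .. (real (i div m) + 1) / m}" for m i :: nat
    define U where "U m i = (if i < m * m then sq m i else {})" for m i :: nat
    have diam: "diameter (sq m i) \<le> 2 / m" if "m > 0" for m i
    proof (rule diameter_le)
      fix p q assume "p \<in> sq m i" "q \<in> sq m i"
      hence "\<bar>fst p - fst q\<bar> \<le> 1 / m" "\<bar>snd p - snd q\<bar> \<le> 1 / m"
        by (auto simp: sq_def abs_le_iff add_divide_distrib)
      moreover have "norm (p - q) \<le> norm (fst p - fst q) + norm (snd p - snd q)"
        by (metis fst_diff norm_Pair_le prod.collapse snd_diff)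
      ultimately show "norm (p - q) \<le> 2 / m" by auto
    qed auto
    have bdd: "bounded (sq m i)" for m i unfolding sq_def by (intro bounded_Times) auto
    have cover: "E \<subseteq> (\<Union>i. U m i)" if m: "m > 0" for m
    proof
      fix p assume "p \<in> E"
      then obtain x y where p: "p = (x, y)" "x \<in> {0..1}" "y \<in> {0..1}" using E by auto
      have ex: "\<exists>k<m. z \<in> {real k / m .. (real k + 1) / m}" if z: "z \<in> {0..1}" for z :: real
      proof (cases "z = 1")
        case True
        thus ?thesis using m by (intro exI[of _ "m - 1"]) (auto simp: field_simps of_nat_diff)
      next
        case False
        define k where "k = nat \<lfloor>z * m\<rfloor>"
        have "z * m < m" using z False m by auto
        hence "k < m" using z m by (auto simp: k_def) (simp add: floor_less_iff nat_less_iff)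
        moreover have "real k \<le> z * m" "z * m \<le> real k + 1" using z by (auto simp: k_def)
        ultimately show ?thesis using m by (intro exI[of _ k]) (auto simp: field_simps)
      qed
      obtain k l where k: "k < m" "x \<in> {real k / m .. (real k + 1) / m}" "l < m" "y \<in> {real l / m .. (real l + 1) / m}"
        using ex[OF p(2)] ex[OF p(3)] by auto
      have "l * m + k < m * m"
      proof -
        have "l * m + k < l * m + m" using k by simp
        also have "\<dots> = (l + 1) * m" by simp
        also have "\<dots> \<le> m * m" using k by (intro mult_right_mono) auto
        finally show ?thesis .
      qed
      moreover have "(l * m + k) mod m = k" "(l * m + k) div m = l" using k by auto
      ultimately have "p \<in> U m (l * m + k)" using k p by (auto simp: U_def sq_def)
      thus "p \<in> (\<Union>i. U m i)" by auto
    qed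
    have cost: "(\<Sum>i. hausdorff_cost s (U m i)) \<le> ennreal (2 powr s * m powr (2 - s))" if m: "m > 0" for m
    proof -
      have "(\<Sum>i. hausdorff_cost s (U m i)) = (\<Sum>i<m*m. hausdorff_cost s (U m i))"
        by (rule suminf_finite) (auto simp: U_def hausdorff_cost_def)
      also have "\<dots> \<le> (\<Sum>i<m*m. ennreal ((2 / m) powr s))"
      proof (rule sum_mono)
        fix i assume "i \<in> {..<m*m}"
        have "diameter (sq m i) powr s \<le> (2 / m) powr s"
          by (rule powr_mono2) (use s diam[OF m] diameter_ge_0[OF bdd] in auto)
        thus "hausdorff_cost s (U m i) \<le> ennreal ((2 / m) powr s)"
          using s by (auto simp: hausdorff_cost_def U_def intro: ennreal_leI)
      qed
      also have "\<dots> = ennreal (real m * real m * (2 / m) powr s)"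
        by (simp add: ennreal_mult ennreal_of_nat_eq_real_of_nat)
      also have "real m * real m * (2 / m) powr s = 2 powr s * m powr (2 - s)"
        using m by (simp add: powr_divide powr_diff power2_eq_square)
      finally show ?thesis .
    qed
    have "hausdorff_premeasure s r E \<le> ennreal e" if e: "e > 0" for e
    proof -
      have "((\<lambda>m. 2 powr s * real m powr (2 - s)) \<longlongrightarrow> 2 powr s * 0) sequentially"
        by (intro tendsto_mult tendsto_const tendsto_neg_powr filterlim_real_sequentially) (use s in auto)
      hence "eventually (\<lambda>m. 2 powr s * real m powr (2 - s) < e) sequentially"
        using e by (intro order_tendstoD) auto
      moreover have "((\<lambda>m. 2 / real m) \<longlongrightarrow> 0) sequentially"
        by (rule tendsto_divide_0[OF tendsto_const filterlim_at_top_imp_at_infinity[OF filterlim_real_sequentially]])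
      hence "eventually (\<lambda>m. 2 / real m < r) sequentially" using r by (intro order_tendstoD) auto
      ultimately have "eventually (\<lambda>m. 2 powr s * real m powr (2 - s) < e \<and> 2 / real m < r \<and> m > 0) sequentially"
        using eventually_gt_at_top[of "0::nat"] by eventually_elim auto
      then obtain m where m: "2 powr s * real m powr (2 - s) < e" "2 / real m < r" "m > 0"
        using eventually_happens by fastforce
      have "hausdorff_premeasure s r E \<le> (\<Sum>i. hausdorff_cost s (U m i))"
        unfolding hausdorff_premeasure_def
      proof (rule INF_lower, intro CollectI conjI allI)
        fix i
        show "bounded (U m i)" using bdd by (auto simp: U_def)
        show "diameter (U m i) \<le> r" using diam[OF m(3), of i] m r by (auto simp: U_def)
      qed (use cover m in auto)
      also have "\<dots> \<le> ennreal e" using cost[OF m(3)] m(1) by (meson ennreal_leI less_imp_le order_trans)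
      finally show ?thesis .
    qed
    thus ?thesis by (metis ennreal_0 ennreal_approx_unit ennreal_le_epsilon le_zero_eq add_0)
  qed
  thus ?thesis unfolding hausdorff_measure_def by (simp add: SUP_eq_const)
qed

lemma hausdorff_dim_eq_2:
  fixes G :: "(real \<times> real) set"
  assumes G: "G \<subseteq> {0..1} \<times> {0..1}" and pos: "\<And>s. 0 \<le> s \<Longrightarrow> s < 2 \<Longrightarrow> hausdorff_measure s G \<noteq> 0"
  shows "hausdorff_dim G = 2"
proof (rule antisym)
  show "hausdorff_dim G \<le> 2"
  proof (rule ennreal_le_epsilon)
    fix e :: real assume e: "0 < e"
    have "hausdorff_dim G \<le> ennreal (2 + e)" unfolding hausdorff_dim_def
      by (rule INF_lower) (use e hausdorff_measure_unit_square[OF G] in auto)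
    thus "hausdorff_dim G \<le> 2 + ennreal e" using e by (simp add: ennreal_plus)
  qed
  show "2 \<le> hausdorff_dim G" unfolding hausdorff_dim_def
  proof (rule INF_greatest)
    fix s assume "s \<in> {s. 0 \<le> s \<and> hausdorff_measure s G = 0}"
    hence "2 \<le> s" using pos[of s] by force
    hence "ennreal 2 \<le> ennreal s" by (rule ennreal_leI)
    thus "2 \<le> ennreal s" by simp
  qed
qed


section \<open>At most one obstruction per scale\<close>

text \<open>
  Only denominators in \<open>(S, T]\<close> are restricted, so that the condition can be imposed one block of
  denominators at a time; \<open>\<delta> = 0\<close> is the homogeneous case.
\<close>

definition badly_approx :: "real \<Rightarrow> real \<Rightarrow> real \<Rightarrow> real \<Rightarrow> real \<Rightarrow> bool" where
  "badly_approx c S T \<beta> \<delta> \<longleftrightarrow>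
     (\<forall>(q::int) (p::int). q \<ge> 1 \<longrightarrow> S < real_of_int q \<longrightarrow> real_of_int q \<le> T \<longrightarrow>
        c \<le> real_of_int q * \<bar>real_of_int q * \<beta> - real_of_int p - \<delta>\<bar>)"

lemma badly_approxD:
  "badly_approx c S T \<beta> \<delta> \<Longrightarrow> q \<ge> (1::int) \<Longrightarrow> S < real_of_int q \<Longrightarrow> real_of_int q \<le> T \<Longrightarrow> c \<le> real_of_int q * \<bar>real_of_int q * \<beta> - real_of_int p - \<delta>\<bar>"
  unfolding badly_approx_def by blast

lemma badly_approx_trans:
  "badly_approx c S T \<beta> \<delta> \<Longrightarrow> badly_approx c T U \<beta> \<delta> \<Longrightarrow> badly_approx c S U \<beta> \<delta>"
  unfolding badly_approx_def by (meson not_le)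

lemma badly_approx_mono:
  "badly_approx c S T \<beta> \<delta> \<Longrightarrow> c' \<le> c \<Longrightarrow> S \<le> S' \<Longrightarrow> T' \<le> T \<Longrightarrow> badly_approx c' S' T' \<beta> \<delta>"
  unfolding badly_approx_def by (meson order_trans le_less_trans)

lemma badly_approx_vacuous: "T < 1 \<Longrightarrow> badly_approx c S T \<beta> \<delta>"
  unfolding badly_approx_def
proof (intro allI impI)
  fix q p :: int assume "T < 1" "1 \<le> q" "real_of_int q \<le> T"
  hence "real_of_int q < 1" by linarith
  thus "c \<le> real_of_int q * \<bar>real_of_int q * \<beta> - real_of_int p - \<delta>\<bar>" using \<open>1 \<le> q\<close> by simp
qed

lemma badly_approx_nonzero:
  assumes "badly_approx c 0 T \<beta> 0" "k \<noteq> 0" "\<bar>real_of_int k\<bar> \<le> T"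
  shows "c \<le> \<bar>of_int k\<bar> * \<bar>of_int k * \<beta> - of_int p\<bar>"
proof (cases "k > 0")
  case True
  with badly_approxD[OF assms(1), of k p] assms(3) show ?thesis by auto
next
  case False
  with badly_approxD[OF assms(1), of "- k" "- p"] assms(2,3) show ?thesis
    by (auto simp: abs_minus_commute)
qed

text \<open>
  The cells to be avoided at one level lie in a window of width 2.  Two candidates at distance 4 per index are
  therefore enough to avoid them, and the spacing 8 separates the cells chosen for different indices.
\<close>

definition pick :: "(nat \<Rightarrow> bool) \<Rightarrow> nat \<Rightarrow> nat" where
  "pick P i = (if P (8 * i) then 8 * i else 8 * i + 4)"

lemma pick_works:
  assumes "\<And>d d'. d < K \<Longrightarrow> d' < K \<Longrightarrow> \<not> P d \<Longrightarrow> \<not> P d' \<Longrightarrow> \<bar>real d - real d'\<bar> \<le> 2" "8 * i + 4 < K"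
  shows "P (pick P i)"
  using assms(1)[of "8 * i" "8 * i + 4"] assms(2) by (auto simp: pick_def)

lemma pick_range: "8 * i \<le> pick P i" "pick P i \<le> 8 * i + 4"
  by (auto simp: pick_def)

lemma pick_separated:
  assumes "i \<noteq> j" shows "\<bar>real (pick P i) - real (pick P j)\<bar> \<ge> 4"
proof -
  have "pick P i + 4 \<le> pick P j \<or> pick P j + 4 \<le> pick P i"
    using assms pick_range[where i = i and P = P] pick_range[where i = j and P = P] by linarith
  thus ?thesis by linarith
qed

lemma distinct_fractions_gap:
  fixes p q p' q' :: int
  assumes q: "q \<ge> 1" "q' \<ge> 1" and ne: "p * q' \<noteq> p' * q"
  shows "1 / (real_of_int q * q') \<le> \<bar>p / q - p' / q'\<bar>"
proof -
  have "real_of_int 1 \<le> of_int \<bar>p * q' - p' * q\<bar>" using ne by (intro of_int_le_iff[THEN iffD2]) auto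
  hence "1 \<le> \<bar>real_of_int p * q' - p' * q\<bar>" by simp
  moreover have "p / q - p' / q' = (real_of_int p * q' - p' * q) / (real_of_int q * q')"
    using q by (simp add: field_simps)
  ultimately show ?thesis using q by (simp add: abs_mult divide_right_mono)
qed

text \<open>
  Distinct fractions with denominators at most \<open>X / 2\<close> are at least \<open>4 / X\<^sup>2\<close> apart, which is more than the
  length of the interval plus the excluded neighbourhoods.  So a single fraction is responsible for all bad
  cells, and its neighbourhood is no longer than one cell.
\<close>

lemma hom_step_window:
  fixes u a c R X :: real and d d' :: nat
  assumes R: "R \<ge> 1" and X: "X > 0" and a: "0 < a" "a * R \<le> 1 / 2" and c: "c \<le> a\<^sup>2 / (2 * R\<^sup>2)"
    and d: "real d + 1 \<le> R\<^sup>2" "real d' + 1 \<le> R\<^sup>2"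
    and bad: "\<not> (\<forall>\<beta>\<in>{u + d / (X * R)\<^sup>2 .. u + (real d + 1) / (X * R)\<^sup>2}. badly_approx c (a * X) (a * (X * R)) \<beta> 0)"
             "\<not> (\<forall>\<beta>\<in>{u + d' / (X * R)\<^sup>2 .. u + (real d' + 1) / (X * R)\<^sup>2}. badly_approx c (a * X) (a * (X * R)) \<beta> 0)"
  shows "\<bar>real d - real d'\<bar> \<le> 2"
proof -
  define s where "s = 1 / (X * R)\<^sup>2"
  have s0: "s > 0" using X R by (simp add: s_def)
  have X2: "R\<^sup>2 * s = 1 / X\<^sup>2" using X R by (simp add: s_def field_simps power2_eq_square)
  have near: "\<exists>\<beta> q p. u + d * s \<le> \<beta> \<and> \<beta> \<le> u + (real d + 1) * s \<and> q \<ge> (1::int) \<and> q \<le> a * (X * R) \<and> \<bar>\<beta> - of_int p / q\<bar> < s / 2"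
    if "\<not> (\<forall>\<beta>\<in>{u + d / (X * R)\<^sup>2 .. u + (real d + 1) / (X * R)\<^sup>2}. badly_approx c (a * X) (a * (X * R)) \<beta> 0)" for d :: nat
  proof -
    from that obtain \<beta> p q where h: "\<beta> \<in> {u + d / (X * R)\<^sup>2 .. u + (real d + 1) / (X * R)\<^sup>2}"
      "q \<ge> (1::int)" "a * X < q" "q \<le> a * (X * R)" "q * \<bar>q * \<beta> - of_int p - 0\<bar> < c"
      unfolding badly_approx_def by (simp only: Ball_def not_all not_imp not_le) blast
    have "\<bar>q * \<beta> - p\<bar> = q * \<bar>\<beta> - p / q\<bar>"
    proof -
      have "q * \<beta> - p = q * (\<beta> - p / q)" using h(2) by (simp add: field_simps)
      thus ?thesis using h(2) by (simp only: abs_mult)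
    qed
    with h(5) have "real_of_int q ^ 2 * \<bar>\<beta> - p / q\<bar> < c" by (simp add: power2_eq_square mult.assoc)
    moreover have "(a * X)\<^sup>2 * \<bar>\<beta> - p / q\<bar> \<le> real_of_int q ^ 2 * \<bar>\<beta> - p / q\<bar>"
      using h(3) a X by (intro mult_right_mono power_mono) auto
    ultimately have "(a * X)\<^sup>2 * \<bar>\<beta> - p / q\<bar> < a\<^sup>2 / (2 * R\<^sup>2)" using c by linarith
    hence "\<bar>\<beta> - p / q\<bar> < s / 2" using a X R by (simp add: s_def field_simps power_mult_distrib)
    with h show ?thesis by - (rule exI[of _ \<beta>], rule exI[of _ q], rule exI[of _ p], auto simp: s_def)
  qed
  obtain \<beta> q p where 1: "u + d * s \<le> \<beta>" "\<beta> \<le> u + (real d + 1) * s" "q \<ge> (1::int)" "q \<le> a * (X * R)" "\<bar>\<beta> - of_int p / q\<bar> < s / 2"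
    using near[OF bad(1)] by blast
  obtain \<beta>' q' p' where 2: "u + d' * s \<le> \<beta>'" "\<beta>' \<le> u + (real d' + 1) * s" "q' \<ge> (1::int)" "q' \<le> a * (X * R)" "\<bar>\<beta>' - of_int p' / q'\<bar> < s / 2"
    using near[OF bad(2)] by blast
  have "(real d + 1) * s \<le> R\<^sup>2 * s" "(real d' + 1) * s \<le> R\<^sup>2 * s" using d s0 by (auto intro: mult_right_mono)
  moreover have "0 \<le> d * s" "0 \<le> d' * s" using s0 by auto
  ultimately have bb: "\<bar>\<beta> - \<beta>'\<bar> \<le> R\<^sup>2 * s" using 1 2 by linarith
  have "s \<le> R\<^sup>2 * s" using R s0 by simp
  hence near2: "\<bar>p / q - p' / q'\<bar> < 2 * (R\<^sup>2 * s)" using bb 1 2 by linarith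
  have "p * q' = p' * q"
  proof (rule ccontr)
    assume ne: "p * q' \<noteq> p' * q"
    have "a * (X * R) \<le> X / 2" using a X mult_right_mono[of "a * R" "1/2" X] by (simp add: mult_ac)
    hence "real_of_int q \<le> X / 2" "real_of_int q' \<le> X / 2" using 1 2 by auto
    hence "real_of_int q * q' \<le> X / 2 * (X / 2)" using 1 2 by (intro mult_mono) auto
    hence "1 / (X / 2 * (X / 2)) \<le> 1 / (real_of_int q * q')" using 1 2 X by (intro divide_left_mono) auto
    also have "\<dots> \<le> \<bar>p / q - p' / q'\<bar>" by (rule distinct_fractions_gap) (use 1 2 ne in auto)
    also have "\<dots> < 2 / X\<^sup>2" using near2 X2 by simp
    finally show False using X by (simp add: power2_eq_square field_simps)
  qed
  hence "of_int p / real_of_int q = of_int p' / of_int q'" using 1 2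
    by (simp add: frac_eq_eq) (metis of_int_mult)
  hence "\<bar>\<beta> - \<beta>'\<bar> < s" using 1 2 by linarith
  hence "real d * s - (real d' + 1) * s < s" "real d' * s - (real d + 1) * s < s" using 1 2 by (auto simp: algebra_simps)
  hence "(real d - real d' - 1) * s < 1 * s" "(real d' - real d - 1) * s < 1 * s" by (auto simp: algebra_simps)
  hence "real d - real d' - 1 < 1" "real d' - real d - 1 < 1" using s0 by (auto simp: mult_less_cancel_right)
  thus ?thesis by linarith
qed

text \<open>
  Subtracting two near-coincidences \<open>q * \<beta> - p \<approx> \<delta>\<close> and \<open>q' * \<beta> - p' \<approx> \<delta>\<close> makes
  \<open>(q - q') * \<beta> - (p - p')\<close> smaller than the homogeneous condition permits for \<open>\<bar>q - q'\<bar> \<le> b * X * R\<close>.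
  So a single pair \<open>(p, q)\<close> is responsible for all bad cells, and \<open>q * \<beta> - p\<close> moves by less than a cell while
  \<open>\<beta>\<close> runs through \<open>I\<close>.  The choice \<open>b = c / (4 * R)\<close> makes the two estimates clash.
\<close>

lemma inhom_step_window:
  fixes v a b c R X :: real and d d' :: nat and I :: "real set"
  assumes R: "R \<ge> 1" and X: "X \<ge> 3" and b: "b = c / (4 * R)" "b \<le> a" "c > 0" "c \<le> 1" and c1: "c1 \<le> b / (4 * R)"
    and I: "\<And>\<beta> \<beta>'. \<beta> \<in> I \<Longrightarrow> \<beta>' \<in> I \<Longrightarrow> \<bar>\<beta> - \<beta>'\<bar> \<le> 1 / (X * R)\<^sup>2"
    and hom: "\<And>\<beta>. \<beta> \<in> I \<Longrightarrow> badly_approx c 0 (a * (X * R)) \<beta> 0"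
    and d: "real d + 1 \<le> R" "real d' + 1 \<le> R"
    and bad: "\<not> (\<forall>\<delta>\<in>{v + d / (X * R) .. v + (real d + 1) / (X * R)}. \<forall>\<beta>\<in>I. badly_approx c1 (b * X) (b * (X * R)) \<beta> \<delta>)"
             "\<not> (\<forall>\<delta>\<in>{v + d' / (X * R) .. v + (real d' + 1) / (X * R)}. \<forall>\<beta>\<in>I. badly_approx c1 (b * X) (b * (X * R)) \<beta> \<delta>)"
  shows "\<bar>real d - real d'\<bar> \<le> 2"
proof -
  define s where "s = 1 / (X * R)"
  have s0: "s > 0" using X R by (simp add: s_def)
  have Rs: "R * s = 1 / X" using X R by (simp add: s_def)
  have b0: "b > 0" using b R by simp
  have b4: "b \<le> 1 / 4" using b R by (simp add: divide_le_eq)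
  have near: "\<exists>\<delta> \<beta> q p. v + d * s \<le> \<delta> \<and> \<delta> \<le> v + (real d + 1) * s \<and> \<beta> \<in> I \<and> q \<ge> (1::int) \<and> q \<le> b * (X * R) \<and> \<bar>q * \<beta> - of_int p - \<delta>\<bar> < s / 4"
    if "\<not> (\<forall>\<delta>\<in>{v + d / (X * R) .. v + (real d + 1) / (X * R)}. \<forall>\<beta>\<in>I. badly_approx c1 (b * X) (b * (X * R)) \<beta> \<delta>)" for d :: nat
  proof -
    from that obtain \<delta> \<beta> p q where h: "\<delta> \<in> {v + d / (X * R) .. v + (real d + 1) / (X * R)}" "\<beta> \<in> I"
      "q \<ge> (1::int)" "b * X < q" "q \<le> b * (X * R)" "q * \<bar>q * \<beta> - of_int p - \<delta>\<bar> < c1"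
      unfolding badly_approx_def by (simp only: Ball_def not_all not_imp not_le) blast
    have "(b * X) * \<bar>q * \<beta> - p - \<delta>\<bar> \<le> q * \<bar>q * \<beta> - p - \<delta>\<bar>" using h by (intro mult_right_mono) auto
    hence "(b * X) * \<bar>q * \<beta> - p - \<delta>\<bar> < b / (4 * R)" using h c1 by linarith
    hence "\<bar>q * \<beta> - p - \<delta>\<bar> < s / 4" using b0 X R by (simp add: s_def field_simps)
    with h show ?thesis by - (rule exI[of _ \<delta>], rule exI[of _ \<beta>], rule exI[of _ q], rule exI[of _ p], auto simp: s_def)
  qed
  obtain \<delta> \<beta> q p where 1: "v + d * s \<le> \<delta>" "\<delta> \<le> v + (real d + 1) * s" "\<beta> \<in> I" "q \<ge> (1::int)" "q \<le> b * (X * R)" "\<bar>q * \<beta> - of_int p - \<delta>\<bar> < s / 4"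
    using near[OF bad(1)] by blast
  obtain \<delta>' \<beta>' q' p' where 2: "v + d' * s \<le> \<delta>'" "\<delta>' \<le> v + (real d' + 1) * s" "\<beta>' \<in> I" "q' \<ge> (1::int)" "q' \<le> b * (X * R)" "\<bar>q' * \<beta>' - of_int p' - \<delta>'\<bar> < s / 4"
    using near[OF bad(2)] by blast
  have qb: "q * \<bar>\<beta> - \<beta>'\<bar> \<le> s / 4"
  proof -
    have "q * \<bar>\<beta> - \<beta>'\<bar> \<le> (b * (X * R)) * (1 / (X * R)\<^sup>2)" using 1 2 I[of \<beta> \<beta>'] b0 X R by (intro mult_mono) auto
    also have "\<dots> = b * s" using X R by (simp add: s_def power2_eq_square)
    also have "\<dots> \<le> 1 / 4 * s" using b4 s0 by (intro mult_right_mono) auto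
    finally show ?thesis by simp
  qed
  have qb': "\<bar>q * (\<beta> - \<beta>')\<bar> \<le> s / 4" using qb 1 by (simp add: abs_mult)
  have "(real d + 1) * s \<le> R * s" "(real d' + 1) * s \<le> R * s" using d s0 by (auto intro: mult_right_mono)
  moreover have "0 \<le> d * s" "0 \<le> d' * s" using s0 by auto
  ultimately have dd: "\<bar>\<delta> - \<delta>'\<bar> \<le> R * s" using 1 2 by linarith
  have eq: "(q - q') * \<beta>' - (p - p') = (q * \<beta> - p - \<delta>) - (q' * \<beta>' - p' - \<delta>') - q * (\<beta> - \<beta>') + (\<delta> - \<delta>')"
    by (simp add: algebra_simps)
  have sR: "s \<le> R * s" using R s0 by simp
  have close: "\<bar>(q - q') * \<beta>' - (p - p')\<bar> < 2 * (R * s)"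
    unfolding eq using 1 2 qb' dd sR s0 by linarith
  have qq: "q = q'"
  proof (rule ccontr)
    assume ne: "q \<noteq> q'"
    have le: "\<bar>real_of_int (q - q')\<bar> \<le> b * (X * R)" using 1 2 by auto
    also have "b * (X * R) \<le> a * (X * R)" using b X R by (intro mult_right_mono) auto
    finally have "c \<le> \<bar>of_int (q - q')\<bar> * \<bar>of_int (q - q') * \<beta>' - of_int (p - p')\<bar>"
      by (intro badly_approx_nonzero[OF hom]) (use 2 ne in auto)
    also have "\<dots> \<le> (b * (X * R)) * (2 * (R * s))"
      using le close b0 X R by (intro mult_mono) auto
    also have "\<dots> = c / 2" using b X R by (simp add: s_def)
    finally show False using b by simp
  qed
  have "p = p'"
  proof -
    have "\<bar>real_of_int (p - p')\<bar> < 2 * (R * s)" using close qq by simp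
    also have "\<dots> \<le> 1" using X Rs by simp
    finally have "\<bar>p - p'\<bar> < 1" by linarith
    thus ?thesis by simp
  qed
  hence "real_of_int (q - q') * \<beta>' - real_of_int (p - p') = 0" using qq by simp
  with eq have "\<delta> - \<delta>' = (q' * \<beta>' - p' - \<delta>') - (q * \<beta> - p - \<delta>) + q * (\<beta> - \<beta>')" by linarith
  hence "\<bar>\<delta> - \<delta>'\<bar> < s" using 1 2 qb' s0 by linarith
  hence "real d * s - (real d' + 1) * s < s" "real d' * s - (real d + 1) * s < s" using 1 2 by (auto simp: algebra_simps)
  hence "(real d - real d' - 1) * s < 1 * s" "(real d' - real d - 1) * s < 1 * s" by (auto simp: algebra_simps)
  hence "real d - real d' - 1 < 1" "real d' - real d - 1 < 1" using s0 by (auto simp: mult_less_cancel_right)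
  thus ?thesis by linarith
qed

text \<open>
  When the order \<open>H\<close> increases, the mediant is inserted as soon as its denominator is admitted.
\<close>

lemma farey_neighbours:
  fixes \<beta> :: real and H :: nat
  assumes "H \<ge> 1"
  shows "\<exists>(P::int) (Q::int) (P'::int) (Q'::int). Q \<ge> (1::int) \<and> Q' \<ge> (1::int) \<and> Q \<le> H \<and> Q' \<le> H \<and> Q + Q' > H \<and>
           P' * Q - P * Q' = (1::int) \<and> P / Q \<le> \<beta> \<and> \<beta> \<le> P' / Q'"
  using assms
proof (induction H rule: nat_induct_at_least)
  case base
  show ?case by (rule exI[of _ "\<lfloor>\<beta>\<rfloor>"], rule exI[of _ 1], rule exI[of _ "\<lfloor>\<beta>\<rfloor> + 1"], rule exI[of _ 1]) (auto; linarith)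
next
  case (Suc H)
  then obtain P Q P' Q' :: int where h: "Q \<ge> 1" "Q' \<ge> 1" "Q \<le> H" "Q' \<le> H" "Q + Q' > H"
    "P' * Q - P * Q' = 1" "P / Q \<le> \<beta>" "\<beta> \<le> P' / Q'" by blast
  show ?case
  proof (cases "Q + Q' > Suc H")
    case True
    with h show ?thesis by (intro exI[of _ P] exI[of _ Q] exI[of _ P'] exI[of _ Q']) auto
  next
    case False
    show ?thesis
    proof (cases "real_of_int (P + P') / real_of_int (Q + Q') \<le> \<beta>")
      case True
      with h False show ?thesis
        by (intro exI[of _ "P + P'"] exI[of _ "Q + Q'"] exI[of _ P'] exI[of _ Q']) (auto simp: algebra_simps)
    next
      case F2: False
      with h False show ?thesis
        by (intro exI[of _ P] exI[of _ Q] exI[of _ "P + P'"] exI[of _ "Q + Q'"]) (auto simp: algebra_simps)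
    qed
  qed
qed


section \<open>Continued fraction words\<close>

text \<open>
  A pair of integers is read as the linear form with these coefficients, and two pairs \<open>v\<close>, \<open>V\<close> as the
  Moebius transformation \<open>x \<mapsto> lin v x / lin V x\<close> with determinant \<open>det2 v V\<close>.
\<close>

definition lin :: "int \<times> int \<Rightarrow> real \<Rightarrow> real" where
  "lin v x = of_int (fst v) + of_int (snd v) * x"

definition det2 :: "int \<times> int \<Rightarrow> int \<times> int \<Rightarrow> int" where
  "det2 v V = snd v * fst V - fst v * snd V"

text \<open>
  Applied to both \<open>v\<close> and \<open>V\<close>, this composes the Moebius transformation with \<open>x \<mapsto> 1 / (a + x)\<close>; on
  the pair of denominators it is the recursion for the denominators of convergents.
\<close>

definition cf_step :: "int \<Rightarrow> int \<times> int \<Rightarrow> int \<times> int" where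
  "cf_step a v = (a * fst v + snd v, fst v)"

fun cf_word :: "int list \<Rightarrow> int \<times> int \<Rightarrow> int \<times> int" where
  "cf_word [] v = v"
| "cf_word (a # w) v = cf_word w (cf_step a v)"

fun cf_value :: "int list \<Rightarrow> real \<Rightarrow> real" where
  "cf_value [] x = x"
| "cf_value (a # w) x = 1 / (of_int a + cf_value w x)"

definition words :: "nat \<Rightarrow> int list set" where
  "words l = {w. set w \<subseteq> {1, 2} \<and> length w = l}"

lemma words_finite: "finite (words l)" and words_card: "card (words l) = 2 ^ l"
  unfolding words_def using finite_lists_length_eq[of "{1, 2::int}" l] card_lists_length_eq[of "{1, 2::int}" l]
  by (auto simp: numeral_2_eq_2)

lemma lin_pos: "1 \<le> fst V \<Longrightarrow> 1 \<le> snd V \<Longrightarrow> 0 \<le> x \<Longrightarrow> lin V x \<ge> 1"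
  unfolding lin_def by (smt (verit) mult_nonneg_nonneg of_int_1_le_iff)

lemma cf_word_append: "cf_word (u @ w) v = cf_word w (cf_word u v)"
  by (induction u arbitrary: v) auto

lemma det2_cf_word: "det2 (cf_word w v) (cf_word w V) = (-1) ^ length w * det2 v V"
proof (induction w arbitrary: v V)
  case (Cons a w)
  have "det2 (cf_step a v) (cf_step a V) = - det2 v V" by (simp add: det2_def cf_step_def algebra_simps)
  thus ?case by (simp add: Cons)
qed auto

lemma cf_value_range: "set w \<subseteq> {1, 2} \<Longrightarrow> x \<in> {1/3..1} \<Longrightarrow> cf_value w x \<in> {1/3..1}"
proof (induction w)
  case (Cons a w)
  hence y: "cf_value w x \<in> {1/3..1}" and a: "a = 1 \<or> a = 2" by auto
  thus ?case by (auto simp: divide_simps)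
qed auto

lemma lin_cf_word:
  assumes "set w \<subseteq> {1, 2}" "x \<in> {1/3..1}"
  shows "\<exists>k>0. \<forall>v. lin (cf_word w v) x = k * lin v (cf_value w x)"
  using assms(1)
proof (induction w)
  case Nil
  show ?case by (auto intro: exI[of _ 1])
next
  case (Cons a w)
  then obtain k where k: "k > 0" "\<And>v. lin (cf_word w v) x = k * lin v (cf_value w x)" by auto
  have y: "cf_value w x \<in> {1/3..1}" using cf_value_range[OF _ assms(2), of w] Cons by auto
  have a: "a = 1 \<or> a = 2" using Cons by auto
  hence pos: "of_int a + cf_value w x > 0" using y by auto
  have "lin (cf_step a v) (cf_value w x) = (of_int a + cf_value w x) * lin v (1 / (of_int a + cf_value w x))" for v
    using pos by (simp add: lin_def cf_step_def field_simps)
  thus ?case using k pos by (intro exI[of _ "k * (of_int a + cf_value w x)"]) (auto simp: mult_ac)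
qed

lemma cf_word_value:
  assumes "set w \<subseteq> {1, 2}" "x \<in> {1/3..1}"
  shows "lin (cf_word w v) x / lin (cf_word w V) x = lin v (cf_value w x) / lin V (cf_value w x)"
proof -
  obtain k where "k > 0" "\<forall>v. lin (cf_word w v) x = k * lin v (cf_value w x)"
    using lin_cf_word[OF assms] by blast
  hence k: "k > 0" "\<And>v. lin (cf_word w v) x = k * lin v (cf_value w x)" by auto
  show ?thesis unfolding k(2) using k(1) by simp
qed

lemma cf_word_bounds:
  assumes "set w \<subseteq> {1, 2}" "1 \<le> snd V" "snd V \<le> fst V"
  shows "snd V \<le> snd (cf_word w V)" "snd (cf_word w V) \<le> fst (cf_word w V)"
    "fst V \<le> fst (cf_word w V)" "fst (cf_word w V) \<le> 3 ^ length w * fst V"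
proof -
  have "snd V \<le> snd (cf_word w V) \<and> snd (cf_word w V) \<le> fst (cf_word w V) \<and>
    fst V \<le> fst (cf_word w V) \<and> fst (cf_word w V) \<le> 3 ^ length w * fst V"
    using assms
  proof (induction w arbitrary: V)
    case (Cons a w)
    hence a: "a = 1 \<or> a = 2" by auto
    have s: "1 \<le> snd (cf_step a V)" "snd (cf_step a V) \<le> fst (cf_step a V)" "snd V \<le> snd (cf_step a V)"
      "fst V \<le> fst (cf_step a V)" "fst (cf_step a V) \<le> 3 * fst V"
      using Cons.prems a by (auto simp: cf_step_def)
    from Cons.IH[OF _ s(1,2)] Cons.prems have IH: "snd (cf_step a V) \<le> snd (cf_word w (cf_step a V))"
      "snd (cf_word w (cf_step a V)) \<le> fst (cf_word w (cf_step a V))"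
      "fst (cf_step a V) \<le> fst (cf_word w (cf_step a V))"
      "fst (cf_word w (cf_step a V)) \<le> 3 ^ length w * fst (cf_step a V)" by auto
    note IH(4)
    also have "3 ^ length w * fst (cf_step a V) \<le> 3 ^ length w * (3 * fst V)" using s by (intro mult_left_mono) auto
    also have "\<dots> = 3 ^ length (a # w) * fst V" by simp
    finally have "fst (cf_word w (cf_step a V)) \<le> 3 ^ length (a # w) * fst V" .
    with IH s show ?case by auto
  qed auto
  thus "snd V \<le> snd (cf_word w V)" "snd (cf_word w V) \<le> fst (cf_word w V)"
    "fst V \<le> fst (cf_word w V)" "fst (cf_word w V) \<le> 3 ^ length w * fst V" by auto
qed

lemma bilinear_identity:
  fixes f :: real
  shows "(f * t + s * b) * (g + h * x) - (g * t + h * b) * (f + s * x) = (h * f - g * s) * (t * x - b)"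
  by (simp add: algebra_simps)

text \<open>
  Here \<open>b / t\<close> is the preimage of \<open>p / q\<close> under the Moebius transformation.  The error \<open>q * \<beta> - p\<close> at the
  image of \<open>x\<close> is the error \<open>t * x - b\<close> at \<open>x\<close>, up to the factor \<open>lin V x\<close>.
\<close>

lemma unimodular_coordinates:
  fixes p q :: int
  assumes det: "\<bar>det2 v V\<bar> = 1"
  obtains t b :: int where "q = fst V * t + snd V * b"
    "\<And>x::real. lin V x > 0 \<Longrightarrow> \<bar>real_of_int q * (lin v x / lin V x) - p\<bar> = \<bar>t * x - b\<bar> / lin V x"
proof -
  define e where "e = det2 v V"
  have e: "e * e = 1" "real_of_int e = 1 \<or> real_of_int e = -1" using det by (auto simp: e_def abs_if split: if_splits)
  define t where "t = e * (snd v * q - snd V * p)"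
  define b where "b = e * (fst V * p - fst v * q)"
  have q: "q = fst V * t + snd V * b"
  proof -
    have "fst V * t + snd V * b = e * (e * q)" by (simp add: t_def b_def e_def det2_def algebra_simps)
    thus ?thesis using e by (metis mult.assoc mult_1)
  qed
  have p: "p = fst v * t + snd v * b"
  proof -
    have "fst v * t + snd v * b = e * (e * p)" by (simp add: t_def b_def e_def det2_def algebra_simps)
    thus ?thesis using e by (metis mult.assoc mult_1)
  qed
  show ?thesis
  proof (rule that[OF q])
    fix x :: real assume pos: "lin V x > 0"
    have qr: "real_of_int q = of_int (fst V) * of_int t + of_int (snd V) * of_int b"
      and pr: "real_of_int p = of_int (fst v) * of_int t + of_int (snd v) * of_int b"
      by (simp_all add: q p)
    have ee: "real_of_int e = of_int (snd v) * of_int (fst V) - of_int (fst v) * of_int (snd V)"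
      by (simp add: e_def det2_def)
    have "q * lin v x - p * lin V x = e * (t * x - b)"
      unfolding ee qr pr lin_def by (rule bilinear_identity)
    hence "q * (lin v x / lin V x) - p = e * (t * x - b) / lin V x" using pos by (simp add: field_simps)
    thus "\<bar>q * (lin v x / lin V x) - p\<bar> = \<bar>t * x - b\<bar> / lin V x" using e pos by (auto simp: abs_mult)
  qed
qed

text \<open>
  A denominator below that of the mediant cannot have two positive coordinates, and coordinates of different
  signs cannot cancel in \<open>t * x - b\<close>.
\<close>

lemma below_mediant:
  fixes p q :: int
  assumes det: "\<bar>det2 v V\<bar> = 1" and V: "1 \<le> fst V" "1 \<le> snd V" and x: "0 < x" "x \<le> 1"
    and q: "1 \<le> q" "q < fst V + snd V"
  shows "x / lin V x \<le> \<bar>q * (lin v x / lin V x) - p\<bar>"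
proof -
  have L: "0 < lin V x" using lin_pos[OF V, of x] x by linarith
  obtain t b :: int where tb0: "q = fst V * t + snd V * b"
    "\<And>x::real. lin V x > 0 \<Longrightarrow> \<bar>real_of_int q * (lin v x / lin V x) - p\<bar> = \<bar>t * x - b\<bar> / lin V x"
    using unimodular_coordinates[OF det, of q p] by blast
  note tb = tb0(1) tb0(2)[OF L]
  have "\<not> (t \<ge> 1 \<and> b \<ge> 1)"
  proof
    assume "t \<ge> 1 \<and> b \<ge> 1"
    hence "fst V * 1 + snd V * 1 \<le> fst V * t + snd V * b" using V by (intro add_mono mult_left_mono) auto
    thus False using q tb by auto
  qed
  moreover have "\<not> (t \<le> 0 \<and> b \<le> 0)"
  proof
    assume "t \<le> 0 \<and> b \<le> 0"
    hence "fst V * t \<le> 0" "snd V * b \<le> 0" using V by (auto simp: mult_nonneg_nonpos)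
    thus False using q tb by auto
  qed
  ultimately have "(t \<ge> 1 \<and> b \<le> 0) \<or> (t \<le> 0 \<and> b \<ge> 1)" by linarith
  hence "x \<le> \<bar>t * x - b\<bar>"
  proof
    assume h: "t \<ge> 1 \<and> b \<le> 0"
    hence "1 * x \<le> t * x" "real_of_int b \<le> 0" using x by (auto intro!: mult_right_mono)
    thus ?thesis by linarith
  next
    assume h: "t \<le> 0 \<and> b \<ge> 1"
    hence "t * x \<le> 0" "real_of_int b \<ge> 1" using x by (auto simp: mult_nonpos_nonneg)
    thus ?thesis using x by linarith
  qed
  thus ?thesis using tb lin_pos[OF V, of x] x by (auto intro: divide_right_mono)
qed

text \<open>
  For denominators from \<open>fst V\<close> on, bad approximability passes from \<open>x\<close> to its image: coordinates of equal sign
  satisfy \<open>t \<le> q / fst V\<close>, and for those of different signs \<open>\<bar>t * x - b\<bar> \<ge> 1\<close>.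
\<close>

lemma badly_approx_transfer:
  fixes p q :: int and c T x :: real
  assumes det: "\<bar>det2 v V\<bar> = 1" and V: "1 \<le> snd V" "snd V \<le> fst V" and x: "0 < x" "x \<le> 1"
    and c: "0 \<le> c" "c \<le> 1" and good: "badly_approx c 0 T x 0"
    and q: "fst V \<le> q" "real_of_int q \<le> real_of_int (fst V) * T"
  shows "c / 2 \<le> real_of_int q * \<bar>q * (lin v x / lin V x) - p\<bar>"
proof -
  have V1: "1 \<le> fst V" using V by simp
  have L: "0 < lin V x" using lin_pos[OF V1 V(1), of x] x by linarith
  have L2: "lin V x \<le> 2 * fst V"
  proof -
    have "snd V * x \<le> real_of_int (fst V) * 1" using V x by (intro mult_mono) auto
    thus ?thesis by (simp add: lin_def)
  qed
  obtain t b :: int where tb0: "q = fst V * t + snd V * b"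
    "\<And>x::real. lin V x > 0 \<Longrightarrow> \<bar>real_of_int q * (lin v x / lin V x) - p\<bar> = \<bar>t * x - b\<bar> / lin V x"
    using unimodular_coordinates[OF det, of q p] by blast
  note tb = tb0(1) tb0(2)[OF L]
  have main: "c * fst V \<le> q * \<bar>t * x - b\<bar>"
  proof (cases "t \<ge> 1 \<and> b \<ge> 0")
    case True
    hence "fst V * t \<le> q" using tb V by auto
    hence le: "real_of_int (fst V) * t \<le> q" by (metis of_int_le_iff of_int_mult)
    hence "fst V * real_of_int t \<le> fst V * T" using q by linarith
    hence "t \<le> T" using V1 by simp
    hence "c \<le> t * \<bar>t * x - b - 0\<bar>" using True by (intro badly_approxD[OF good]) auto
    hence "c * fst V \<le> (fst V * t) * \<bar>t * x - b\<bar>" using V1 by (simp add: mult_ac mult_left_mono)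
    also have "\<dots> \<le> q * \<bar>t * x - b\<bar>" using le by (intro mult_right_mono) auto
    finally show ?thesis .
  next
    case False
    have "\<not> (t \<le> 0 \<and> b \<le> 0)"
    proof
      assume "t \<le> 0 \<and> b \<le> 0"
      hence "fst V * t \<le> 0" "snd V * b \<le> 0" using V by (auto simp: mult_nonneg_nonpos)
      thus False using q tb V by auto
    qed
    with False have "(t \<ge> 1 \<and> b \<le> -1) \<or> (t \<le> 0 \<and> b \<ge> 1)" by linarith
    hence "1 \<le> \<bar>t * x - b\<bar>"
    proof
      assume h: "t \<ge> 1 \<and> b \<le> -1"
      hence "0 \<le> t * x" "real_of_int b \<le> -1" using x by auto
      thus ?thesis by linarith
    next
      assume h: "t \<le> 0 \<and> b \<ge> 1"
      hence "t * x \<le> 0" "real_of_int b \<ge> 1" using x by (auto simp: mult_nonpos_nonneg)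
      thus ?thesis by linarith
    qed
    hence "real_of_int (fst V) * 1 \<le> q * \<bar>t * x - b\<bar>" using q V1 by (intro mult_mono) auto
    moreover have "c * real_of_int (fst V) \<le> 1 * real_of_int (fst V)" using c V1 by (intro mult_right_mono) auto
    ultimately show ?thesis by linarith
  qed
  have "c / 2 * lin V x \<le> c / 2 * (2 * fst V)" using c L2 by (intro mult_left_mono) auto
  hence "c / 2 * lin V x \<le> q * \<bar>t * x - b\<bar>" using main by simp
  thus ?thesis using tb L by (simp add: field_simps)
qed

text \<open>
  The successive prefixes of \<open>w\<close> have pairs of denominators \<open>(Q, Q')\<close> whose ranges \<open>[Q / 2, Q + Q')\<close> cover,
  one after the other, all denominators up to those of \<open>w\<close> itself; on each range \<open>below_mediant\<close> applies.
\<close>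

lemma badly_approx_word:
  fixes p q :: int
  assumes "\<bar>det2 v V\<bar> = 1" "1 \<le> snd V" "snd V \<le> fst V" "set w \<subseteq> {1, 2}" and x: "x \<in> {1/3..1}"
    and "fst V \<le> 2 * q" "q < fst (cf_word w V) + snd (cf_word w V)"
  shows "1 / 12 \<le> q * \<bar>q * (lin (cf_word w v) x / lin (cf_word w V) x) - p\<bar>"
  using assms(1-4) assms(6,7)
proof (induction w arbitrary: v V)
  have base: "1 / 12 \<le> q * \<bar>q * (lin v y / lin V y) - p\<bar>"
    if h: "\<bar>det2 v V\<bar> = 1" "1 \<le> snd V" "snd V \<le> fst V" "fst V \<le> 2 * q" "q < fst V + snd V" "y \<in> {1/3..1}" for v V y
  proof -
    have L: "0 < lin V y" using lin_pos[of V y] h by auto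
    have "snd V * y \<le> real_of_int (fst V) * 1" using h by (intro mult_mono) auto
    hence L2: "lin V y \<le> 2 * fst V" by (simp add: lin_def)
    have "y / lin V y \<le> \<bar>q * (lin v y / lin V y) - p\<bar>" by (rule below_mediant) (use h in auto)
    moreover have "(1/3) / (2 * fst V) \<le> y / lin V y" using h L L2 by (intro frac_le) auto
    ultimately have *: "1 / (6 * fst V) \<le> \<bar>q * (lin v y / lin V y) - p\<bar>" by simp
    have q2: "real_of_int (fst V) / 2 \<le> q" using h by linarith
    have "1 / 12 = (fst V / 2) * (1 / (6 * fst V))" using h by simp
    also have "\<dots> \<le> q * \<bar>q * (lin v y / lin V y) - p\<bar>" using * q2 h by (intro mult_mono) auto
    finally show ?thesis .
  qed
  {
    case Nil
    show ?case using base[of v V x] Nil x by simp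
  next
    case (Cons a w)
    have a: "a = 1 \<or> a = 2" using Cons by auto
    have d: "\<bar>det2 (cf_step a v) (cf_step a V)\<bar> = 1"
      using Cons.prems(1) by (simp add: det2_def cf_step_def algebra_simps abs_if split: if_splits)
    show ?case
    proof (cases "q < fst V + snd V")
      case True
      show ?thesis
        by (subst cf_word_value[OF Cons.prems(4) x], rule base) (use Cons.prems True cf_value_range[OF Cons.prems(4) x] in auto)
    next
      case False
      have "1 / 12 \<le> q * \<bar>q * (lin (cf_word w (cf_step a v)) x / lin (cf_word w (cf_step a V)) x) - p\<bar>"
        by (rule Cons.IH[OF d]) (use Cons.prems a False in \<open>auto simp: cf_step_def\<close>)
      thus ?thesis by simp
    qed
  }
qed

text \<open>
  The digits are recovered from the end.  If the pairs of denominators nearly agree, then so do the last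
  digits, since otherwise one of the smaller denominators would be as small as the error; undoing the common
  digit at most triples the error.
\<close>

lemma words_separated:
  fixes \<sigma> :: real
  assumes V: "1 \<le> snd V" "snd V \<le> fst V" and w: "w \<in> words l" "w' \<in> words l"
    and s: "5 * 3 ^ l * \<sigma> \<le> real_of_int (snd V)"
    and close: "\<bar>real_of_int (fst (cf_word w V)) - fst (cf_word w' V)\<bar> < \<sigma>"
      "\<bar>real_of_int (snd (cf_word w V)) - snd (cf_word w' V)\<bar> < \<sigma>"
  shows "w = w'"
  using w s close
proof (induction l arbitrary: w w' \<sigma>)
  case 0
  thus ?case by (simp add: words_def)
next
  case (Suc l)
  obtain u a where w: "w = u @ [a]" "u \<in> words l" "a \<in> {1, 2}"
    using Suc.prems(1) unfolding words_def by (cases w rule: rev_cases) auto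
  obtain u' a' where w': "w' = u' @ [a']" "u' \<in> words l" "a' \<in> {1, 2}"
    using Suc.prems(2) unfolding words_def by (cases w' rule: rev_cases) auto
  define A B A' B' where AB: "A = real_of_int (fst (cf_word u V))" "B = real_of_int (snd (cf_word u V))"
    "A' = real_of_int (fst (cf_word u' V))" "B' = real_of_int (snd (cf_word u' V))"
  have c: "\<bar>(a * A + B) - (a' * A' + B')\<bar> < \<sigma>" "\<bar>A - A'\<bar> < \<sigma>"
    using Suc.prems(4,5) by (auto simp: w w' AB cf_word_append cf_step_def)
  have ord: "B \<le> A" "B' \<le> A'" "real_of_int (snd V) \<le> B" "real_of_int (snd V) \<le> B'"
    using cf_word_bounds(1,2)[OF _ V, of u] cf_word_bounds(1,2)[OF _ V, of u'] w w' by (auto simp: AB words_def)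
  have \<sigma>0: "\<sigma> > 0" using c by linarith
  have "15 * \<sigma> * 1 \<le> 15 * \<sigma> * 3 ^ l" using \<sigma>0 by (intro mult_left_mono) auto
  hence big: "15 * \<sigma> \<le> real_of_int (snd V)" using Suc.prems(3) by (simp add: mult_ac)
  have aa: "a = a'"
  proof (rule ccontr)
    assume "a \<noteq> a'"
    hence "(a = 1 \<and> a' = 2) \<or> (a = 2 \<and> a' = 1)" using w w' by auto
    thus False using c ord big \<sigma>0 by (elim disjE) auto
  qed
  have "\<bar>A - A'\<bar> < 3 * \<sigma>" using c \<sigma>0 by linarith
  moreover have "\<bar>B - B'\<bar> < 3 * \<sigma>" using c aa w(3) by (auto simp: algebra_simps)
  moreover have "5 * 3 ^ l * (3 * \<sigma>) \<le> real_of_int (snd V)" using Suc.prems(3) by (simp add: mult_ac)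
  ultimately have "u = u'" unfolding AB by - (rule Suc.IH[OF w(2) w'(2), of "3 * \<sigma>"])
  thus ?case using aa w w' by simp
qed


section \<open>Mean square of an exponential sum over Moebius maps\<close>

text \<open>
  Integration by parts: \<open>cos f = (sin f / f')' + sin f * f'' / f'\<^sup>2\<close>.
\<close>

lemma first_derivative_test:
  fixes f f' f'' :: "real \<Rightarrow> real"
  assumes ab: "a \<le> b"
    and f: "\<And>x. x \<in> {a..b} \<Longrightarrow> (f has_real_derivative f' x) (at x within {a..b})"
    and f': "\<And>x. x \<in> {a..b} \<Longrightarrow> (f' has_real_derivative f'' x) (at x within {a..b})"
    and lower: "\<And>x. x \<in> {a..b} \<Longrightarrow> \<mu> \<le> \<bar>f' x\<bar>" and \<mu>: "\<mu> > 0"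
    and upper: "\<And>x. x \<in> {a..b} \<Longrightarrow> \<bar>f'' x\<bar> \<le> F"
  shows "\<bar>integral {a..b} (\<lambda>x. cos (f x))\<bar> \<le> 2 / \<mu> + (b - a) * (F / \<mu>\<^sup>2)"
proof -
  have nz: "f' x \<noteq> 0" if "x \<in> {a..b}" for x using lower[OF that] \<mu> by auto
  define G where "G x = sin (f x) / f' x" for x
  have G: "(G has_real_derivative (cos (f x) - sin (f x) * f'' x / (f' x)\<^sup>2)) (at x within {a..b})" if x: "x \<in> {a..b}" for x
    unfolding G_def using nz[OF x]
    by (auto intro!: derivative_eq_intros f[OF x] f'[OF x] simp: field_simps power2_eq_square)
  have I1: "((\<lambda>x. cos (f x) - sin (f x) * f'' x / (f' x)\<^sup>2) has_integral (G b - G a)) {a..b}"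
    by (rule fundamental_theorem_of_calculus[OF ab]) (use G in \<open>auto simp: has_real_derivative_iff_has_vector_derivative\<close>)
  have cont: "continuous_on {a..b} (\<lambda>x. cos (f x))"
    by (intro continuous_intros) (rule DERIV_continuous_on, use f in auto)
  hence I2: "((\<lambda>x. cos (f x)) has_integral integral {a..b} (\<lambda>x. cos (f x))) {a..b}"
    by (intro integrable_integral integrable_continuous_interval)
  have F0: "0 \<le> F" using upper[of a] ab by auto
  have "((\<lambda>x. sin (f x) * f'' x / (f' x)\<^sup>2) has_integral (integral {a..b} (\<lambda>x. cos (f x)) - (G b - G a))) {a..b}"
    using has_integral_diff[OF I2 I1] by simp
  hence "norm (integral {a..b} (\<lambda>x. cos (f x)) - (G b - G a)) \<le> F / \<mu>\<^sup>2 * measure lborel (cbox a b)"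
  proof (intro has_integral_bound[where f = "\<lambda>x. sin (f x) * f'' x / (f' x)\<^sup>2"])
    fix x assume "x \<in> cbox a b"
    hence x: "x \<in> {a..b}" by simp
    have "norm (sin (f x) * f'' x / (f' x)\<^sup>2) = \<bar>sin (f x)\<bar> * \<bar>f'' x\<bar> / \<bar>f' x\<bar>\<^sup>2" by (simp add: abs_mult)
    also have "\<dots> \<le> 1 * F / \<mu>\<^sup>2"
      using lower[OF x] upper[OF x] \<mu> by (intro frac_le mult_mono power_mono) auto
    finally show "norm (sin (f x) * f'' x / (f' x)\<^sup>2) \<le> F / \<mu>\<^sup>2" by simp
  qed (use F0 in auto)
  hence 1: "\<bar>integral {a..b} (\<lambda>x. cos (f x)) - (G b - G a)\<bar> \<le> F / \<mu>\<^sup>2 * (b - a)"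
    using ab by simp
  have Gb: "\<bar>G x\<bar> \<le> 1 / \<mu>" if "x \<in> {a..b}" for x
    unfolding G_def abs_divide using lower[OF that] \<mu> by (intro frac_le) auto
  have "\<bar>G a\<bar> \<le> 1 / \<mu>" "\<bar>G b\<bar> \<le> 1 / \<mu>" using ab by (auto intro!: Gb)
  with 1 have "\<bar>integral {a..b} (\<lambda>x. cos (f x))\<bar> \<le> 1 / \<mu> + 1 / \<mu> + F / \<mu>\<^sup>2 * (b - a)"
    by linarith
  thus ?thesis by (simp add: mult.commute)
qed

lemma linear_away_from_zero:
  fixes u v \<sigma> \<tau> :: real
  assumes "\<sigma> > 0" "0 < \<tau>" "\<tau> \<le> 1" and big: "\<sigma> \<le> \<bar>u\<bar> \<or> \<sigma> \<le> \<bar>v\<bar>"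
  obtains a b where "0 \<le> a" "a \<le> b" "b \<le> 1" "b - a \<le> 2 * \<tau>"
    "\<And>x. x \<in> {0..a} \<Longrightarrow> 0 < a \<Longrightarrow> \<sigma> * \<tau> / 2 \<le> \<bar>u + v * x\<bar>" "\<And>x. x \<in> {b..1} \<Longrightarrow> b < 1 \<Longrightarrow> \<sigma> * \<tau> / 2 \<le> \<bar>u + v * x\<bar>"
proof (cases "\<sigma> / 2 \<le> \<bar>v\<bar>")
  case False
  hence u: "\<sigma> \<le> \<bar>u\<bar>" using big assms by auto
  have *: "\<sigma> * \<tau> / 2 \<le> \<bar>u + v * x\<bar>" if "x \<in> {0..1}" for x
  proof -
    have "\<bar>v * x\<bar> \<le> \<sigma> / 2 * 1" unfolding abs_mult using False that assms by (intro mult_mono) auto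
    hence "\<sigma> / 2 \<le> \<bar>u + v * x\<bar>" using u by linarith
    moreover have "\<sigma> * \<tau> \<le> \<sigma> * 1" using assms by (intro mult_left_mono) auto
    ultimately show ?thesis by linarith
  qed
  show ?thesis by (rule that[of 0 0]) (use * assms in auto)
next
  case True
  define z where "z = - u / v"
  have v: "v \<noteq> 0" using True assms by auto
  have eq: "\<bar>u + v * x\<bar> = \<bar>v\<bar> * \<bar>x - z\<bar>" for x
  proof -
    have "u + v * x = v * (x - z)" using v by (simp add: z_def field_simps)
    thus ?thesis by (simp add: abs_mult)
  qed
  have *: "\<sigma> * \<tau> / 2 \<le> \<bar>u + v * x\<bar>" if "\<tau> \<le> \<bar>x - z\<bar>" for x
  proof -
    have "\<sigma> / 2 * \<tau> \<le> \<bar>v\<bar> * \<bar>x - z\<bar>" using True that assms by (intro mult_mono) auto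
    thus ?thesis using eq by simp
  qed
  show ?thesis
    by (rule that[of "max 0 (min 1 (z - \<tau>))" "max 0 (min 1 (z + \<tau>))"])
      (use * assms in \<open>auto simp: max_def min_def split: if_splits\<close>)
qed

text \<open>
  The derivative of \<open>f\<close> is \<open>k * (a' - a) * (a' + a) / (a * a')\<^sup>2\<close> for the two linear denominators \<open>a\<close> and \<open>a'\<close>.
  As their coefficients differ by \<open>\<kappa> * Q\<close>, it is small only on an interval of length \<open>2 * \<tau>\<close>, and the
  first derivative test applies on both sides of that interval.
\<close>

lemma mobius_phase_integral:
  fixes A B A' B' :: real
  assumes Q: "Q > 0" and A: "Q \<le> A" "A \<le> X * Q" "0 \<le> B" "B \<le> A" and A': "Q \<le> A'" "A' \<le> X * Q" "0 \<le> B'" "B' \<le> A'"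
    and sep: "\<kappa> * Q \<le> \<bar>A' - A\<bar> \<or> \<kappa> * Q \<le> \<bar>B' - B\<bar>" and \<kappa>: "0 < \<kappa>" "\<kappa> \<le> 1"
    and \<tau>: "0 < \<tau>" "\<tau> \<le> 1" and k: "k \<noteq> 0"
    and f: "\<And>x. x \<in> {0..1} \<Longrightarrow> (f has_real_derivative k * (1 / (A + B * x)\<^sup>2 - 1 / (A' + B' * x)\<^sup>2)) (at x within {0..1})"
    and large: "2112 * X ^ 8 * Q\<^sup>2 \<le> \<bar>k\<bar> * \<kappa>\<^sup>2 * \<tau> ^ 3"
  shows "\<bar>integral {0..1} (\<lambda>x. cos (f x))\<bar> \<le> 3 * \<tau>"
proof -
  have X: "1 \<le> X"
  proof -
    have "1 * Q \<le> X * Q" using A by simp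
    thus ?thesis using Q by simp
  qed
  define f' where "f' x = k * (1 / (A + B * x)\<^sup>2 - 1 / (A' + B' * x)\<^sup>2)" for x
  define f'' where "f'' x = k * (2 * B' / (A' + B' * x) ^ 3 - 2 * B / (A + B * x) ^ 3)" for x
  define F where "F = 4 * \<bar>k\<bar> / Q\<^sup>2"
  define \<mu> where "\<mu> = \<bar>k\<bar> * \<kappa> * \<tau> / (16 * X ^ 4 * Q\<^sup>2)"
  have \<mu>0: "\<mu> > 0" using k \<kappa> \<tau> X Q by (simp add: \<mu>_def)
  have rng: "Q \<le> A + B * x" "A + B * x \<le> 2 * X * Q" "A \<le> A + B * x" if "x \<in> {0..1}" "Q \<le> A" "A \<le> X * Q" "0 \<le> B" "B \<le> A" for A B x
  proof -
    have "B * x \<le> A * 1" using that Q by (intro mult_mono) auto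
    moreover have "0 \<le> B * x" using that by auto
    ultimately show "Q \<le> A + B * x" "A + B * x \<le> 2 * X * Q" "A \<le> A + B * x" using that by linarith+
  qed
  have d1: "(f has_real_derivative f' x) (at x within S)" if "x \<in> {0..1}" "S \<subseteq> {0..1}" for x S
    unfolding f'_def by (rule DERIV_subset[OF f[OF that(1)] that(2)])
  have d2: "(f' has_real_derivative f'' x) (at x within S)" if "x \<in> {0..1}" for x S
  proof -
    have nz: "A + B * x \<noteq> 0" "A' + B' * x \<noteq> 0" using rng(1)[OF that A] rng(1)[OF that A'] Q by auto
    have e: "((\<lambda>x. 1 / (A + B * x)\<^sup>2) has_real_derivative - (2 * B / (A + B * x) ^ 3)) (at x within S)"
      if "A + B * x \<noteq> 0" for A B :: real
      using that by (auto intro!: derivative_eq_intros simp: power2_eq_square power3_eq_cube divide_simps)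
    show ?thesis unfolding f'_def f''_def
      by (rule derivative_eq_intros e nz refl)+ (simp add: algebra_simps)
  qed
  have up: "\<bar>f'' x\<bar> \<le> F" if x: "x \<in> {0..1}" for x
  proof -
    have e: "0 \<le> 2 * B / (A + B * x) ^ 3 \<and> 2 * B / (A + B * x) ^ 3 \<le> 2 / Q\<^sup>2"
      if h: "Q \<le> A" "A \<le> X * Q" "0 \<le> B" "B \<le> A" for A B
    proof
      note r = rng[OF x h]
      have p: "0 < A + B * x" using r Q by linarith
      show "0 \<le> 2 * B / (A + B * x) ^ 3" using p h by simp
      have "2 * B / (A + B * x) ^ 3 = (2 * B / (A + B * x)) * (1 / (A + B * x)\<^sup>2)"
        by (simp add: power2_eq_square power3_eq_cube)
      also have "\<dots> \<le> 2 * (1 / Q\<^sup>2)"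
      proof (rule mult_mono)
        show "2 * B / (A + B * x) \<le> 2" using p h r by (simp add: divide_le_eq)
        show "1 / (A + B * x)\<^sup>2 \<le> 1 / Q\<^sup>2" using r Q by (intro frac_le power_mono) auto
      qed (use p in auto)
      finally show "2 * B / (A + B * x) ^ 3 \<le> 2 / Q\<^sup>2" by simp
    qed
    have "\<bar>2 * B' / (A' + B' * x) ^ 3 - 2 * B / (A + B * x) ^ 3\<bar> \<le> 4 / Q\<^sup>2"
      using e[OF A] e[OF A'] by linarith
    hence "\<bar>k\<bar> * \<bar>2 * B' / (A' + B' * x) ^ 3 - 2 * B / (A + B * x) ^ 3\<bar> \<le> \<bar>k\<bar> * (4 / Q\<^sup>2)"
      by (intro mult_left_mono) auto
    thus ?thesis by (simp add: f''_def F_def abs_mult mult.commute)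
  qed
  have low: "\<mu> \<le> \<bar>f' x\<bar>" if x: "x \<in> {0..1}" and l: "\<kappa> * Q * \<tau> / 2 \<le> \<bar>(A' - A) + (B' - B) * x\<bar>" for x
  proof -
    define a a' where aa: "a = A + B * x" "a' = A' + B' * x"
    have r: "Q \<le> a" "a \<le> 2 * X * Q" "Q \<le> a'" "a' \<le> 2 * X * Q"
      using rng[OF x A] rng[OF x A'] by (auto simp: aa)
    have l': "\<kappa> * Q * \<tau> / 2 \<le> \<bar>a' - a\<bar>" using l by (simp add: aa algebra_simps)
    have pos: "a > 0" "a' > 0" using r Q by auto
    have "f' x = k * ((a' - a) * (a' + a) / (a\<^sup>2 * a'\<^sup>2))"
      using pos by (simp add: f'_def aa[symmetric] field_simps power2_eq_square)
    hence eq: "\<bar>f' x\<bar> = \<bar>k\<bar> * (\<bar>a' - a\<bar> * (a' + a) / (a\<^sup>2 * a'\<^sup>2))" using pos by (simp add: abs_mult)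
    have "\<kappa> * Q * \<tau> / 2 * (2 * Q) / ((2 * X * Q)\<^sup>2 * (2 * X * Q)\<^sup>2) \<le> \<bar>a' - a\<bar> * (a' + a) / (a\<^sup>2 * a'\<^sup>2)"
    proof (rule frac_le)
      show "\<kappa> * Q * \<tau> / 2 * (2 * Q) \<le> \<bar>a' - a\<bar> * (a' + a)" using l' r Q \<kappa> \<tau> by (intro mult_mono) auto
      show "a\<^sup>2 * a'\<^sup>2 \<le> (2 * X * Q)\<^sup>2 * (2 * X * Q)\<^sup>2" using r pos by (intro mult_mono power_mono) auto
    qed (use pos in auto)
    moreover have "\<kappa> * Q * \<tau> / 2 * (2 * Q) / ((2 * X * Q)\<^sup>2 * (2 * X * Q)\<^sup>2) = \<kappa> * \<tau> / (16 * X ^ 4 * Q\<^sup>2)"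
      using Q X by (simp add: field_simps power2_eq_square eval_nat_numeral)
    ultimately have "\<kappa> * \<tau> / (16 * X ^ 4 * Q\<^sup>2) \<le> \<bar>a' - a\<bar> * (a' + a) / (a\<^sup>2 * a'\<^sup>2)" by simp
    hence "\<bar>k\<bar> * (\<kappa> * \<tau> / (16 * X ^ 4 * Q\<^sup>2)) \<le> \<bar>f' x\<bar>" unfolding eq by (intro mult_left_mono) auto
    thus ?thesis by (simp add: \<mu>_def)
  qed
  have bound: "2 / \<mu> + F / \<mu>\<^sup>2 \<le> \<tau> / 2"
  proof -
    have e1: "2 / \<mu> = 32 * X ^ 4 * Q\<^sup>2 / (\<bar>k\<bar> * \<kappa> * \<tau>)" using \<mu>0 by (simp add: \<mu>_def)
    also have "\<dots> \<le> 32 * X ^ 8 * Q\<^sup>2 / (\<bar>k\<bar> * \<kappa>\<^sup>2 * \<tau>\<^sup>2)"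
    proof (rule frac_le)
      show "32 * X ^ 4 * Q\<^sup>2 \<le> 32 * X ^ 8 * Q\<^sup>2" using X by (intro mult_right_mono mult_left_mono power_increasing) auto
      have "\<kappa>\<^sup>2 \<le> \<kappa>" "\<tau>\<^sup>2 \<le> \<tau>" using \<kappa> \<tau> by (auto simp: power2_eq_square mult_le_one intro: mult_left_le)
      thus "\<bar>k\<bar> * \<kappa>\<^sup>2 * \<tau>\<^sup>2 \<le> \<bar>k\<bar> * \<kappa> * \<tau>" using \<kappa> \<tau> by (intro mult_mono) auto
    qed (use X \<kappa> \<tau> k in auto)
    finally have e2: "2 / \<mu> \<le> 32 * X ^ 8 * Q\<^sup>2 / (\<bar>k\<bar> * \<kappa>\<^sup>2 * \<tau>\<^sup>2)" .
    have "F / \<mu>\<^sup>2 = 1024 * X ^ 8 * Q\<^sup>2 / (\<bar>k\<bar> * \<kappa>\<^sup>2 * \<tau>\<^sup>2)"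
      using k \<kappa> \<tau> X Q by (simp add: F_def \<mu>_def field_simps power2_eq_square eval_nat_numeral)
    hence "2 / \<mu> + F / \<mu>\<^sup>2 \<le> 1056 * X ^ 8 * Q\<^sup>2 / (\<bar>k\<bar> * \<kappa>\<^sup>2 * \<tau>\<^sup>2)"
      using e2 by (simp add: add_divide_distrib[symmetric])
    also have "\<dots> \<le> \<tau> / 2"
      using large k \<kappa> \<tau> by (simp add: divide_le_eq power2_eq_square power3_eq_cube algebra_simps)
    finally show ?thesis .
  qed
  have F0: "0 \<le> F / \<mu>\<^sup>2" using \<mu>0 by (simp add: F_def)
  have cont: "continuous_on {0..1} (\<lambda>x. cos (f x))"
    by (intro continuous_intros) (rule DERIV_continuous_on, use f in auto)
  obtain a b where ab: "0 \<le> a" "a \<le> b" "b \<le> 1" "b - a \<le> 2 * \<tau>"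
    "\<And>x. x \<in> {0..a} \<Longrightarrow> 0 < a \<Longrightarrow> \<kappa> * Q * \<tau> / 2 \<le> \<bar>(A' - A) + (B' - B) * x\<bar>"
    "\<And>x. x \<in> {b..1} \<Longrightarrow> b < 1 \<Longrightarrow> \<kappa> * Q * \<tau> / 2 \<le> \<bar>(A' - A) + (B' - B) * x\<bar>"
    using linear_away_from_zero[of "\<kappa> * Q" \<tau> "A' - A" "B' - B"] \<kappa> Q \<tau> sep by (metis mult_pos_pos)
  have piece: "\<bar>integral {c..d} (\<lambda>x. cos (f x))\<bar> \<le> \<tau> / 2"
    if cd: "0 \<le> c" "c \<le> d" "d \<le> 1" and l: "\<And>x. x \<in> {c..d} \<Longrightarrow> \<kappa> * Q * \<tau> / 2 \<le> \<bar>(A' - A) + (B' - B) * x\<bar>" for c d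
  proof -
    have "\<bar>integral {c..d} (\<lambda>x. cos (f x))\<bar> \<le> 2 / \<mu> + (d - c) * (F / \<mu>\<^sup>2)"
      by (rule first_derivative_test[where f' = f' and f'' = f''])
        (use cd d1 d2 low l up \<mu>0 in auto)
    also have "\<dots> \<le> 2 / \<mu> + 1 * (F / \<mu>\<^sup>2)" using F0 cd by (intro add_left_mono mult_right_mono) auto
    finally show ?thesis using bound by linarith
  qed
  have p1: "\<bar>integral {0..a} (\<lambda>x. cos (f x))\<bar> \<le> \<tau> / 2"
  proof (cases "a = 0")
    case False thus ?thesis using ab by (intro piece) auto
  qed (use \<tau> in auto)
  have p3: "\<bar>integral {b..1} (\<lambda>x. cos (f x))\<bar> \<le> \<tau> / 2"
  proof (cases "b = 1")
    case False thus ?thesis using ab by (intro piece) auto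
  qed (use \<tau> in auto)
  have intg: "(\<lambda>x. cos (f x)) integrable_on {c..d}" if "0 \<le> c" "d \<le> 1" for c d
    by (intro integrable_continuous_interval continuous_on_subset[OF cont]) (use that in auto)
  have p2: "\<bar>integral {a..b} (\<lambda>x. cos (f x))\<bar> \<le> 2 * \<tau>"
  proof -
    have "norm (integral {a..b} (\<lambda>x. cos (f x))) \<le> 1 * measure lborel (cbox a b)"
      by (rule has_integral_bound[where f = "\<lambda>x. cos (f x)"]) (use ab intg[of a b] in \<open>auto intro: integrable_integral\<close>)
    thus ?thesis using ab by auto
  qed
  have "integral {0..1} (\<lambda>x. cos (f x)) = integral {0..a} (\<lambda>x. cos (f x)) + integral {a..1} (\<lambda>x. cos (f x))"
    by (rule Henstock_Kurzweil_Integration.integral_combine[symmetric]) (use ab intg in auto)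
  also have "integral {a..1} (\<lambda>x. cos (f x)) = integral {a..b} (\<lambda>x. cos (f x)) + integral {b..1} (\<lambda>x. cos (f x))"
    by (rule Henstock_Kurzweil_Integration.integral_combine[symmetric]) (use ab intg in auto)
  finally show ?thesis using p1 p2 p3 by linarith
qed


text \<open>
  The test function for hitting a target: a power of \<open>(1 + cos t) / 2\<close> is concentrated near the multiples of
  \<open>2 * pi\<close>, and its Fourier coefficients are nonnegative with sum 1.
\<close>

lemma cos_power_expansion:
  fixes t :: real
  shows "((1 + cos t) / 2) ^ K = (\<Sum>j\<le>2 * K. real (2 * K choose j) / 4 ^ K * cos ((real j - real K) * t))"
proof -
  have e1: "(1 + cis t)\<^sup>2 * cis (- t) = complex_of_real (2 + 2 * cos t)"
    by (simp add: complex_eq_iff power2_eq_square cis.code field_simps sin_cos_eq_iff)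
  have e2: "cis (- t) ^ K = cis (- (real K * t))" by (simp add: Complex.DeMoivre)
  have "complex_of_real ((2 + 2 * cos t) ^ K) = (1 + cis t) ^ (2 * K) * cis (- (real K * t))"
    by (simp only: of_real_power e1[symmetric] power_mult_distrib power_mult e2)
  also have "\<dots> = (\<Sum>j\<le>2 * K. of_nat (2 * K choose j) * cis (real j * t)) * cis (- (real K * t))"
    by (subst add.commute, subst binomial_ring) (simp add: Complex.DeMoivre)
  also have "\<dots> = (\<Sum>j\<le>2 * K. of_nat (2 * K choose j) * cis ((real j - real K) * t))"
    by (simp add: sum_distrib_right mult.assoc cis_mult left_diff_distrib)
  finally have "(2 + 2 * cos t) ^ K = Re (\<Sum>j\<le>2 * K. of_nat (2 * K choose j) * cis ((real j - real K) * t))"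
    by (metis Re_complex_of_real)
  also have "\<dots> = (\<Sum>j\<le>2 * K. real (2 * K choose j) * cos ((real j - real K) * t))" by simp
  finally have *: "(2 + 2 * cos t) ^ K = (\<Sum>j\<le>2 * K. real (2 * K choose j) * cos ((real j - real K) * t))" .
  have "(1 + cos t) / 2 = (2 + 2 * cos t) / 4" by (simp add: field_simps)
  hence "((1 + cos t) / 2) ^ K = ((2 + 2 * cos t) / 4) ^ K" by (rule arg_cong)
  also have "\<dots> = (2 + 2 * cos t) ^ K / 4 ^ K" by (simp add: power_divide)
  finally show ?thesis unfolding * by (simp add: sum_divide_distrib)
qed

lemma cos_gap:
  assumes "0 \<le> \<eta>" "\<eta> \<le> 1 / 8"
  shows "(1 + cos (2 * pi * \<eta>)) / 2 \<le> 1 - \<eta>\<^sup>2"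
proof -
  have s: "\<eta> \<le> sin (pi * \<eta>)"
  proof (cases "\<eta> = 0")
    case False
    hence pos: "0 < pi * \<eta>" using assms by simp
    obtain z where z: "0 < z" "z < pi * \<eta>" "sin (pi * \<eta>) - sin 0 = (pi * \<eta> - 0) * cos z"
      using MVT2[OF pos, of sin cos] by (auto intro: DERIV_sin)
    have "pi * \<eta> \<le> pi * (1 / 3)" using assms by (intro mult_left_mono) auto
    hence "z \<le> pi / 3" using z by linarith
    hence "cos (pi / 3) \<le> cos z" using z by (intro cos_monotone_0_pi_le) auto
    hence "1 / 2 \<le> cos z" by (simp add: cos_60)
    hence "pi * \<eta> * (1 / 2) \<le> sin (pi * \<eta>)" using z pos mult_left_mono[of "1/2" "cos z" "pi * \<eta>"] by simp
    moreover have "2 * \<eta> \<le> pi * \<eta>" using pi_ge_two assms by (intro mult_right_mono) auto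
    ultimately show ?thesis by linarith
  qed simp
  have "cos (2 * (pi * \<eta>)) = 1 - 2 * (sin (pi * \<eta>))\<^sup>2" by (rule cos_double_sin)
  moreover have "\<eta>\<^sup>2 \<le> (sin (pi * \<eta>))\<^sup>2" using s assms by (intro power_mono) auto
  ultimately show ?thesis by (simp add: mult.assoc)
qed

text \<open>
  At points that miss the target by at least \<open>\<eta>\<close> the test function is at most \<open>(1 - \<eta>\<^sup>2) ^ K\<close>.  For \<open>K\<close> of order
  \<open>\<eta> powr - 4\<close> this is at most half of the lower bound \<open>1 / (2 * K)\<close> for its mean value.
\<close>

lemma power_below_central_coeff:
  assumes \<eta>: "0 < \<eta>" "\<eta> \<le> 1 / 8" and K: "1 / \<eta> ^ 4 \<le> real K"
  shows "(1 - \<eta>\<^sup>2) ^ K \<le> 1 / (4 * real K)"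
proof -
  define y where "y = sqrt (real K)"
  have "1 / (1/8) ^ 4 \<le> 1 / \<eta> ^ 4" using \<eta> by (intro frac_le power_mono) auto
  moreover have "1 / (1/8) ^ 4 = (4096::real)" by (simp add: power_divide)
  ultimately have K4096: "4096 \<le> real K" using K by linarith
  have y0: "y \<ge> 64"
  proof -
    have "sqrt (64\<^sup>2) \<le> sqrt (real K)" using K4096 by (intro real_sqrt_le_mono) simp
    thus ?thesis by (simp add: y_def)
  qed
  have yK: "y\<^sup>2 = real K" by (simp add: y_def)
  have "1 \<le> real K * \<eta> ^ 4" using K \<eta> by (simp add: divide_le_eq)
  hence "1\<^sup>2 \<le> (y * \<eta>\<^sup>2)\<^sup>2" by (simp add: power_mult_distrib yK)
  hence "1 \<le> y * \<eta>\<^sup>2" using y0 by (intro power2_le_imp_le[of 1]) auto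
  hence "y * 1 \<le> y * (y * \<eta>\<^sup>2)" using y0 by (intro mult_left_mono) auto
  hence yy: "y \<le> real K * \<eta>\<^sup>2" by (simp add: mult.assoc[symmetric] yK[symmetric] power2_eq_square)
  have "\<eta>\<^sup>2 \<le> 1" using \<eta> by (simp add: power_le_one)
  hence "(1 - \<eta>\<^sup>2) ^ K \<le> exp (- \<eta>\<^sup>2) ^ K" using exp_ge_add_one_self[of "- \<eta>\<^sup>2"] by (intro power_mono) auto
  also have "\<dots> = exp (- (real K * \<eta>\<^sup>2))" by (simp add: exp_of_nat_mult[symmetric])
  also have "\<dots> \<le> exp (- y)" using yy by simp
  also have "\<dots> = 1 / exp y" by (simp add: exp_minus field_simps)
  also have "\<dots> \<le> 1 / (4 * real K)"
  proof (rule divide_left_mono)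
    have "(y / 4) ^ 4 \<le> exp (y / 4) ^ 4" using y0 exp_ge_add_one_self[of "y / 4"] by (intro power_mono) linarith+
    also have "\<dots> = exp y" using exp_of_nat_mult[of 4 "y / 4"] by simp
    finally have "y ^ 4 / 256 \<le> exp y" by (simp add: power_divide)
    moreover have "64\<^sup>2 * y\<^sup>2 \<le> y\<^sup>2 * y\<^sup>2" using y0 by (intro mult_right_mono power_mono) auto
    moreover have "y\<^sup>2 * y\<^sup>2 = y ^ 4" by (simp flip: power_add)
    moreover have "0 \<le> y\<^sup>2" by simp
    ultimately show "4 * real K \<le> exp y" using yK by simp
  qed (use K4096 in auto)
  finally show ?thesis .
qed

text \<open>
  Where all \<open>\<theta> w x\<close> miss the target, the average over \<open>w\<close> of the test function stays below its constant Fourier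
  coefficient by \<open>1 / (4 * K)\<close>, so the other frequencies contribute at least that much in absolute value.  The
  decorrelation hypothesis bounds their mean square over \<open>[0, 1]\<close> by \<open>4 * \<tau>\<close>, and Chebyshev's inequality bounds
  the measure.
\<close>

lemma few_points_avoid_target:
  fixes \<theta> :: "'w \<Rightarrow> real \<Rightarrow> real" and W :: "'w set"
  assumes W: "finite W" "1 / real (card W) \<le> \<tau>" "W \<noteq> {}"
    and cont: "\<And>w. w \<in> W \<Longrightarrow> continuous_on {0..1} (\<theta> w)"
    and decor: "\<And>w w' h. w \<in> W \<Longrightarrow> w' \<in> W \<Longrightarrow> w \<noteq> w' \<Longrightarrow> 1 \<le> \<bar>h\<bar> \<Longrightarrow>
        \<bar>integral {0..1} (\<lambda>x. cos (h * (\<theta> w x - \<theta> w' x)))\<bar> \<le> 3 * \<tau>"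
    and \<eta>: "0 < \<eta>" "\<eta> \<le> 1 / 8"
    and S: "S \<in> lmeasurable" "S \<subseteq> {0..1}"
    and avoid: "\<And>x w. x \<in> S \<Longrightarrow> w \<in> W \<Longrightarrow> cos (\<theta> w x) \<le> cos (2 * pi * \<eta>)"
  shows "measure lebesgue S \<le> 256 * \<tau> / \<eta> ^ 8"
proof -
  define n where "n = real (card W)"
  have n: "n > 0" using W by (auto simp: n_def card_gt_0_iff)
  \<comment> \<open>The exponent of the test function, large enough for \<open>power_below_central_coeff\<close>.\<close>
  define K where "K = nat \<lceil>1 / \<eta> ^ 4\<rceil>"
  have e4: "1 / \<eta> ^ 4 \<ge> 1" using \<eta> by (simp add: power_le_one)
  have K: "1 / \<eta> ^ 4 \<le> real K" "real K \<le> 2 / \<eta> ^ 4" "K > 0"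
    using e4 by (auto simp: K_def) linarith+
  define c where "c j = real (2 * K choose j) / 4 ^ K" for j
  define J where "J = {..2 * K} - {K}"
  have J: "{..2 * K} = insert K J" "finite J" "K \<notin> J" by (auto simp: J_def)
  have csum: "(\<Sum>j\<in>J. c j) \<le> 1" and c0: "\<And>j. c j \<ge> 0"
  proof -
    have "(\<Sum>j\<le>2*K. c j) = (\<Sum>j\<le>2*K. real (2 * K choose j)) / 4 ^ K" by (simp add: c_def sum_divide_distrib)
    also have "(\<Sum>j\<le>2*K. real (2 * K choose j)) = real (\<Sum>j\<le>2*K. (2 * K choose j))" by simp
    also have "\<dots> = 4 ^ K" by (subst choose_row_sum) (simp add: power_mult)
    finally have "(\<Sum>j\<le>2*K. c j) = 1" by simp
    moreover show "c j \<ge> 0" for j by (simp add: c_def)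
    moreover have "0 \<le> c K" by (simp add: c_def)
    ultimately have "c K + (\<Sum>j\<in>J. c j) = 1 \<and> 0 \<le> c K" unfolding J(1) using J(2,3) by simp
    thus "(\<Sum>j\<in>J. c j) \<le> 1" by linarith
  qed
  define T where "T h x = (\<Sum>w\<in>W. cos (h * \<theta> w x)) / n" for h x :: real
  define M where "M x = (\<Sum>j\<in>J. c j * (T (real j - real K) x)\<^sup>2)" for x
  have contT: "continuous_on {0..1} (T h)" for h
    unfolding T_def by (intro continuous_intros cont) (use n in auto)
  have contM: "continuous_on {0..1} M" unfolding M_def by (intro continuous_intros contT)
  have lower: "(1 / (4 * real K))\<^sup>2 \<le> M x" if x: "x \<in> S" for x
  proof -
    have avg: "(\<Sum>w\<in>W. ((1 + cos (\<theta> w x)) / 2) ^ K) / n = (\<Sum>j\<le>2*K. c j * T (real j - real K) x)"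
    proof -
      have "(\<Sum>w\<in>W. ((1 + cos (\<theta> w x)) / 2) ^ K) = (\<Sum>j\<le>2*K. \<Sum>w\<in>W. c j * cos ((real j - real K) * \<theta> w x))"
        unfolding cos_power_expansion c_def by (rule sum.swap)
      thus ?thesis by (simp add: T_def sum_divide_distrib sum_distrib_left)
    qed
    have "(\<Sum>w\<in>W. ((1 + cos (\<theta> w x)) / 2) ^ K) \<le> (\<Sum>w\<in>W. 1 / (4 * real K))"
    proof (rule sum_mono)
      fix w assume w: "w \<in> W"
      have "((1 + cos (\<theta> w x)) / 2) ^ K \<le> (1 - \<eta>\<^sup>2) ^ K"
      proof (rule power_mono)
        show "(1 + cos (\<theta> w x)) / 2 \<le> 1 - \<eta>\<^sup>2" using avoid[OF x w] cos_gap[of \<eta>] \<eta> by simp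
        show "0 \<le> (1 + cos (\<theta> w x)) / 2" using add_left_mono[OF cos_ge_minus_one[of "\<theta> w x"], of 1] by simp
      qed
      also have "\<dots> \<le> 1 / (4 * real K)" by (rule power_below_central_coeff[OF \<eta> K(1)])
      finally show "((1 + cos (\<theta> w x)) / 2) ^ K \<le> 1 / (4 * real K)" .
    qed
    hence "(\<Sum>w\<in>W. ((1 + cos (\<theta> w x)) / 2) ^ K) / n \<le> 1 / (4 * real K)"
      using n by (simp add: n_def divide_le_eq mult.commute)
    hence "c K * T 0 x + (\<Sum>j\<in>J. c j * T (real j - real K) x) \<le> 1 / (4 * real K)"
      unfolding avg J(1) using J by simp
    moreover have "T 0 x = 1" using n by (simp add: T_def n_def)
    moreover have "c K \<ge> 1 / (2 * real K)"
      using central_binomial_lower_bound[OF K(3)] by (simp add: c_def field_simps)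
    ultimately have "1 / (4 * real K) \<le> - (\<Sum>j\<in>J. c j * T (real j - real K) x)"
      by (simp add: field_simps)
    hence "(1 / (4 * real K))\<^sup>2 \<le> (\<Sum>j\<in>J. c j * T (real j - real K) x)\<^sup>2"
      by (metis K(3) of_nat_0_le_iff power2_minus power_mono zero_le_divide_1_iff zero_le_mult_iff zero_le_numeral)
    also have "\<dots> = (\<Sum>j\<in>J. sqrt (c j) * (sqrt (c j) * T (real j - real K) x))\<^sup>2"
      using c0 by (simp add: mult.assoc[symmetric])
    also have "\<dots> \<le> (\<Sum>j\<in>J. (sqrt (c j))\<^sup>2) * (\<Sum>j\<in>J. (sqrt (c j) * T (real j - real K) x)\<^sup>2)"
      by (rule Cauchy_Schwarz_ineq_sum)
    also have "\<dots> = (\<Sum>j\<in>J. c j) * M x" using c0 by (simp add: M_def power_mult_distrib)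
    also have "\<dots> \<le> 1 * M x" using csum c0 by (intro mult_right_mono) (auto simp: M_def intro: sum_nonneg)
    finally show ?thesis by simp
  qed
  have T2: "integral {0..1} (\<lambda>x. (T h x)\<^sup>2) \<le> 4 * \<tau>" if h: "1 \<le> \<bar>h\<bar>" for h
  proof -
    define D where "D w w' x = cos (h * (\<theta> w x - \<theta> w' x))" for w w' x
    have contD: "continuous_on {0..1} (D w w')" if "w \<in> W" "w' \<in> W" for w w'
      unfolding D_def by (intro continuous_intros cont that)
    have sq: "(T h x)\<^sup>2 \<le> (\<Sum>w\<in>W. \<Sum>w'\<in>W. D w w' x) / n\<^sup>2" for x
    proof -
      have "(\<Sum>w\<in>W. \<Sum>w'\<in>W. D w w' x) = (\<Sum>w\<in>W. cos (h * \<theta> w x))\<^sup>2 + (\<Sum>w\<in>W. sin (h * \<theta> w x))\<^sup>2"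
        by (simp add: D_def right_diff_distrib cos_diff power2_eq_square sum_product sum.distrib)
      hence "(\<Sum>w\<in>W. cos (h * \<theta> w x))\<^sup>2 \<le> (\<Sum>w\<in>W. \<Sum>w'\<in>W. D w w' x)" by simp
      thus ?thesis by (simp add: T_def power_divide divide_right_mono)
    qed
    have "integral {0..1} (\<lambda>x. (T h x)\<^sup>2) \<le> integral {0..1} (\<lambda>x. (\<Sum>w\<in>W. \<Sum>w'\<in>W. D w w' x) / n\<^sup>2)"
      by (intro integral_le integrable_continuous_interval continuous_intros contT contD sq) (use n in auto)
    also have "\<dots> = (\<Sum>w\<in>W. \<Sum>w'\<in>W. integral {0..1} (D w w')) / n\<^sup>2"
      by (simp add: integral_divide integral_sum W integrable_continuous_interval contD continuous_on_sum)
    also have "\<dots> \<le> (\<Sum>w\<in>W. \<Sum>w'\<in>W. (if w = w' then 1 else 0) + 3 * \<tau>) / n\<^sup>2"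
    proof (intro divide_right_mono sum_mono)
      fix w w' assume w: "w \<in> W" "w' \<in> W"
      have \<tau>0: "0 \<le> \<tau>" using W(2) by (meson divide_nonneg_nonneg of_nat_0_le_iff order_trans zero_le_one)
      show "integral {0..1} (D w w') \<le> (if w = w' then 1 else 0) + 3 * \<tau>"
      proof (cases "w = w'")
        case True
        hence "D w w' = (\<lambda>x. 1)" by (auto simp: D_def)
        thus ?thesis using True \<tau>0 by simp
      next
        case False
        thus ?thesis using decor[OF w False h] by (simp add: D_def[abs_def])
      qed
    qed auto
    also have "(\<Sum>w\<in>W. \<Sum>w'\<in>W. (if w = w' then 1 else 0) + 3 * \<tau>) = n + n\<^sup>2 * (3 * \<tau>)"
      using W by (simp add: sum.distrib n_def power2_eq_square distrib_left)
    also have "(n + n\<^sup>2 * (3 * \<tau>)) / n\<^sup>2 = 1 / n + 3 * \<tau>" using n by (simp add: field_simps power2_eq_square)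
    also have "\<dots> \<le> 4 * \<tau>" using W(2) by (simp add: n_def)
    finally show ?thesis .
  qed
  have "integral {0..1} M = (\<Sum>j\<in>J. c j * integral {0..1} (\<lambda>x. (T (real j - real K) x)\<^sup>2))"
    unfolding M_def using J(2)
    by (simp add: integral_sum integrable_continuous_interval contT continuous_intros)
  also have "\<dots> \<le> (\<Sum>j\<in>J. c j * (4 * \<tau>))"
  proof (intro sum_mono mult_left_mono T2 c0)
    fix j assume "j \<in> J"
    hence "j \<noteq> K" by (auto simp: J_def)
    thus "1 \<le> \<bar>real j - real K\<bar>" by linarith
  qed
  also have "\<dots> = (\<Sum>j\<in>J. c j) * (4 * \<tau>)" by (simp add: sum_distrib_right)
  also have "\<dots> \<le> 1 * (4 * \<tau>)"
    using csum W(2) by (intro mult_right_mono) (auto intro: order_trans[rotated])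
  finally have upper: "integral {0..1} M \<le> 4 * \<tau>" by simp
  have M0: "M x \<ge> 0" for x using c0 by (auto simp: M_def intro: sum_nonneg)
  have MS: "M integrable_on S"
  proof -
    have "M absolutely_integrable_on {0..1}"
      using absolutely_integrable_continuous_real[OF contM] .
    hence "M absolutely_integrable_on S" by (rule set_integrable_subset) (use S in \<open>auto dest: fmeasurableD\<close>)
    thus ?thesis by (simp add: absolutely_integrable_on_def)
  qed
  have "(1 / (4 * real K))\<^sup>2 * measure lebesgue S = integral S (\<lambda>x. (1 / (4 * real K))\<^sup>2)"
    using lmeasure_integral[OF S(1)] integral_mult_right[of S "(1 / (4 * real K))\<^sup>2" "\<lambda>x. 1"] by simp
  also have "\<dots> \<le> integral S M"
    by (rule integral_le) (use lower MS S(1) integrable_on_const[of S] in \<open>auto simp: fmeasurable_def\<close>)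
  also have "\<dots> \<le> integral {0..1} M"
    by (rule integral_subset_le) (use S MS M0 contM in \<open>auto intro: integrable_continuous_interval\<close>)
  finally have "(1 / (4 * real K))\<^sup>2 * measure lebesgue S \<le> 4 * \<tau>" using upper by linarith
  hence "measure lebesgue S \<le> 64 * \<tau> * (real K)\<^sup>2" using K(3) by (simp add: field_simps power2_eq_square)
  also have "\<dots> \<le> 64 * \<tau> * (2 / \<eta> ^ 4)\<^sup>2"
    using K W(2) by (intro mult_left_mono power_mono) (auto intro: order_trans[rotated])
  also have "\<dots> = 256 * \<tau> / \<eta> ^ 8" by (simp add: power_divide flip: power_mult)
  finally show ?thesis .
qed


section \<open>Badly approximable numbers hitting a target\<close>

lemma hom_child:
  fixes a c R X u :: real and N i :: nat
  assumes R: "R = 8 * real N" and X: "X > 0" and a: "0 < a" "a * R \<le> 1 / 2" and c: "c \<le> a\<^sup>2 / (2 * R\<^sup>2)"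
    and i: "8 * i + 4 < 64 * N\<^sup>2"
  defines "P \<equiv> \<lambda>d. \<forall>\<beta>\<in>{u + real d / (X * R)\<^sup>2 .. u + (real d + 1) / (X * R)\<^sup>2}. badly_approx c (a * X) (a * (X * R)) \<beta> 0"
  shows "P (pick P i)"
proof (rule pick_works[OF _ i])
  fix d d' assume d: "d < 64 * N\<^sup>2" "d' < 64 * N\<^sup>2" "\<not> P d" "\<not> P d'"
  have N: "N \<ge> 1" using d(1) by (cases N) auto
  have e: "real e + 1 \<le> R\<^sup>2" if "e < 64 * N\<^sup>2" for e
  proof -
    have "real (e + 1) \<le> real (64 * N\<^sup>2)" using that by (subst of_nat_le_iff) simp
    thus ?thesis by (simp add: R power_mult_distrib)
  qed
  show "\<bar>real d - real d'\<bar> \<le> 2"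
    by (rule hom_step_window[of R X a c d d' u]) (use N R X a c e[OF d(1)] e[OF d(2)] d(3,4) in \<open>auto simp: P_def\<close>)
qed

lemma cell_subset:
  fixes u X R :: real and d :: real
  assumes "X > 0" "R > 0" "0 \<le> d" "d + 1 \<le> R\<^sup>2"
  shows "{u + d / (X * R)\<^sup>2 .. u + (d + 1) / (X * R)\<^sup>2} \<subseteq> {u .. u + 1 / X\<^sup>2}"
proof -
  have "(d + 1) / (X * R)\<^sup>2 \<le> R\<^sup>2 / (X * R)\<^sup>2" using assms by (intro divide_right_mono) auto
  also have "\<dots> = 1 / X\<^sup>2" using assms by (simp add: power_mult_distrib)
  finally show ?thesis using assms by auto
qed

lemma hom_descend:
  fixes a c R X u :: real and N k :: nat
  assumes R: "R = 8 * real N" "N \<ge> 1" and X: "X > 0" and a: "0 < a" "a * R \<le> 1 / 2" and c: "c \<le> a\<^sup>2 / (2 * R\<^sup>2)"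
  shows "\<exists>u'. {u' .. u' + 1 / (X * R ^ k)\<^sup>2} \<subseteq> {u .. u + 1 / X\<^sup>2} \<and>
     (\<forall>\<beta>\<in>{u' .. u' + 1 / (X * R ^ k)\<^sup>2}. badly_approx c (a * X) (a * (X * R ^ k)) \<beta> 0)"
proof (induction k)
  case 0
  show ?case by (intro exI[of _ u]) (auto simp: badly_approx_def)
next
  case (Suc k)
  then obtain u' where u': "{u' .. u' + 1 / (X * R ^ k)\<^sup>2} \<subseteq> {u .. u + 1 / X\<^sup>2}"
    "\<And>\<beta>. \<beta>\<in>{u' .. u' + 1 / (X * R ^ k)\<^sup>2} \<Longrightarrow> badly_approx c (a * X) (a * (X * R ^ k)) \<beta> 0" by blast
  define Y where "Y = X * R ^ k"
  have Y: "Y > 0" using X R by (simp add: Y_def)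
  define P where "P d \<longleftrightarrow> (\<forall>\<beta>\<in>{u' + real d / (Y * R)\<^sup>2 .. u' + (real d + 1) / (Y * R)\<^sup>2}. badly_approx c (a * Y) (a * (Y * R)) \<beta> 0)" for d
  have NN: "1 \<le> N\<^sup>2" using R by simp
  have P: "P (pick P 0)" unfolding P_def by (rule hom_child[OF R(1) Y a c]) (use NN in linarith)
  have "real (pick P 0) \<le> 4" using pick_range(2)[of P 0] by simp
  moreover have "R\<^sup>2 \<ge> 64"
  proof -
    have "8\<^sup>2 \<le> R\<^sup>2" using R by (intro power_mono) auto
    thus ?thesis by simp
  qed
  ultimately have p: "real (pick P 0) + 1 \<le> R\<^sup>2" by linarith
  have sub: "{u' + real (pick P 0) / (Y * R)\<^sup>2 .. u' + (real (pick P 0) + 1) / (Y * R)\<^sup>2} \<subseteq> {u' .. u' + 1 / Y\<^sup>2}"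
    by (rule cell_subset) (use Y R p in auto)
  have eq: "{u' + real (pick P 0) / (Y * R)\<^sup>2 .. u' + (real (pick P 0) + 1) / (Y * R)\<^sup>2} =
    {u' + real (pick P 0) / (Y * R)\<^sup>2 .. u' + real (pick P 0) / (Y * R)\<^sup>2 + 1 / (X * R ^ Suc k)\<^sup>2}"
    by (simp add: Y_def add_divide_distrib mult_ac)
  have YR: "Y * R = X * R ^ Suc k" by (simp add: Y_def mult_ac)
  show ?case
  proof (intro exI[of _ "u' + real (pick P 0) / (Y * R)\<^sup>2"] conjI ballI)
    show "{u' + real (pick P 0) / (Y * R)\<^sup>2 .. u' + real (pick P 0) / (Y * R)\<^sup>2 + 1 / (X * R ^ Suc k)\<^sup>2} \<subseteq> {u .. u + 1 / X\<^sup>2}"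
      unfolding eq[symmetric] using sub u'(1) unfolding Y_def by (rule order_trans)
    fix \<beta> assume "\<beta> \<in> {u' + real (pick P 0) / (Y * R)\<^sup>2 .. u' + real (pick P 0) / (Y * R)\<^sup>2 + 1 / (X * R ^ Suc k)\<^sup>2}"
    hence b: "\<beta> \<in> {u' + real (pick P 0) / (Y * R)\<^sup>2 .. u' + (real (pick P 0) + 1) / (Y * R)\<^sup>2}" unfolding eq .
    have "badly_approx c (a * X) (a * Y) \<beta> 0" using sub b u'(2) unfolding Y_def by blast
    moreover have "badly_approx c (a * Y) (a * (Y * R)) \<beta> 0" using P b unfolding P_def by blast
    ultimately show "badly_approx c (a * X) (a * (X * R ^ Suc k)) \<beta> 0"
      unfolding YR[symmetric] by (rule badly_approx_trans)
  qed
qed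

text \<open>
  A child away from the ends of the interval leaves room for Farey neighbours on both sides of its points.
\<close>

lemma hom_central_child:
  fixes a c R X u :: real and N k :: nat
  assumes R: "R = 8 * real N" "N \<ge> 1" and X: "X > 0" and a: "0 < a" "a * R \<le> 1 / 2" and c: "c \<le> a\<^sup>2 / (2 * R\<^sup>2)"
  shows "\<exists>u'. {u' .. u' + 1 / (X * R)\<^sup>2} \<subseteq> {u + 1 / (4 * X\<^sup>2) .. u + 3 / (4 * X\<^sup>2)} \<and>
     (\<forall>\<beta>\<in>{u' .. u' + 1 / (X * R)\<^sup>2}. badly_approx c (a * X) (a * (X * R)) \<beta> 0)"
proof -
  define P where "P d \<longleftrightarrow> (\<forall>\<beta>\<in>{u + real d / (X * R)\<^sup>2 .. u + (real d + 1) / (X * R)\<^sup>2}. badly_approx c (a * X) (a * (X * R)) \<beta> 0)" for d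
  have NN: "1 \<le> N\<^sup>2" using R by simp
  have P: "P (pick P (4 * N\<^sup>2))" unfolding P_def by (rule hom_child[OF R(1) X a c]) (use NN in linarith)
  define d where "d = pick P (4 * N\<^sup>2)"
  have "32 * N\<^sup>2 \<le> d" "d \<le> 32 * N\<^sup>2 + 4" using pick_range[where P = P and i = "4 * N\<^sup>2"] by (auto simp: d_def)
  hence "real (32 * N\<^sup>2) \<le> d" "d \<le> real (32 * N\<^sup>2 + 4)" by (simp_all only: of_nat_le_iff)
  moreover have R2: "R\<^sup>2 = 64 * (real N)\<^sup>2" by (simp add: R power_mult_distrib)
  moreover have "1 \<le> (real N)\<^sup>2" using R by simp
  ultimately have d: "R\<^sup>2 / 4 \<le> d" "d + 1 \<le> 3 * R\<^sup>2 / 4" by auto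
  have R0: "R > 0" using R by simp
  have e: "R\<^sup>2 / (X * R)\<^sup>2 = 1 / X\<^sup>2" using X R0 by (simp add: power_mult_distrib)
  have "R\<^sup>2 / 4 / (X * R)\<^sup>2 \<le> d / (X * R)\<^sup>2" "(real d + 1) / (X * R)\<^sup>2 \<le> (3 * R\<^sup>2 / 4) / (X * R)\<^sup>2"
    by (rule divide_right_mono; use d in simp)+
  hence lo: "1 / (4 * X\<^sup>2) \<le> d / (X * R)\<^sup>2" and hi: "(real d + 1) / (X * R)\<^sup>2 \<le> 3 / (4 * X\<^sup>2)"
    using X R0 by (simp_all add: power_mult_distrib divide_simps)
  show ?thesis
    by (rule exI[of _ "u + d / (X * R)\<^sup>2"])
      (use lo hi P in \<open>auto simp: P_def d_def[symmetric] add_divide_distrib\<close>)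
qed

text \<open>
  A tree of the same kind as for \<open>\<beta>\<close>, in which all good children are kept.  The root is the cell of length \<open>1 / R\<^sup>2\<close> at
  \<open>1 / 2\<close>, where no denominator has been restricted yet.
\<close>

lemma good_cells:
  fixes R :: real and N L :: nat
  assumes R: "R = 8 * real N" "N \<ge> 1"
  shows "\<exists>V. finite V \<and> (64 * N\<^sup>2 - 3) ^ L \<le> card V \<and> (\<forall>d\<in>V. d < (64 * N\<^sup>2) ^ L \<and>
     (\<forall>x\<in>{1/2 + real d / (R ^ (L + 1))\<^sup>2 .. 1/2 + (real d + 1) / (R ^ (L + 1))\<^sup>2}.
        badly_approx (1 / (8 * R ^ 4)) 0 (1 / (2 * R) * R ^ (L + 1)) x 0))"
proof (induction L)
  case 0
  have "badly_approx (1 / (8 * R ^ 4)) 0 (1 / (2 * R) * R ^ (0 + 1)) x 0" for x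
    unfolding badly_approx_def using R by (auto simp: field_simps)
  thus ?case by (intro exI[of _ "{0}"]) auto
next
  case (Suc L)
  define B where "B = 64 * N\<^sup>2"
  have R0: "R > 0" using R by simp
  have RB: "R\<^sup>2 = real B" by (simp add: R B_def power_mult_distrib)
  have B: "B \<ge> 64" using R by (simp add: B_def)
  define X where "X = R ^ (L + 1)"
  have X: "X > 0" using R0 by (simp add: X_def)
  define good where "good X d \<longleftrightarrow> (\<forall>x\<in>{1/2 + real d / X\<^sup>2 .. 1/2 + (real d + 1) / X\<^sup>2}. badly_approx (1 / (8 * R ^ 4)) 0 (1 / (2 * R) * X) x 0)" for X d
  obtain V where V: "finite V" "(B - 3) ^ L \<le> card V" "\<And>d. d \<in> V \<Longrightarrow> d < B ^ L" "\<And>d. d \<in> V \<Longrightarrow> good X d"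
    using Suc unfolding B_def good_def X_def by blast
  define bad where "bad d = {e. e < B \<and> \<not> (\<forall>x\<in>{(1/2 + real d / X\<^sup>2) + real e / (X * R)\<^sup>2 .. (1/2 + real d / X\<^sup>2) + (real e + 1) / (X * R)\<^sup>2}.
      badly_approx (1 / (8 * R ^ 4)) (1 / (2 * R) * X) (1 / (2 * R) * (X * R)) x 0)}" for d
  have fb: "finite (bad d)" for d by (simp add: bad_def)
  have cb: "card (bad d) \<le> 3" for d
  proof (cases "bad d = {}")
    case False
    have win: "\<bar>real e - real e'\<bar> \<le> 2" if "e \<in> bad d" "e' \<in> bad d" for e e'
    proof (rule hom_step_window[of R X "1 / (2 * R)" "1 / (8 * R ^ 4)" e e' "1/2 + real d / X\<^sup>2"])
      show "1 / (8 * R ^ 4) \<le> (1 / (2 * R))\<^sup>2 / (2 * R\<^sup>2)" using R0 by (simp add: power2_eq_square eval_nat_numeral)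
      show "real e + 1 \<le> R\<^sup>2" "real e' + 1 \<le> R\<^sup>2" using that by (auto simp: RB bad_def)
    qed (use that R X R0 in \<open>auto simp: bad_def\<close>)
    have "bad d \<subseteq> {Min (bad d) .. Min (bad d) + 2}"
    proof
      fix e assume e: "e \<in> bad d"
      have "Min (bad d) \<le> e" "Min (bad d) \<in> bad d" using fb e False by auto
      thus "e \<in> {Min (bad d) .. Min (bad d) + 2}" using win[OF e, of "Min (bad d)"] by auto
    qed
    hence "card (bad d) \<le> card {Min (bad d) .. Min (bad d) + 2}" by (intro card_mono) auto
    thus ?thesis by simp
  qed simp
  define E where "E d = {..<B} - bad d" for d
  have cE: "B - 3 \<le> card (E d)" for d
  proof -
    have "card {..<B} - card (bad d) \<le> card (E d)" unfolding E_def by (rule diff_card_le_card_Diff[OF fb])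
    thus ?thesis using cb[of d] by simp
  qed
  define h where "h = (\<lambda>(d, e). B * d + e)"
  have inj: "inj_on h (Sigma V E)"
  proof (rule inj_onI, clarsimp simp: h_def E_def)
    fix d e d' e' assume *: "B * d + e = B * d' + e'" "e < B" "e' < B"
    have "(B * d + e) div B = d" using *(2) by simp
    moreover have "(B * d' + e') div B = d'" using *(3) by simp
    ultimately have "d = d'" using *(1) by simp
    thus "d = d' \<and> e = e'" using *(1) by simp
  qed
  have X2: "R ^ (Suc L + 1) = X * R" by (simp add: X_def mult_ac)
  have "finite (h ` Sigma V E)" using V by (auto simp: E_def)
  moreover have "(B - 3) ^ Suc L \<le> card (h ` Sigma V E)"
  proof -
    have "(B - 3) ^ Suc L \<le> card V * (B - 3)" using V(2) by simp
    also have "\<dots> = (\<Sum>d\<in>V. B - 3)" by simp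
    also have "\<dots> \<le> (\<Sum>d\<in>V. card (E d))" by (intro sum_mono cE)
    also have "\<dots> = card (Sigma V E)" using V by (simp add: card_SigmaI E_def)
    finally show ?thesis by (simp add: card_image inj)
  qed
  moreover have "k < B ^ Suc L \<and> good (X * R) k" if "k \<in> h ` Sigma V E" for k
  proof -
    from that obtain d e where k: "k = B * d + e" "d \<in> V" "e \<in> E d" by (auto simp: h_def)
    have e: "e < B" using k by (auto simp: E_def)
    have "B * d + e < B * d + B" using e by simp
    also have "\<dots> = B * (d + 1)" by simp
    also have "\<dots> \<le> B * B ^ L" using V(3)[OF k(2)] by (intro mult_left_mono) auto
    finally have lt: "k < B ^ Suc L" using k by simp
    have kd: "(real B * d + z) / (X * R)\<^sup>2 = d / X\<^sup>2 + z / (X * R)\<^sup>2" for z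
      using R0 X by (simp add: RB[symmetric] power_mult_distrib add_divide_distrib)
    have set_eq: "{1/2 + real k / (X * R)\<^sup>2 .. 1/2 + (real k + 1) / (X * R)\<^sup>2} =
      {(1/2 + real d / X\<^sup>2) + real e / (X * R)\<^sup>2 .. (1/2 + real d / X\<^sup>2) + (real e + 1) / (X * R)\<^sup>2}"
      using kd[of "real e"] kd[of "real e + 1"] by (simp add: k add.assoc)
    have "real e + 1 \<le> R\<^sup>2" using e by (simp add: RB)
    hence sub: "{(1/2 + real d / X\<^sup>2) + real e / (X * R)\<^sup>2 .. (1/2 + real d / X\<^sup>2) + (real e + 1) / (X * R)\<^sup>2} \<subseteq>
       {1/2 + real d / X\<^sup>2 .. 1/2 + real d / X\<^sup>2 + 1 / X\<^sup>2}" using X R0 by (intro cell_subset) auto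
    have "good (X * R) k"
      unfolding good_def set_eq
    proof
      fix x assume x: "x \<in> {(1/2 + real d / X\<^sup>2) + real e / (X * R)\<^sup>2 .. (1/2 + real d / X\<^sup>2) + (real e + 1) / (X * R)\<^sup>2}"
      have "badly_approx (1 / (8 * R ^ 4)) 0 (1 / (2 * R) * X) x 0"
        using V(4)[OF k(2)] subsetD[OF sub x] unfolding good_def by (simp add: add_divide_distrib add.assoc)
      moreover have "badly_approx (1 / (8 * R ^ 4)) (1 / (2 * R) * X) (1 / (2 * R) * (X * R)) x 0"
        using k(3) x e unfolding E_def bad_def by blast
      ultimately show "badly_approx (1 / (8 * R ^ 4)) 0 (1 / (2 * R) * (X * R)) x 0" by (rule badly_approx_trans)
    qed
    with lt show ?thesis by blast
  qed
  ultimately show ?case unfolding B_def[symmetric] X2 good_def by blast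
qed

lemma good_cells_measure:
  fixes R :: real and N L :: nat
  assumes R: "R = 8 * real N" "N \<ge> 1"
  shows "\<exists>S. S \<in> lmeasurable \<and> S \<subseteq> {0..1} \<and> (1 - 3 / R\<^sup>2) ^ L / R\<^sup>2 \<le> measure lebesgue S \<and>
     (\<forall>x\<in>S. \<exists>z. x \<in> {z .. z + 1 / (R ^ (L + 1))\<^sup>2} \<and> {z .. z + 1 / (R ^ (L + 1))\<^sup>2} \<subseteq> {1/3 .. 1} \<and>
       (\<forall>y\<in>{z .. z + 1 / (R ^ (L + 1))\<^sup>2}. badly_approx (1 / (8 * R ^ 4)) 0 (1 / (2 * R) * R ^ (L + 1)) y 0))"
proof -
  define B where "B = 64 * N\<^sup>2"
  have R0: "R > 0" "R \<ge> 8" using R by auto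
  have RB: "R\<^sup>2 = real B" by (simp add: R B_def power_mult_distrib)
  have B: "B \<ge> 64" using R by (simp add: B_def)
  obtain V where V: "finite V" "(B - 3) ^ L \<le> card V" "\<And>d. d \<in> V \<Longrightarrow> d < B ^ L"
    "\<And>d x. d \<in> V \<Longrightarrow> x\<in>{1/2 + real d / (R ^ (L + 1))\<^sup>2 .. 1/2 + (real d + 1) / (R ^ (L + 1))\<^sup>2} \<Longrightarrow>
        badly_approx (1 / (8 * R ^ 4)) 0 (1 / (2 * R) * R ^ (L + 1)) x 0"
    using good_cells[OF R, of L] unfolding B_def by blast
  define s where "s = 1 / (R ^ (L + 1))\<^sup>2"
  have s0: "s > 0" using R0 by (simp add: s_def)
  have sB: "s = 1 / (real B ^ L * R\<^sup>2)"
    by (simp add: s_def power_mult_distrib RB[symmetric] flip: power_mult) (simp add: mult_ac)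
  define C where "C d = {1/2 + real d * s ..< 1/2 + (real d + 1) * s}" for d :: nat
  have disj: "disjoint_family_on C V"
    unfolding disjoint_family_on_def
  proof (intro ballI impI)
    fix d d' :: nat assume "d \<noteq> d'"
    hence "real d + 1 \<le> real d' \<or> real d' + 1 \<le> real d" by linarith
    hence "(real d + 1) * s \<le> real d' * s \<or> (real d' + 1) * s \<le> real d * s" using s0 by auto
    thus "C d \<inter> C d' = {}" by (auto simp: C_def)
  qed
  define S where "S = (\<Union>d\<in>V. C d)"
  have meas: "measure lebesgue S = card V * s"
  proof -
    have "measure lebesgue S = (\<Sum>d\<in>V. measure lebesgue (C d))"
      unfolding S_def by (rule measure_finite_Union[OF V(1) _ disj]) (use s0 in \<open>auto simp: C_def algebra_simps\<close>)
    also have "\<dots> = (\<Sum>d\<in>V. s)" using s0 by (intro sum.cong) (auto simp: C_def algebra_simps)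
    finally show ?thesis by simp
  qed
  have rng: "(real d + 1) * s \<le> 1 / R\<^sup>2" if "d \<in> V" for d
  proof -
    have "real (d + 1) \<le> real (B ^ L)" using V(3)[OF that] by (subst of_nat_le_iff) simp
    hence "(real d + 1) * s \<le> real (B ^ L) * s" using s0 by (intro mult_right_mono) auto
    also have "\<dots> = 1 / R\<^sup>2" using B by (simp add: sB)
    finally show ?thesis .
  qed
  have R64: "1 / R\<^sup>2 \<le> 1 / 64"
  proof -
    have "8\<^sup>2 \<le> R\<^sup>2" using R0 by (intro power_mono) auto
    thus ?thesis by (intro divide_left_mono) auto
  qed
  have cell: "{1/2 + real d * s .. 1/2 + real d * s + s} \<subseteq> {1/3..1}" if "d \<in> V" for d
  proof
    fix y assume "y \<in> {1/2 + real d * s .. 1/2 + real d * s + s}"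
    moreover have "real d * s + s \<le> 1 / 64" using rng[OF that] R64 by (simp add: algebra_simps)
    moreover have "0 \<le> real d * s" using s0 by simp
    ultimately have "1/3 \<le> y" "y \<le> 1" unfolding atLeastAtMost_iff by linarith+
    thus "y \<in> {1/3..1}" by simp
  qed
  show ?thesis
  proof (intro exI[of _ S] conjI ballI)
    have "C d \<in> lmeasurable" for d
      by (rule bounded_set_imp_lmeasurable)
        (auto simp: C_def intro: bounded_subset[OF bounded_closed_interval[of "1/2 + real d * s" "1/2 + (real d + 1) * s"]])
    thus "S \<in> lmeasurable" unfolding S_def using V(1) by (intro fmeasurable.finite_UN) auto
    show "S \<subseteq> {0..1}" unfolding S_def C_def using cell by (fastforce simp: algebra_simps)
    have "(1 - 3 / R\<^sup>2) ^ L / R\<^sup>2 = (real B - 3) ^ L * s"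
    proof -
      have "1 - 3 / R\<^sup>2 = (real B - 3) / real B" using B by (simp add: RB field_simps)
      thus ?thesis by (simp add: sB power_divide)
    qed
    also have "\<dots> = real ((B - 3) ^ L) * s" using B by (simp add: of_nat_diff)
    also have "\<dots> \<le> card V * s" using V(2) s0 by (intro mult_right_mono) (auto simp only: of_nat_le_iff)
    finally show "(1 - 3 / R\<^sup>2) ^ L / R\<^sup>2 \<le> measure lebesgue S" using meas by simp
    fix x assume "x \<in> S"
    then obtain d where d: "d \<in> V" "x \<in> C d" by (auto simp: S_def)
    show "\<exists>z. x \<in> {z .. z + 1 / (R ^ (L + 1))\<^sup>2} \<and> {z .. z + 1 / (R ^ (L + 1))\<^sup>2} \<subseteq> {1/3 .. 1} \<and>
       (\<forall>y\<in>{z .. z + 1 / (R ^ (L + 1))\<^sup>2}. badly_approx (1 / (8 * R ^ 4)) 0 (1 / (2 * R) * R ^ (L + 1)) y 0)"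
      unfolding s_def[symmetric]
      by (rule exI[of _ "1/2 + real d * s"]) (use d cell V(4) in \<open>auto simp: C_def s_def algebra_simps add_divide_distrib\<close>)
  qed
qed

text \<open>
  The constants of the construction: a box at scale \<open>X\<close> has homogeneous conditions for denominators up to
  \<open>1 / (4 * R\<^sup>2) * X\<close>.  A free step achieves the constant \<open>1 / (32 * R ^ 6)\<close>, a forced step the smaller
  constant \<open>1 / R ^ 7\<close>, which is the one maintained throughout.
\<close>

lemma block_constants:
  fixes R :: real
  assumes R: "1048576 \<le> R"
  shows "0 < 1 / (4 * R\<^sup>2)" "1 / (4 * R\<^sup>2) * R \<le> 1 / 2"
    "1 / (32 * R ^ 6) \<le> (1 / (4 * R\<^sup>2))\<^sup>2 / (2 * R\<^sup>2)" "1 / R ^ 7 \<le> 1 / (32 * R ^ 6)"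
proof -
  have R0: "R > 0" using R by simp
  show "0 < 1 / (4 * R\<^sup>2)" using R0 by simp
  show "1 / (4 * R\<^sup>2) * R \<le> 1 / 2" using R R0 by (simp add: power2_eq_square divide_simps)
  show "1 / (32 * R ^ 6) \<le> (1 / (4 * R\<^sup>2))\<^sup>2 / (2 * R\<^sup>2)" using R0 by (simp add: power2_eq_square eval_nat_numeral)
  have "32 * R ^ 6 \<le> R * R ^ 6" using R by (intro mult_right_mono) auto
  also have "\<dots> = R ^ 7" by (simp flip: power_Suc)
  finally show "1 / R ^ 7 \<le> 1 / (32 * R ^ 6)" using R0 by (intro divide_left_mono) auto
qed

text \<open>
  After some free steps, Farey neighbours of a point are of comparable size because the point is badly
  approximable with the better constant of free steps, and the interval between them lies inside the given
  interval.  Comparability makes every point of this Farey interval, away from its ends, badly approximable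
  up to the denominator of the mediant.  The resulting constant depends on the number of free steps only, not on
  the past, so it does not deteriorate when forced steps are repeated.
\<close>

lemma farey_prefix:
  fixes R X u :: real and N :: nat
  assumes R: "R = 8 * real N" "1048576 \<le> R" and X: "X \<ge> 1"
    and good: "\<And>\<beta>. \<beta> \<in> {u .. u + 1 / X\<^sup>2} \<Longrightarrow> badly_approx (1 / R ^ 7) 0 (1 / (4 * R\<^sup>2) * X) \<beta> 0"
  shows "\<exists>v V. \<bar>det2 v V\<bar> = 1 \<and> 1 \<le> snd V \<and> snd V \<le> fst V \<and> X * R ^ 5 \<le> of_int (fst V) \<and> of_int (fst V) \<le> X * R ^ 6 \<and>
    of_int (fst V) \<le> R ^ 7 * of_int (snd V) \<and>
    (\<forall>y\<in>{0..1}. lin v y / lin V y \<in> {u .. u + 1 / X\<^sup>2}) \<and>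
    (\<forall>y\<in>{1/3..1}. \<forall>q p. 1 \<le> q \<longrightarrow> q < fst V + snd V \<longrightarrow>
        1 / R ^ 7 \<le> of_int q * \<bar>of_int q * (lin v y / lin V y) - of_int p\<bar>)"
proof -
  define a where "a = 1 / (4 * R\<^sup>2)"
  define cF where "cF = 1 / (32 * R ^ 6)"
  define cs where "cs = 1 / R ^ 7"
  have R0: "R > 0" using R by simp
  have N: "N \<ge> 1" using R by (cases N) auto
  have a: "0 < a" "a * R \<le> 1 / 2" unfolding a_def by (rule block_constants[OF R(2)])+
  have cF: "cF \<le> a\<^sup>2 / (2 * R\<^sup>2)" unfolding a_def cF_def by (rule block_constants[OF R(2)])
  have cs: "0 < cs" "cs \<le> cF"
  proof -
    show "cs \<le> cF" unfolding cs_def cF_def by (rule block_constants[OF R(2)])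
    show "0 < cs" using R0 by (simp add: cs_def)
  qed
  have X0: "X > 0" using X by simp
  \<comment> \<open>Denominators up to \<open>a * X2\<close> are covered by the interval reached after two free steps.  Six more raise the order \<open>T\<close> of the Farey fractions until \<open>small\<close> and \<open>gap_small\<close> below hold.\<close>
  obtain u2 where u2: "{u2 .. u2 + 1 / (X * R ^ 2)\<^sup>2} \<subseteq> {u .. u + 1 / X\<^sup>2}"
    "\<And>\<beta>. \<beta> \<in> {u2 .. u2 + 1 / (X * R ^ 2)\<^sup>2} \<Longrightarrow> badly_approx cF (a * X) (a * (X * R ^ 2)) \<beta> 0"
    using hom_descend[where u = u and k = 2, OF R(1) N X0 a cF] by blast
  define X2 where "X2 = X * R ^ 2"
  have X20: "X2 > 0" using X0 R0 by (simp add: X2_def)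
  obtain u3 where u3: "{u3 .. u3 + 1 / (X2 * R)\<^sup>2} \<subseteq> {u2 + 1 / (4 * X2\<^sup>2) .. u2 + 3 / (4 * X2\<^sup>2)}"
    "\<And>\<beta>. \<beta> \<in> {u3 .. u3 + 1 / (X2 * R)\<^sup>2} \<Longrightarrow> badly_approx cF (a * X2) (a * (X2 * R)) \<beta> 0"
    using hom_central_child[where u = u2, OF R(1) N X20 a cF] by blast
  have X30: "X2 * R > 0" using X20 R0 by simp
  obtain u8 where u8: "{u8 .. u8 + 1 / (X2 * R * R ^ 5)\<^sup>2} \<subseteq> {u3 .. u3 + 1 / (X2 * R)\<^sup>2}"
    "\<And>\<beta>. \<beta> \<in> {u8 .. u8 + 1 / (X2 * R * R ^ 5)\<^sup>2} \<Longrightarrow> badly_approx cF (a * (X2 * R)) (a * (X2 * R * R ^ 5)) \<beta> 0"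
    using hom_descend[where u = u3 and k = 5, OF R(1) N X30 a cF] by blast
  define T where "T = X * R ^ 6 / 4"
  have T: "a * (X2 * R * R ^ 5) = T" using R0 by (simp add: a_def X2_def T_def eval_nat_numeral)
  have b8: "u8 \<in> {u8 .. u8 + 1 / (X2 * R * R ^ 5)\<^sup>2}" by simp
  have b3: "u8 \<in> {u3 .. u3 + 1 / (X2 * R)\<^sup>2}" using u8(1) b8 by blast
  have b2: "u8 \<in> {u2 + 1 / (4 * X2\<^sup>2) .. u2 + 3 / (4 * X2\<^sup>2)}" using u3(1) b3 by blast
  have in2: "{u2 + 1 / (4 * X2\<^sup>2) .. u2 + 3 / (4 * X2\<^sup>2)} \<subseteq> {u2 .. u2 + 1 / (X * R ^ 2)\<^sup>2}"
    unfolding X2_def[symmetric] using X20 by (auto simp: field_simps)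
  have bu: "u8 \<in> {u .. u + 1 / X\<^sup>2}" using b2 in2 u2(1) by blast
  have gF: "badly_approx cF (a * X) T u8 0"
  proof (rule badly_approx_trans)
    show "badly_approx cF (a * X) (a * X2) u8 0" unfolding X2_def by (rule u2(2)[OF subsetD[OF in2 b2]])
    have "badly_approx cF (a * (X2 * R)) T u8 0" using u8(2)[OF b8] unfolding T .
    thus "badly_approx cF (a * X2) T u8 0" by (rule badly_approx_trans[OF u3(2)[OF b3]])
  qed
  have gs: "badly_approx cs 0 T u8 0"
  proof (rule badly_approx_trans)
    show "badly_approx cs 0 (a * X) u8 0" using good[OF bu] by (simp add: cs_def a_def)
    show "badly_approx cs (a * X) T u8 0" by (rule badly_approx_mono[OF gF]) (use cs in auto)
  qed
  have Rbig: "R \<ge> 1048576" using R by simp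
  have R6: "R ^ 6 \<ge> 1048576"
  proof -
    have "R * 1 \<le> R * R ^ 5" using R0 Rbig by (intro mult_left_mono one_le_power) auto
    also have "R * R ^ 5 = R ^ 6" by (simp flip: power_Suc)
    finally show ?thesis using Rbig by simp
  qed
  have T4: "T \<ge> 4"
  proof -
    have "1 * R ^ 6 \<le> X * R ^ 6" using X R0 by (intro mult_right_mono) auto
    thus ?thesis using R6 by (simp add: T_def)
  qed
  define H where "H = nat \<lfloor>T\<rfloor>"
  have H: "real H \<le> T" "T < real H + 1" "H \<ge> 1" using T4 by (auto simp: H_def) linarith+
  obtain P Q P' Q' :: int where f: "Q \<ge> 1" "Q' \<ge> 1" "Q \<le> H" "Q' \<le> H" "Q + Q' > H" "P' * Q - P * Q' = 1"
    "P / Q \<le> u8" "u8 \<le> P' / Q'" using farey_neighbours[OF H(3), of u8] by blast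
  define gap where "gap = 1 / (real_of_int Q * Q')"
  have QQ: "0 < real_of_int Q" "0 < real_of_int Q'" using f by auto
  have gap: "P' / Q' - P / Q = gap"
  proof -
    have "real_of_int (P' * Q - P * Q') = 1" using f by simp
    thus ?thesis using QQ by (simp add: gap_def field_simps)
  qed
  have H': "real_of_int Q \<le> T" "real_of_int Q' \<le> T" "T < real_of_int Q + Q'" using f H by linarith+
  have ratio: "cs * Q' \<le> Q \<and> cs * Q \<le> Q' \<and> (a * X < Q \<longrightarrow> cF * Q' \<le> Q) \<and> (a * X < Q' \<longrightarrow> cF * Q \<le> Q')"
  proof -
    have e: "c * t \<le> q" if g: "c \<le> q * \<bar>q * u8 - p\<bar>" and d: "\<bar>u8 - p / q\<bar> \<le> 1 / (q * t)" and q: "0 < q" "0 < t" for c q p t :: real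
    proof -
      have "q * u8 - p = q * (u8 - p / q)" using q by (simp add: field_simps)
      hence "\<bar>q * u8 - p\<bar> = q * \<bar>u8 - p / q\<bar>" using q by (simp add: abs_mult)
      also have "\<dots> \<le> q * (1 / (q * t))" using d q by (intro mult_left_mono) auto
      also have "\<dots> = 1 / t" using q by simp
      finally have "q * \<bar>q * u8 - p\<bar> \<le> q * (1 / t)" using q by (intro mult_left_mono) auto
      with g have "c \<le> q / t" by simp
      thus ?thesis using q by (simp add: field_simps)
    qed
    have d: "\<bar>u8 - P / Q\<bar> \<le> 1 / (real_of_int Q * Q')" "\<bar>u8 - P' / Q'\<bar> \<le> 1 / (real_of_int Q' * Q)"
      using f(7,8) gap by (auto simp: gap_def mult.commute)
    have "cs * Q' \<le> Q" by (rule e[OF _ d(1) QQ]) (use badly_approxD[OF gs, of Q P] f H' QQ in auto)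
    moreover have "cs * Q \<le> Q'" by (rule e[OF _ d(2) QQ(2,1)]) (use badly_approxD[OF gs, of Q' P'] f H' QQ in auto)
    moreover have "cF * Q' \<le> Q" if "a * X < Q" by (rule e[OF _ d(1) QQ]) (use badly_approxD[OF gF, of Q P] f H' QQ that in auto)
    moreover have "cF * Q \<le> Q'" if "a * X < Q'" by (rule e[OF _ d(2) QQ(2,1)]) (use badly_approxD[OF gF, of Q' P'] f H' QQ that in auto)
    ultimately show ?thesis by blast
  qed
  \<comment> \<open>Both denominators lie in the range of the better constant \<open>cF\<close>.\<close>
  have small: "a * X < q'" if "cs * q \<le> q'" "T / 2 < q" for q q' :: real
  proof -
    have "a * X < cs * (T / 2)" using X0 R0 Rbig by (simp add: a_def cs_def T_def field_simps eval_nat_numeral)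
    also have "\<dots> < cs * q" using that cs by simp
    finally show ?thesis using that by simp
  qed
  define v V where vV: "v = (if Q' \<le> Q then (P, P') else (P', P))" "V = (if Q' \<le> Q then (Q, Q') else (Q', Q))"
  have V: "1 \<le> snd V" "snd V \<le> fst V" "\<bar>det2 v V\<bar> = 1" using f by (auto simp: vV det2_def mult.commute)
  have V1: "T / 2 < fst V" "fst V \<le> T" using H' by (auto simp: vV)
  have prod: "real_of_int (fst V) * snd V = real_of_int Q * Q'" by (auto simp: vV)
  have VcF: "cF * fst V \<le> snd V"
  proof -
    have "cs * fst V \<le> snd V" using ratio by (auto simp: vV)
    hence "a * X < snd V" using small V1 by blast
    thus ?thesis using ratio by (auto simp: vV split: if_splits)
  qed
  have gap_small: "gap \<le> 1 / (4 * X2\<^sup>2)"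
  proof -
    have "cF * (T / 2)\<^sup>2 \<le> cF * (real_of_int (fst V))\<^sup>2"
      using V1 T4 cs by (intro mult_left_mono power_mono) auto
    also have "\<dots> = real_of_int (fst V) * (cF * fst V)" by (simp add: power2_eq_square)
    also have "\<dots> \<le> real_of_int (fst V) * snd V" using VcF V by (intro mult_left_mono) auto
    finally have *: "cF * (T / 2)\<^sup>2 \<le> real_of_int Q * Q'" using prod by simp
    have "4 * X2\<^sup>2 \<le> cF * (T / 2)\<^sup>2"
    proof -
      have "cF * (T / 2)\<^sup>2 = X\<^sup>2 * R ^ 6 / 2048" using R0 by (simp add: cF_def T_def field_simps eval_nat_numeral)
      moreover have "4 * X2\<^sup>2 = X\<^sup>2 * (4 * R ^ 4)" by (simp add: X2_def power_mult_distrib flip: power_mult)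
      moreover have "X\<^sup>2 * (4 * R ^ 4) \<le> X\<^sup>2 * (R ^ 6 / 2048)"
      proof (rule mult_left_mono)
        have "8192 \<le> R\<^sup>2" using Rbig power_mono[of 1048576 R 2] by simp
        hence "8192 * R ^ 4 \<le> R\<^sup>2 * R ^ 4" by (intro mult_right_mono) auto
        thus "4 * R ^ 4 \<le> R ^ 6 / 2048" by (simp flip: power_add)
      qed simp
      ultimately show ?thesis by simp
    qed
    thus ?thesis unfolding gap_def using * X20 by (intro divide_left_mono) (auto intro!: mult_pos_pos QQ)
  qed
  have val: "lin v y / lin V y \<in> {P / Q .. P' / Q'}" if y: "y \<in> {0..1}" for y
  proof -
    have cmp: "lo \<le> (A + B * y) / (C + D * y) \<and> (A + B * y) / (C + D * y) \<le> hi"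
      if h: "0 < C" "0 < D" "lo \<le> A / C" "A / C \<le> hi" "lo \<le> B / D" "B / D \<le> hi" for A B C D lo hi :: real
    proof -
      have pos: "C + D * y > 0" using h y by (simp add: add_pos_nonneg)
      have 1: "lo * C \<le> A" "A \<le> hi * C" "lo * D \<le> B" "B \<le> hi * D"
        using h by (simp_all add: le_divide_eq divide_le_eq)
      have "lo * D * y \<le> B * y" "B * y \<le> hi * D * y" using y by (intro mult_right_mono 1; simp)+
      hence "lo * (C + D * y) \<le> A + B * y" "A + B * y \<le> hi * (C + D * y)" using 1 by (simp_all add: distrib_left)
      thus ?thesis using pos by (simp add: le_divide_eq divide_le_eq)
    qed
    have ord: "P / Q \<le> P' / Q'" using f by linarith
    show ?thesis unfolding lin_def 
      using cmp[where lo = "P / Q" and hi = "P' / Q'" and A = "real_of_int P" and B = "real_of_int P'" and C = "real_of_int Q" and D = "real_of_int Q'"]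
        cmp[where lo = "P / Q" and hi = "P' / Q'" and A = "real_of_int P'" and B = "real_of_int P" and C = "real_of_int Q'" and D = "real_of_int Q"] QQ ord by (auto simp: vV)
  qed
  have val2: "lin v y / lin V y \<in> {u2 .. u2 + 1 / (X * R ^ 2)\<^sup>2}" if y: "y \<in> {0..1}" for y
  proof -
    have "3 / (4 * X2\<^sup>2) + 1 / (4 * X2\<^sup>2) = 1 / X2\<^sup>2" using X20 by (simp add: field_simps)
    hence "u2 \<le> lin v y / lin V y \<and> lin v y / lin V y \<le> u2 + 1 / X2\<^sup>2"
      using val[OF y] gap gap_small b2 f(7,8) by auto
    thus ?thesis by (simp add: X2_def)
  qed
  have good2: "cs \<le> q * \<bar>q * (lin v y / lin V y) - of_int p\<bar>"
    if y: "y \<in> {1/3..1}" and q: "1 \<le> q" "q < fst V + snd V" for y and q p :: int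
  proof (cases "q \<le> a * X2")
    case True
    have y01: "y \<in> {0..1}" using y by auto
    have m: "lin v y / lin V y \<in> {u2 .. u2 + 1 / (X * R ^ 2)\<^sup>2}" by (rule val2[OF y01])
    have "badly_approx cs 0 (a * (X * R\<^sup>2)) (lin v y / lin V y) 0"
    proof (rule badly_approx_trans)
      show "badly_approx cs 0 (a * X) (lin v y / lin V y) 0"
        using good[OF subsetD[OF u2(1) m]] by (simp add: cs_def a_def)
      show "badly_approx cs (a * X) (a * (X * R\<^sup>2)) (lin v y / lin V y) 0"
        by (rule badly_approx_mono[OF u2(2)[OF m]]) (use cs in auto)
    qed
    from badly_approxD[OF this, of q p] show ?thesis using True q by (simp add: X2_def)
  next
    case False
    have L: "0 < lin V y" using lin_pos[of V y] V y by auto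
    have "snd V * y \<le> real_of_int (fst V) * 1" using V y by (intro mult_mono) auto
    hence L2: "lin V y \<le> 2 * T" using V1 by (simp add: lin_def)
    have "(1/3) / (2 * T) \<le> y / lin V y" using y L L2 by (intro frac_le) auto
    also have "\<dots> \<le> \<bar>q * (lin v y / lin V y) - of_int p\<bar>"
      by (rule below_mediant) (use V y q in auto)
    finally have *: "1 / (6 * T) \<le> \<bar>q * (lin v y / lin V y) - of_int p\<bar>" by simp
    have "cs \<le> (a * X2) * (1 / (6 * T))"
      using R0 X0 Rbig by (simp add: cs_def a_def X2_def T_def field_simps eval_nat_numeral)
    also have "\<dots> \<le> q * \<bar>q * (lin v y / lin V y) - of_int p\<bar>"
      using False * a X20 T4 q(1) by (intro mult_mono) auto
    finally show ?thesis .
  qed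
  show ?thesis
  proof (rule exI[of _ v], rule exI[of _ V], intro conjI)
    show "\<bar>det2 v V\<bar> = 1" "1 \<le> snd V" "snd V \<le> fst V" by (fact V)+
    have "8 * R ^ 5 \<le> R * R ^ 5" using Rbig by (intro mult_right_mono) auto
    hence "X * (8 * R ^ 5) \<le> X * R ^ 6" using X0 by (intro mult_left_mono) (auto simp: eval_nat_numeral)
    thus "X * R ^ 5 \<le> of_int (fst V)" using V1 by (simp add: T_def)
    have "0 \<le> X * R ^ 6" using X0 R0 by simp
    thus "of_int (fst V) \<le> X * R ^ 6" using V1 by (simp add: T_def)
    have "cs * fst V \<le> cF * fst V" using cs V by (intro mult_right_mono) auto
    hence "cs * fst V \<le> snd V" using VcF by linarith
    thus "of_int (fst V) \<le> R ^ 7 * of_int (snd V)" using R0 by (simp add: cs_def field_simps)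
    show "\<forall>y\<in>{0..1}. lin v y / lin V y \<in> {u .. u + 1 / X\<^sup>2}" using val2 u2(1) by blast
    show "\<forall>y\<in>{1/3..1}. \<forall>q p. 1 \<le> q \<longrightarrow> q < fst V + snd V \<longrightarrow>
        1 / R ^ 7 \<le> of_int q * \<bar>of_int q * (lin v y / lin V y) - of_int p\<bar>"
      using good2 unfolding cs_def by blast
  qed
qed

lemma cos_near_integer:
  assumes "cos (2 * pi * \<eta>) < cos (2 * pi * y)" "0 \<le> \<eta>"
  obtains p :: int where "\<bar>y - p\<bar> < \<eta>"
proof (rule that[of "round y"], rule ccontr)
  assume "\<not> \<bar>y - of_int (round y)\<bar> < \<eta>"
  hence far: "\<eta> \<le> \<bar>y - round y\<bar>" by simp
  have half: "\<bar>y - round y\<bar> \<le> 1 / 2" using of_int_round_abs_le[of y] by (simp add: abs_minus_commute)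
  have "cos (2 * pi * y) = cos (2 * pi * (y - round y))"
    by (simp add: right_diff_distrib cos_diff cos_int_2pin sin_int_2pin)
  also have "\<dots> = cos \<bar>2 * pi * (y - round y)\<bar>" by simp
  also have "\<bar>2 * pi * (y - round y)\<bar> = 2 * pi * \<bar>y - round y\<bar>" by (simp add: abs_mult)
  also have "cos \<dots> \<le> cos (2 * pi * \<eta>)"
    using far half assms(2) by (intro cos_monotone_0_pi_le) auto
  finally show False using assms(1) by simp
qed

text \<open>
  The derivative of \<open>n * \<beta>\<^sub>w\<close> is of order \<open>n / (fst V)\<^sup>2\<close>.  The lower bound on \<open>n\<close> makes it exceed
  the losses in the separation of words, which are exponential in \<open>l = 32 * j\<close>, and \<open>S\<close> has measure at least \<open>1 / 4 ^ j\<close>, much more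
  than \<open>256 / 2 ^ (24 * j)\<close>, the bound for a set that avoids the target.
\<close>

lemma cf_family_hits_target:
  fixes R X q0 \<delta> :: real and j n N :: nat
  assumes R: "R = 8 * real N" "1048576 \<le> R" and X: "X \<ge> 1" and lam: "j \<ge> 3" "R\<^sup>2 \<le> 2 ^ j"
    and n: "X\<^sup>2 * R ^ (896 * j) \<le> real n"
    and V: "\<bar>det2 v V\<bar> = 1" "1 \<le> snd V" "snd V \<le> fst V" "of_int (fst V) \<le> X * R ^ 6" "of_int (fst V) \<le> R ^ 7 * of_int (snd V)"
    and S: "S \<in> lmeasurable" "S \<subseteq> {0..1}" "(1 - 3 / R\<^sup>2) ^ (480 * j) / R\<^sup>2 \<le> measure lebesgue S"
  shows "\<exists>w\<in>words (32 * j). \<exists>x\<in>S. \<exists>p::int. \<bar>n * (lin (cf_word w v) x / lin (cf_word w V) x) - \<delta> - p\<bar> < 1 / 2 ^ j"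
proof (rule ccontr)
  assume no: "\<not> ?thesis"
  define l where "l = 32 * j"
  have l: "l \<ge> 1" using lam by (simp add: l_def)
  have R0: "R > 0" using R by simp
  define q0 where "q0 = real_of_int (fst V)"
  have q0: "q0 \<ge> 1" using V by (simp add: q0_def)
  define \<beta> where "\<beta> w x = lin (cf_word w v) x / lin (cf_word w V) x" for w x
  define \<theta> where "\<theta> w x = 2 * pi * (n * \<beta> w x - \<delta>)" for w x
  define \<tau> where "\<tau> = 1 / (2::real) ^ l"
  define \<eta> where "\<eta> = 1 / (2::real) ^ j"
  define \<kappa> where "\<kappa> = 1 / (R ^ 7 * 5 * 3 ^ l)"
  define e where "e = real_of_int ((-1) ^ l * det2 v V)"
  have e: "\<bar>e\<bar> = 1" using V(1) by (simp add: e_def abs_mult power_abs flip: of_int_abs)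
  have wb: "snd V \<le> snd (cf_word w V)" "snd (cf_word w V) \<le> fst (cf_word w V)"
    "fst V \<le> fst (cf_word w V)" "fst (cf_word w V) \<le> 3 ^ l * fst V" if "w \<in> words l" for w
    using cf_word_bounds[of w V] that V by (auto simp: words_def)
  have linpos: "lin (cf_word w V) x > 0" if "w \<in> words l" "x \<in> {0..1}" for w x
    using lin_pos[of "cf_word w V" x] wb[OF that(1)] V that(2) by auto
  have deriv: "(\<beta> w has_real_derivative e / (lin (cf_word w V) x)\<^sup>2) (at x within T)"
    if w: "w \<in> words l" and x: "x \<in> {0..1}" for w x T
  proof -
    have nz: "lin (cf_word w V) x \<noteq> 0" using linpos[OF w x] by simp
    have d: "((\<lambda>x. lin u x) has_real_derivative of_int (snd u)) (at x within T)" for u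
      unfolding lin_def by (auto intro!: derivative_eq_intros)
    have "((\<lambda>x. lin (cf_word w v) x / lin (cf_word w V) x) has_real_derivative
      (of_int (snd (cf_word w v)) * lin (cf_word w V) x - lin (cf_word w v) x * of_int (snd (cf_word w V))) /
        (lin (cf_word w V) x * lin (cf_word w V) x)) (at x within T)"
      by (rule DERIV_divide[OF d d nz])
    moreover have "of_int (snd (cf_word w v)) * lin (cf_word w V) x - lin (cf_word w v) x * of_int (snd (cf_word w V)) =
       real_of_int (det2 (cf_word w v) (cf_word w V))"
      by (simp add: lin_def det2_def algebra_simps)
    moreover have "real_of_int (det2 (cf_word w v) (cf_word w V)) = e"
      using w by (simp only: det2_cf_word e_def) (simp add: words_def)
    ultimately show ?thesis by (simp add: \<beta>_def[abs_def] power2_eq_square)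
  qed
  have "measure lebesgue S \<le> 256 * \<tau> / \<eta> ^ 8"
  proof (rule few_points_avoid_target[where W = "words l" and \<theta> = \<theta>])
    show "finite (words l)" by (rule words_finite)
    show "1 / real (card (words l)) \<le> \<tau>" by (simp add: words_card \<tau>_def)
    have "card (words l) \<noteq> 0" by (simp add: words_card)
    thus "words l \<noteq> {}" by auto
    show "continuous_on {0..1} (\<theta> w)" if "w \<in> words l" for w
      unfolding \<theta>_def by (intro continuous_intros DERIV_continuous_on[OF deriv[OF that]])
    show "0 < \<eta>" by (simp add: \<eta>_def)
    have "(2::real) ^ 3 \<le> 2 ^ j" using lam by (intro power_increasing) auto
    thus "\<eta> \<le> 1 / 8" unfolding \<eta>_def by (intro divide_left_mono) auto
    show "S \<in> lmeasurable" "S \<subseteq> {0..1}" by fact+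
    show "cos (\<theta> w x) \<le> cos (2 * pi * \<eta>)" if "x \<in> S" "w \<in> words l" for x w
    proof (rule ccontr)
      assume "\<not> ?thesis"
      hence "cos (2 * pi * \<eta>) < cos (2 * pi * (n * \<beta> w x - \<delta>))" by (simp add: \<theta>_def)
      then obtain p :: int where "\<bar>n * \<beta> w x - \<delta> - p\<bar> < \<eta>" by (rule cos_near_integer) (simp add: \<eta>_def)
      thus False using no that by (auto simp: \<beta>_def \<eta>_def l_def)
    qed
    show "\<bar>integral {0..1} (\<lambda>x. cos (h * (\<theta> w x - \<theta> w' x)))\<bar> \<le> 3 * \<tau>"
      if w: "w \<in> words l" "w' \<in> words l" "w \<noteq> w'" and h: "1 \<le> \<bar>h\<bar>" for w w' and h :: real
    proof (rule mobius_phase_integral[where Q = q0 and X = "3 ^ l" and \<kappa> = \<kappa> and k = "h * (2 * pi * n * e)"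
          and A = "of_int (fst (cf_word w V))" and B = "of_int (snd (cf_word w V))"
          and A' = "of_int (fst (cf_word w' V))" and B' = "of_int (snd (cf_word w' V))"])
      have up: "real_of_int (fst (cf_word w V)) \<le> 3 ^ l * q0" if "w \<in> words l" for w
      proof -
        have "real_of_int (fst (cf_word w V)) \<le> real_of_int (3 ^ l * fst V)" using wb(4)[OF that] by (simp only: of_int_le_iff)
        thus ?thesis by (simp add: q0_def)
      qed
      show "real_of_int (fst (cf_word w V)) \<le> 3 ^ l * q0" "real_of_int (fst (cf_word w' V)) \<le> 3 ^ l * q0"
        using up w by auto
      show "q0 \<le> of_int (fst (cf_word w V))" "q0 \<le> of_int (fst (cf_word w' V))" using wb w by (auto simp: q0_def)
      show "0 \<le> real_of_int (snd (cf_word w V))" "0 \<le> real_of_int (snd (cf_word w' V))"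
        "real_of_int (snd (cf_word w V)) \<le> fst (cf_word w V)" "real_of_int (snd (cf_word w' V)) \<le> fst (cf_word w' V)"
        using wb[OF w(1)] wb[OF w(2)] V by auto
      show "0 < q0" using q0 by simp
      show \<kappa>0: "0 < \<kappa>" using R0 by (simp add: \<kappa>_def)
      have a: "1 \<le> R ^ 7" using R(2) by (intro one_le_power) simp
      have b: "(1::real) \<le> 5 * 3 ^ l" using one_le_power[of "3::real" l] by linarith
      have "1 * 1 \<le> R ^ 7 * (5 * 3 ^ l)" by (rule mult_mono[OF a b]) (use R0 in auto)
      thus "\<kappa> \<le> 1" using R0 by (simp add: \<kappa>_def)
      show "0 < \<tau>" "\<tau> \<le> 1" by (auto simp: \<tau>_def)
      have n0: "n > 0"
      proof -
        have "0 < X\<^sup>2 * R ^ (896 * j)" using X R0 by simp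
        thus ?thesis using n by (cases n) auto
      qed
      show "h * (2 * pi * n * e) \<noteq> 0" using h e n0 by auto
      show "\<kappa> * q0 \<le> \<bar>real_of_int (fst (cf_word w' V)) - of_int (fst (cf_word w V))\<bar> \<or>
            \<kappa> * q0 \<le> \<bar>real_of_int (snd (cf_word w' V)) - of_int (snd (cf_word w V))\<bar>"
      proof (rule ccontr)
        assume far: "\<not> ?thesis"
        have "w = w'"
        proof (rule words_separated[OF V(2,3) w(1,2)])
          have "5 * 3 ^ l * (\<kappa> * q0) = q0 / R ^ 7" by (simp add: \<kappa>_def)
          also have "\<dots> \<le> of_int (snd V)" using V(5) R0 by (simp add: divide_le_eq q0_def mult.commute)
          finally show "5 * 3 ^ l * (\<kappa> * q0) \<le> of_int (snd V)" .
        qed (use far in \<open>auto simp: abs_minus_commute\<close>)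
        thus False using w by simp
      qed
      show "((\<lambda>x. h * (\<theta> w x - \<theta> w' x)) has_real_derivative
          h * (2 * pi * n * e) * (1 / (of_int (fst (cf_word w V)) + of_int (snd (cf_word w V)) * x)\<^sup>2 -
             1 / (of_int (fst (cf_word w' V)) + of_int (snd (cf_word w' V)) * x)\<^sup>2)) (at x within {0..1})"
        if x: "x \<in> {0..1}" for x
        unfolding lin_def[symmetric] \<theta>_def
        by (auto intro!: derivative_eq_intros deriv[OF w(1) x] deriv[OF w(2) x] simp: algebra_simps)
      show "2112 * (3 ^ l) ^ 8 * q0\<^sup>2 \<le> \<bar>h * (2 * pi * n * e)\<bar> * \<kappa>\<^sup>2 * \<tau> ^ 3"
      proof -
        have "52800 * 472392 ^ l * R ^ 14 * q0\<^sup>2 \<le> R * R ^ l * R ^ 14 * (X * R ^ 6)\<^sup>2"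
          using R V(4) q0 by (intro mult_mono power_mono) (auto simp: q0_def)
        also have "\<dots> = X\<^sup>2 * R ^ (27 + l)" by (simp add: power_mult_distrib power_add eval_nat_numeral)
        also have "\<dots> \<le> X\<^sup>2 * R ^ (896 * j)" using R l by (intro mult_left_mono power_increasing) (auto simp: l_def)
        also have "\<dots> \<le> n" by (rule n)
        also have "1 * real n \<le> \<bar>h * (2 * pi * n * e)\<bar>"
        proof -
          have "\<bar>h * (2 * pi * n * e)\<bar> = \<bar>h\<bar> * (2 * pi) * n" using e by (simp add: abs_mult)
          moreover have "1 * 1 \<le> \<bar>h\<bar> * (2 * pi)" using h pi_ge_two by (intro mult_mono) auto
          ultimately show ?thesis by (simp only:) (rule mult_right_mono, auto)
        qed
        finally have *: "52800 * 472392 ^ l * R ^ 14 * q0\<^sup>2 \<le> \<bar>h * (2 * pi * n * e)\<bar>" by simp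
        \<comment> \<open>The base \<open>472392\<close> collects \<open>X ^ 8\<close>, \<open>\<kappa>\<^sup>2\<close> and \<open>\<tau> ^ 3\<close> of \<open>mobius_phase_integral\<close>.\<close>
        have 9: "(472392::real) ^ l = (3 ^ l) ^ 8 * (3 ^ l)\<^sup>2 * (2 ^ l) ^ 3"
        proof -
          have "(472392::real) ^ l = (3 ^ 8 * 3\<^sup>2 * 2 ^ 3) ^ l" by simp
          thus ?thesis by (simp only: power_mult_distrib power_mult[symmetric] mult.commute)
        qed
        have "\<kappa>\<^sup>2 * \<tau> ^ 3 = 1 / (R ^ 14 * 25 * (3 ^ l)\<^sup>2 * (2 ^ l) ^ 3)"
          by (simp add: \<kappa>_def \<tau>_def power_divide power_mult_distrib flip: power_mult)
        hence "\<bar>h * (2 * pi * n * e)\<bar> * \<kappa>\<^sup>2 * \<tau> ^ 3 = \<bar>h * (2 * pi * n * e)\<bar> / (R ^ 14 * 25 * (3 ^ l)\<^sup>2 * (2 ^ l) ^ 3)"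
          by (simp only: mult.assoc) simp
        also have "2112 * (3 ^ l) ^ 8 * q0\<^sup>2 \<le> \<dots>"
          using * R0 unfolding 9 by (simp add: le_divide_eq mult_ac)
        finally show ?thesis .
      qed
    qed
  qed
  moreover have "256 * \<tau> / \<eta> ^ 8 < 1 / 4 ^ j"
  proof -
    have "256 * \<tau> / \<eta> ^ 8 = 256 / 2 ^ (24 * j)"
    proof -
      have "(2::real) ^ l = 2 ^ (24 * j) * 2 ^ (8 * j)" by (simp add: l_def flip: power_add)
      moreover have "\<eta> ^ 8 = 1 / 2 ^ (8 * j)" by (simp add: \<eta>_def power_divide mult.commute flip: power_mult)
      ultimately show ?thesis by (simp add: \<tau>_def)
    qed
    moreover have "256 * (4::real) ^ j < 2 ^ (24 * j)"
    proof -
      have "256 * (4::real) ^ j = 2 ^ (8 + 2 * j)" by (simp add: power_add power_mult)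
      also have "\<dots> < 2 ^ (24 * j)" using lam by (intro power_strict_increasing) auto
      finally show ?thesis .
    qed
    hence "256 / 2 ^ (24 * j) < 1 / (4::real) ^ j" by (simp add: field_simps)
    ultimately show ?thesis by simp
  qed
  moreover have "1 / 4 ^ j \<le> measure lebesgue S"
  proof -
    have "R\<^sup>2 \<ge> 1048576\<^sup>2" using R by (intro power_mono) auto
    hence R2: "2880 \<le> R\<^sup>2" by simp
    have "1 / 2 \<le> 1 + real 480 * (- (3 / R\<^sup>2))" using R2 R0 by (simp add: field_simps divide_le_eq)
    also have "\<dots> \<le> (1 + (- (3 / R\<^sup>2))) ^ 480" by (rule Bernoulli_inequality) (use R2 R0 in \<open>simp add: field_simps\<close>)
    finally have "(1 / 2) ^ j \<le> ((1 - 3 / R\<^sup>2) ^ 480) ^ j" by (intro power_mono) auto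
    hence "(1 / 2) ^ j \<le> (1 - 3 / R\<^sup>2) ^ (480 * j)" by (simp add: power_mult)
    moreover have "(1 / 2) ^ j \<le> 1 / R\<^sup>2" using lam R0 by (simp add: power_one_over field_simps)
    moreover have "0 \<le> (1 - 3 / R\<^sup>2) ^ (480 * j)"
      using R2 R0 by (intro zero_le_power) (simp add: divide_le_eq)
    ultimately have "(1 / 2) ^ j * (1 / 2) ^ j \<le> (1 - 3 / R\<^sup>2) ^ (480 * j) * (1 / R\<^sup>2)" by (intro mult_mono) auto
    moreover have "(1 / 2) ^ j * (1 / 2) ^ j = 1 / (4::real) ^ j" by (simp add: power_one_over flip: power_mult_distrib)
    ultimately show ?thesis using S(3) by simp
  qed
  ultimately show False by linarith
qed

text \<open>
  The word has length \<open>l = 32 * j\<close>, the cells of \<open>x\<close> have level \<open>L = 480 * j\<close>.  With \<open>n\<close> in the given window a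
  whole cell is mapped into a neighbourhood of the target of radius \<open>2 / 2 ^ j\<close>.  The image of a cell contains an
  interval of length \<open>1 / Y\<^sup>2\<close> with \<open>Y\<close> depending on the word, and free steps lead from \<open>Y\<close> to the common final
  scale \<open>X * R ^ (736 * j)\<close>.
\<close>

lemma forced_hom_step:
  fixes R X u \<delta> :: real and j n N :: nat
  assumes R: "R = 8 * real N" "1048576 \<le> R" and X: "X \<ge> 1" and j: "j \<ge> 3" "R\<^sup>2 \<le> 2 ^ j"
    and n: "X\<^sup>2 * R ^ (896 * j) \<le> real n" "real n \<le> X\<^sup>2 * R ^ (896 * j + 2)"
    and good: "\<And>\<beta>. \<beta> \<in> {u .. u + 1 / X\<^sup>2} \<Longrightarrow> badly_approx (1 / R ^ 7) 0 (1 / (4 * R\<^sup>2) * X) \<beta> 0"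
  shows "\<exists>u'. {u' .. u' + 1 / (X * R ^ (736 * j))\<^sup>2} \<subseteq> {u .. u + 1 / X\<^sup>2} \<and>
    (\<forall>\<beta>\<in>{u' .. u' + 1 / (X * R ^ (736 * j))\<^sup>2}.
       badly_approx (1 / R ^ 7) 0 (1 / (4 * R\<^sup>2) * (X * R ^ (736 * j))) \<beta> 0 \<and>
       (\<exists>p::int. \<bar>n * \<beta> - \<delta> - p\<bar> \<le> 2 / 2 ^ j))"
proof -
  define l L where lL: "l = 32 * j" "L = 480 * j"
  define a where "a = 1 / (4 * R\<^sup>2)"
  define cF where "cF = 1 / (32 * R ^ 6)"
  define cs where "cs = 1 / R ^ 7"
  have R0: "R > 0" "R \<ge> 1" using R by auto
  have N: "N \<ge> 1" using R by (cases N) auto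
  have X0: "X > 0" using X by simp
  have a: "0 < a" "a * R \<le> 1 / 2" unfolding a_def by (rule block_constants[OF R(2)])+
  have cF: "cF \<le> a\<^sup>2 / (2 * R\<^sup>2)" unfolding a_def cF_def by (rule block_constants[OF R(2)])
  have cs: "0 < cs" "cs \<le> cF" "cs \<le> 1 / (16 * R ^ 4)" "cs \<le> 1 / 12"
  proof -
    have "32 * R ^ 6 \<le> R * R ^ 6" using R(2) by (intro mult_right_mono) auto
    also have "\<dots> = R ^ 7" by (simp flip: power_Suc)
    finally have 1: "32 * R ^ 6 \<le> R ^ 7" .
    show "cs \<le> cF" unfolding cs_def cF_def by (rule block_constants[OF R(2)])
    have "R ^ 4 \<le> R ^ 6" using R0 by (intro power_increasing) auto
    moreover have "1 \<le> R ^ 4" using R0 by (intro one_le_power) auto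
    ultimately have 2: "16 * R ^ 4 \<le> R ^ 7" "12 \<le> R ^ 7" using 1 by linarith+
    show "cs \<le> 1 / (16 * R ^ 4)" "cs \<le> 1 / 12" unfolding cs_def using R0 2 by (auto intro!: divide_left_mono)
    show "0 < cs" using R0 by (simp add: cs_def)
  qed
  obtain v V where V: "\<bar>det2 v V\<bar> = 1" "1 \<le> snd V" "snd V \<le> fst V" "X * R ^ 5 \<le> of_int (fst V)" "of_int (fst V) \<le> X * R ^ 6"
    "of_int (fst V) \<le> R ^ 7 * of_int (snd V)"
    and Vin: "\<And>y. y \<in> {0..1} \<Longrightarrow> lin v y / lin V y \<in> {u .. u + 1 / X\<^sup>2}"
    and Vgood: "\<And>y q p. y \<in> {1/3..1} \<Longrightarrow> 1 \<le> q \<Longrightarrow> q < fst V + snd V \<Longrightarrow>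
        1 / R ^ 7 \<le> of_int q * \<bar>of_int q * (lin v y / lin V y) - of_int p\<bar>"
    using farey_prefix[OF R X good] by blast
  define s where "s = 1 / (R ^ (L + 1))\<^sup>2"
  have s0: "s > 0" using R0 by (simp add: s_def)
  obtain S where S: "S \<in> lmeasurable" "S \<subseteq> {0..1}" "(1 - 3 / R\<^sup>2) ^ L / R\<^sup>2 \<le> measure lebesgue S"
    and cell: "\<And>x. x\<in>S \<Longrightarrow> \<exists>z. x \<in> {z .. z + s} \<and> {z .. z + s} \<subseteq> {1/3 .. 1} \<and>
       (\<forall>y\<in>{z .. z + s}. badly_approx (1 / (8 * R ^ 4)) 0 (1 / (2 * R) * R ^ (L + 1)) y 0)"
    using good_cells_measure[OF R(1) N, of L] unfolding s_def by blast
  obtain w x p where w: "w \<in> words l" and x: "x \<in> S"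
    and hit: "\<bar>n * (lin (cf_word w v) x / lin (cf_word w V) x) - \<delta> - of_int p\<bar> < 1 / 2 ^ j"
    using cf_family_hits_target[OF R X j n(1) V(1,2,3,5,6) S[unfolded lL], of \<delta>] unfolding lL by blast
  obtain z where z: "x \<in> {z .. z + s}" "{z .. z + s} \<subseteq> {1/3 .. 1}"
    "\<And>y. y \<in> {z .. z + s} \<Longrightarrow> badly_approx (1 / (8 * R ^ 4)) 0 (1 / (2 * R) * R ^ (L + 1)) y 0"
    using cell[OF x] by blast
  define A B where "A = fst (cf_word w V)" and "B = snd (cf_word w V)"
  have ws: "set w \<subseteq> {1, 2}" "length w = l" using w by (auto simp: words_def)
  have AB: "1 \<le> B" "B \<le> A" "fst V \<le> A" "A \<le> 3 ^ l * fst V"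
    using cf_word_bounds[OF ws(1) V(2,3)] V(2) ws(2) by (auto simp: A_def B_def)
  define D where "D y = lin (cf_word w V) y" for y
  define \<beta> where "\<beta> y = lin (cf_word w v) y / D y" for y
  have Z01: "y \<in> {1/3..1}" if "y \<in> {z .. z + s}" for y using z(2) that by blast
  have Dle: "of_int A \<le> D y" "D y \<le> 2 * of_int A" if "y \<in> {1/3..1}" for y
  proof -
    have "0 \<le> of_int B * y" using AB that by auto
    thus "of_int A \<le> D y" by (simp add: D_def lin_def A_def B_def)
    have "of_int B * y \<le> real_of_int A * 1" using AB that by (intro mult_mono) auto
    thus "D y \<le> 2 * of_int A" by (simp add: D_def lin_def A_def B_def)
  qed
  have A0: "0 < real_of_int A" "1 \<le> A" using AB V by auto
  have det: "\<bar>det2 (cf_word w v) (cf_word w V)\<bar> = 1" using V(1) by (simp add: det2_cf_word abs_mult power_abs)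
  have diff: "\<bar>\<beta> y - \<beta> y'\<bar> = \<bar>y - y'\<bar> / (D y * D y')" if "y \<in> {1/3..1}" "y' \<in> {1/3..1}" for y y'
  proof -
    have D0: "D y > 0" "D y' > 0" using Dle[OF that(1)] Dle[OF that(2)] A0 by auto
    have "\<beta> y - \<beta> y' = (lin (cf_word w v) y * D y' - lin (cf_word w v) y' * D y) / (D y * D y')"
      using D0 by (simp add: \<beta>_def diff_frac_eq)
    also have "lin (cf_word w v) y * D y' - lin (cf_word w v) y' * D y =
       of_int (det2 (cf_word w v) (cf_word w V)) * (y - y')"
      by (simp add: D_def lin_def det2_def algebra_simps)
    also have "\<bar>of_int (det2 (cf_word w v) (cf_word w V)) * (y - y') / (D y * D y')\<bar> = \<bar>y - y'\<bar> / (D y * D y')"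
      using det D0 by (simp add: abs_mult flip: of_int_abs)
    finally show ?thesis .
  qed
  have contb: "continuous_on {z .. z + s} \<beta>"
    unfolding \<beta>_def D_def lin_def
  proof (intro continuous_intros ballI)
    fix y assume "y \<in> {z .. z + s}"
    hence "D y > 0" using Dle(1)[OF Z01] A0 by fastforce
    thus "of_int (fst (cf_word w V)) + of_int (snd (cf_word w V)) * y \<noteq> 0" by (simp add: D_def lin_def)
  qed
  have ends: "z \<in> {z .. z + s}" "z + s \<in> {z .. z + s}" using s0 by auto
  \<comment> \<open>The Moebius map may be decreasing.\<close>
  define b0 where "b0 = min (\<beta> z) (\<beta> (z + s))"
  have image: "\<exists>y\<in>{z .. z + s}. \<beta> y = c" if c: "c \<in> {b0 .. b0 + s / (4 * (of_int A)\<^sup>2)}" for c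
  proof -
    have "D (z + s) * D z \<le> (2 * of_int A) * (2 * of_int A)"
      using Dle[OF Z01[OF ends(1)]] Dle[OF Z01[OF ends(2)]] A0 by (intro mult_mono) auto
    hence "s / (4 * (of_int A)\<^sup>2) \<le> s / (D (z + s) * D z)"
      using s0 Dle(1)[OF Z01[OF ends(1)]] Dle(1)[OF Z01[OF ends(2)]] A0
      by (intro divide_left_mono) (auto simp: power2_eq_square intro!: mult_pos_pos)
    also have "\<dots> = \<bar>\<beta> (z + s) - \<beta> z\<bar>" using diff[OF Z01[OF ends(2)] Z01[OF ends(1)]] s0 by simp
    finally have len: "s / (4 * (of_int A)\<^sup>2) \<le> \<bar>\<beta> (z + s) - \<beta> z\<bar>" .
    show ?thesis
    proof (cases "\<beta> z \<le> \<beta> (z + s)")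
      case True
      hence "\<beta> z \<le> c" "c \<le> \<beta> (z + s)" using c len by (auto simp: b0_def)
      from IVT'[OF this _ contb] s0 show ?thesis by auto
    next
      case False
      hence "\<beta> (z + s) \<le> c" "c \<le> \<beta> z" using c len by (auto simp: b0_def)
      from IVT2'[OF this _ contb] s0 show ?thesis by auto
    qed
  qed
  have Abig: "X * R ^ 5 \<le> of_int A" using V(4) AB(3) by linarith
  have Aup: "of_int A \<le> 3 ^ l * (X * R ^ 6)"
  proof -
    have "real_of_int A \<le> of_int (3 ^ l * fst V)" using AB(4) by (simp only: of_int_le_iff)
    also have "\<dots> \<le> 3 ^ l * (X * R ^ 6)" using V(5) by simp
    finally show ?thesis .
  qed
  define good_k where "good_k k \<longleftrightarrow> 2 * of_int A * R ^ (L + 1) \<le> X * R ^ k" for k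
  have gk: "good_k (736 * j)"
  proof -
    have "2 * of_int A * R ^ (L + 1) \<le> 2 * (3 ^ l * (X * R ^ 6)) * R ^ (L + 1)"
      using Aup R0 by (intro mult_right_mono) auto
    also have "\<dots> = X * (2 * 3 ^ l * R ^ (7 + L))" by (simp add: power_add eval_nat_numeral)
    also have "\<dots> \<le> X * (R * R ^ l * R ^ (7 + L))" using R X0
      by (intro mult_left_mono mult_right_mono mult_mono power_mono) auto
    also have "\<dots> = X * R ^ (8 + l + L)" by (simp add: power_add eval_nat_numeral)
    also have "\<dots> \<le> X * R ^ (736 * j)" using X0 R0 j by (intro mult_left_mono power_increasing) (auto simp: lL)
    finally show ?thesis by (simp add: good_k_def)
  qed
  \<comment> \<open>The least \<open>k\<close> gives the longest interval inside the image of the cell, hence the weakest demand on denominators.\<close>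
  define k where "k = (LEAST k. good_k k)"
  have k: "good_k k" "k \<le> 736 * j" using gk unfolding k_def by (auto intro: LeastI Least_le)
  define Y where "Y = X * R ^ k"
  have Y0: "Y > 0" using X0 R0 by (simp add: Y_def)
  have Ylow: "2 * of_int A * R ^ (L + 1) \<le> Y" using k by (simp add: good_k_def Y_def)
  have Yup: "Y \<le> 2 * of_int A * R ^ (L + 1) * R"
  proof (cases k)
    case 0
    have "X * 1 \<le> X * R ^ 5" using X0 R0 by (intro mult_left_mono one_le_power) auto
    hence XA: "X \<le> 2 * of_int A" using Abig A0 by linarith
    have r1: "1 \<le> R ^ (L + 1)" using R0(2) by (rule one_le_power)
    have "X * 1 \<le> 2 * of_int A * R ^ (L + 1)" by (rule mult_mono[OF XA r1]) (use A0 in auto)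
    hence "X \<le> 2 * of_int A * R ^ (L + 1) * 1" by simp
    also have "2 * of_int A * R ^ (L + 1) * 1 \<le> 2 * of_int A * R ^ (L + 1) * R"
      using R0 A0 by (intro mult_left_mono) auto
    finally show ?thesis using 0 by (simp add: Y_def)
  next
    case (Suc k')
    have "\<not> good_k k'" using not_less_Least[of k' good_k] Suc unfolding k_def by auto
    hence "X * R ^ k' * R \<le> 2 * of_int A * R ^ (L + 1) * R" unfolding good_k_def using R0 by (intro mult_right_mono) auto
    thus ?thesis using Suc by (simp add: Y_def mult_ac)
  qed
  have Ylen: "1 / Y\<^sup>2 \<le> s / (4 * (of_int A)\<^sup>2)"
  proof -
    have "(2 * of_int A * R ^ (L + 1))\<^sup>2 \<le> Y\<^sup>2" using Ylow A0 R0 by (intro power_mono) auto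
    hence "1 / Y\<^sup>2 \<le> 1 / (2 * of_int A * R ^ (L + 1))\<^sup>2" using A0 R0 Y0 by (intro divide_left_mono) auto
    also have "\<dots> = s / (4 * (of_int A)\<^sup>2)" by (simp add: s_def power_mult_distrib)
    finally show ?thesis .
  qed
  have pts: "c \<in> {u .. u + 1 / X\<^sup>2} \<and> badly_approx cs 0 (a * Y) c 0 \<and> \<bar>n * c - \<delta> - p\<bar> \<le> 2 / 2 ^ j"
    if c: "c \<in> {b0 .. b0 + 1 / Y\<^sup>2}" for c :: real
  proof -
    obtain y where y: "y \<in> {z .. z + s}" "\<beta> y = c" using image[of c] c Ylen by auto
    have y1: "y \<in> {1/3..1}" by (rule Z01[OF y(1)])
    have y01: "0 < y" "y \<le> 1" using y1 by auto
    define y' where "y' = cf_value w y"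
    have y': "y' \<in> {1/3..1}" unfolding y'_def by (rule cf_value_range[OF ws(1) y1])
    have cy: "c = lin v y' / lin V y'" using cf_word_value[OF ws(1) y1, of v V] y by (simp add: \<beta>_def D_def y'_def)
    have cw: "c = lin (cf_word w v) y / lin (cf_word w V) y" using y by (simp add: \<beta>_def D_def)
    have 1: "c \<in> {u .. u + 1 / X\<^sup>2}" unfolding cy by (rule Vin) (use y' in auto)
    have 2: "badly_approx cs 0 (a * Y) c 0"
      unfolding badly_approx_def
    proof (intro allI impI)
      fix q p :: int assume q: "1 \<le> q" "0 < real_of_int q" "real_of_int q \<le> a * Y"
      \<comment> \<open>Small denominators are handled by the Farey interval, middle ones by the word, and large ones by the cell of \<open>x\<close>.\<close>
      consider "q < fst V + snd V" | "fst V + snd V \<le> q" "q < A" | "A \<le> q" by linarith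
      thus "cs \<le> of_int q * \<bar>of_int q * c - of_int p - 0\<bar>"
      proof cases
        case 1
        thus ?thesis using Vgood[OF y' q(1) 1, of p] by (simp add: cy cs_def)
      next
        case 2
        have "1 / 12 \<le> real_of_int q * \<bar>real_of_int q * c - real_of_int p\<bar>" unfolding cw
          by (rule badly_approx_word[OF V(1,2,3) ws(1) y1]) (use 2 V AB in \<open>auto simp: A_def B_def\<close>)
        thus ?thesis using cs by simp
      next
        case 3
        have "a * Y \<le> of_int A * (1 / (2 * R) * R ^ (L + 1))"
        proof -
          have "a * Y \<le> a * (2 * of_int A * R ^ (L + 1) * R)" using Yup a by (intro mult_left_mono) auto
          also have "\<dots> = of_int A * (1 / (2 * R) * R ^ (L + 1))" using R0 by (simp add: a_def field_simps power2_eq_square)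
          finally show ?thesis .
        qed
        moreover have "1 / (8 * R ^ 4) \<le> 1"
        proof -
          have "1 \<le> R ^ 4" by (rule one_le_power[OF R0(2)])
          hence "1 \<le> 8 * R ^ 4" by linarith
          hence "1 / (8 * R ^ 4) \<le> 1 / 1" by (intro divide_left_mono) auto
          thus ?thesis by simp
        qed
        ultimately have "1 / (8 * R ^ 4) / 2 \<le> real_of_int q * \<bar>real_of_int q * c - real_of_int p\<bar>" unfolding cw
          by (intro badly_approx_transfer[OF det _ _ y01 _ _ z(3)[OF y(1)]])
            (use AB 3 q R0 in \<open>auto simp: A_def B_def\<close>)
        thus ?thesis using cs by simp
      qed
    qed
    have 3: "\<bar>n * c - \<delta> - p\<bar> \<le> 2 / 2 ^ j"
    proof -
      have x1: "x \<in> {1/3..1}" by (rule Z01[OF z(1)])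
      have "\<bar>\<beta> y - \<beta> x\<bar> = \<bar>y - x\<bar> / (D y * D x)" by (rule diff[OF y1 x1])
      also have "\<dots> \<le> s / (of_int A * of_int A)"
        using z(1) y(1) Dle(1)[OF y1] Dle(1)[OF x1] A0 s0 by (intro frac_le mult_mono) auto
      also have "\<dots> \<le> s / ((X * R ^ 5) * (X * R ^ 5))"
        using Abig s0 A0 X0 R0 by (intro divide_left_mono mult_mono) auto
      finally have "n * \<bar>\<beta> y - \<beta> x\<bar> \<le> (X\<^sup>2 * R ^ (896 * j + 2)) * (s / ((X * R ^ 5) * (X * R ^ 5)))"
        using n(2) by (intro mult_mono) auto
      also have "\<dots> = R ^ (896 * j + 2) / (R ^ (2 * (L + 1)) * R ^ 10)"
        using X0 by (simp add: s_def power_mult_distrib power2_eq_square flip: power_mult power_add)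
      also have "\<dots> = R ^ (896 * j + 2) / (R ^ (896 * j + 2) * R ^ (64 * j + 10))"
        by (simp add: lL flip: power_add)
      also have "\<dots> = 1 / R ^ (64 * j + 10)" using R0 by simp
      also have "\<dots> \<le> 1 / 2 ^ j"
      proof (rule divide_left_mono)
        have "(2::real) ^ j \<le> R ^ j" using R by (intro power_mono) auto
        also have "\<dots> \<le> R ^ (64 * j + 10)" using R0 by (intro power_increasing) auto
        finally show "2 ^ j \<le> R ^ (64 * j + 10)" .
      qed (use R0 in auto)
      finally have "\<bar>n * (\<beta> y - \<beta> x)\<bar> \<le> 1 / 2 ^ j" by (simp add: abs_mult)
      moreover have "n * c - \<delta> - p = (n * \<beta> x - \<delta> - p) + n * (\<beta> y - \<beta> x)" using y(2) by (simp add: algebra_simps)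
      moreover have "\<bar>n * \<beta> x - \<delta> - p\<bar> < 1 / 2 ^ j" using hit by (simp add: \<beta>_def D_def)
      ultimately have "\<bar>n * c - \<delta> - p\<bar> \<le> 1 / 2 ^ j + 1 / 2 ^ j" by linarith
      thus ?thesis by simp
    qed
    show ?thesis using 1 2 3 by blast
  qed
  obtain u' where u': "{u' .. u' + 1 / (Y * R ^ (736 * j - k))\<^sup>2} \<subseteq> {b0 .. b0 + 1 / Y\<^sup>2}"
    "\<And>c. c \<in> {u' .. u' + 1 / (Y * R ^ (736 * j - k))\<^sup>2} \<Longrightarrow> badly_approx cF (a * Y) (a * (Y * R ^ (736 * j - k))) c 0"
    using hom_descend[where u = b0 and k = "736 * j - k", OF R(1) N Y0 a cF] by blast
  have YR: "Y * R ^ (736 * j - k) = X * R ^ (736 * j)"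
    using k(2) by (simp add: Y_def mult.assoc flip: power_add)
  show ?thesis
  proof (intro exI[of _ u'] conjI ballI)
    show "{u' .. u' + 1 / (X * R ^ (736 * j))\<^sup>2} \<subseteq> {u .. u + 1 / X\<^sup>2}" using u'(1) pts unfolding YR by blast
    fix c assume c: "c \<in> {u' .. u' + 1 / (X * R ^ (736 * j))\<^sup>2}"
    hence cb: "c \<in> {b0 .. b0 + 1 / Y\<^sup>2}" using u'(1) unfolding YR by blast
    show "badly_approx (1 / R ^ 7) 0 (1 / (4 * R\<^sup>2) * (X * R ^ (736 * j))) c 0"
      unfolding cs_def[symmetric] a_def[symmetric]
    proof (rule badly_approx_trans)
      show "badly_approx cs 0 (a * Y) c 0" using pts[OF cb] by blast
      show "badly_approx cs (a * Y) (a * (X * R ^ (736 * j))) c 0"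
        by (rule badly_approx_mono[OF u'(2)]) (use c cs YR in auto)
    qed
    show "\<exists>p::int. \<bar>n * c - \<delta> - p\<bar> \<le> 2 / 2 ^ j" using pts[OF cb] by blast
  qed
qed


section \<open>Coding of separated trees of boxes\<close>

definition digit :: "nat \<Rightarrow> nat \<Rightarrow> real \<Rightarrow> nat" where
  "digit b k x = nat (\<lfloor>real b ^ Suc k * x\<rfloor> mod int b)"

lemma digit_less: "b \<ge> 1 \<Longrightarrow> digit b k x < b"
  by (simp add: digit_def nat_less_iff)

lemma digits_agree:
  assumes b: "b \<ge> 1" and xy: "x \<in> {0..<1}" "y \<in> {0..<1}" and agree: "\<And>i. i < k \<Longrightarrow> digit b i x = digit b i y"
  shows "\<bar>x - y\<bar> \<le> 1 / real b ^ k"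
proof -
  have "\<lfloor>real b ^ k * x\<rfloor> = \<lfloor>real b ^ k * y\<rfloor>" using agree
  proof (induction k)
    case 0
    have "\<lfloor>x\<rfloor> = 0" "\<lfloor>y\<rfloor> = 0" using xy by (simp_all add: floor_eq_iff)
    thus ?case by simp
  next
    case (Suc k)
    have e: "\<lfloor>real b ^ Suc k * z\<rfloor> div int b = \<lfloor>real b ^ k * z\<rfloor>" for z
    proof -
      have "\<lfloor>real b ^ Suc k * z / real_of_int (int b)\<rfloor> = \<lfloor>real b ^ Suc k * z\<rfloor> div int b"
        by (rule floor_divide_real_eq_div) simp
      moreover have "real b ^ Suc k * z / real_of_int (int b) = real b ^ k * z" using b by simp
      ultimately show ?thesis by simp
    qed
    have "digit b k x = digit b k y" using Suc.prems by simp
    moreover have "0 \<le> z mod int b" for z using b by simp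
    ultimately have "\<lfloor>real b ^ Suc k * x\<rfloor> mod int b = \<lfloor>real b ^ Suc k * y\<rfloor> mod int b"
      unfolding digit_def by (metis eq_nat_nat_iff)
    moreover have "\<lfloor>real b ^ Suc k * x\<rfloor> div int b = \<lfloor>real b ^ Suc k * y\<rfloor> div int b" unfolding e using Suc by simp
    ultimately show ?case by (metis div_mult_mod_eq)
  qed
  hence "\<bar>real b ^ k * x - real b ^ k * y\<bar> \<le> 1" by linarith
  hence "real b ^ k * \<bar>x - y\<bar> \<le> 1" by (simp add: abs_mult flip: right_diff_distrib)
  thus ?thesis using b by (simp add: field_simps)
qed

lemma digits_separate:
  assumes b: "b \<ge> 2" and xy: "x \<in> {0..<1}" "y \<in> {0..<1}" "x \<noteq> y"
  shows "\<exists>k. digit b k x \<noteq> digit b k y"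
proof (rule ccontr)
  assume "\<not> ?thesis"
  hence le: "\<bar>x - y\<bar> \<le> 1 / real b ^ k" for k using digits_agree[of b x y k] b xy by auto
  have "(\<lambda>k. (1 / real b) ^ k) \<longlonglongrightarrow> 0" using b by (intro LIMSEQ_power_zero) auto
  hence "eventually (\<lambda>k. (1 / real b) ^ k < \<bar>x - y\<bar>) sequentially" using xy by (intro order_tendstoD) auto
  then obtain k where "(1 / real b) ^ k < \<bar>x - y\<bar>" using eventually_happens by fastforce
  thus False using le[of k] by (simp add: power_one_over)
qed

lemma nested_intervals:
  fixes a b :: "nat \<Rightarrow> real"
  assumes nest: "\<And>k. {a (Suc k) .. b (Suc k)} \<subseteq> {a k .. b k}" and ne: "\<And>k. a k \<le> b k"
  shows "(SUP k. a k) \<in> {a k .. b k}"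
proof -
  have "a k \<le> a (Suc k)" "b (Suc k) \<le> b k" for k using nest[of k] ne[of "Suc k"] by auto
  hence mono: "incseq a" "decseq b" by (auto intro: incseq_SucI decseq_SucI)
  have le: "a i \<le> b k" for i k
  proof -
    have "a i \<le> a (max i k)" "b (max i k) \<le> b k" using mono by (auto simp: incseq_def decseq_def)
    thus ?thesis using ne[of "max i k"] by linarith
  qed
  have "bdd_above (range a)" using le by (auto intro!: bdd_aboveI)
  thus ?thesis using le by (auto intro: cSUP_upper cSUP_least)
qed

text \<open>
  The branch of the tree with code \<open>(\<xi>, \<eta>)\<close> takes at step \<open>k\<close> the child given by the \<open>k\<close>-th digits of \<open>\<xi>\<close>
  and \<open>\<eta>\<close> in the bases \<open>N\<^sup>2\<close> and \<open>N\<close>.  If the digits first differ at step \<open>k\<close>, then the codes differ by at most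
  \<open>N ^ (- 2 * k)\<close> or \<open>N ^ (- k)\<close>, whereas the points are separated by the gap between two children of one
  box; \<open>growth\<close> compares the two.  For equal \<open>\<xi>\<close> the boxes can separate only in the second coordinate, which is
  what makes the larger gap \<open>1 / (X k * R)\<close> available there.
\<close>

lemma separated_tree_coding:
  fixes X :: "nat \<Rightarrow> real" and valid :: "nat \<Rightarrow> real \<times> real \<Rightarrow> bool" and R \<sigma> C :: real and N :: nat
    and F :: "nat \<Rightarrow> real \<times> real \<Rightarrow> nat \<Rightarrow> nat \<Rightarrow> real \<times> real"
  defines "I \<equiv> \<lambda>k (s :: real \<times> real). {fst s .. fst s + 1 / (X k)\<^sup>2}" and "J \<equiv> \<lambda>k (s :: real \<times> real). {snd s .. snd s + 1 / X k}"
  assumes N: "N \<ge> 2" and X: "\<And>k. X k > 0" and R: "R \<ge> 1" and X1: "\<And>k. X k * R \<ge> 1" and \<sigma>: "\<sigma> > 0"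
    and start: "valid 0 s0"
    and step: "\<And>k s i j. valid k s \<Longrightarrow> i < N\<^sup>2 \<Longrightarrow> j < N \<Longrightarrow>
        valid (Suc k) (F k s i j) \<and> I (Suc k) (F k s i j) \<subseteq> I k s \<and> J (Suc k) (F k s i j) \<subseteq> J k s"
    and sep1: "\<And>k s i i' j j' x x'. valid k s \<Longrightarrow> i < N\<^sup>2 \<Longrightarrow> i' < N\<^sup>2 \<Longrightarrow> j < N \<Longrightarrow> j' < N \<Longrightarrow> i \<noteq> i' \<Longrightarrow>
        x \<in> I (Suc k) (F k s i j) \<Longrightarrow> x' \<in> I (Suc k) (F k s i' j') \<Longrightarrow> 1 / (X k * R)\<^sup>2 \<le> \<bar>x - x'\<bar>"
    and sep2: "\<And>k s i j j' y y'. valid k s \<Longrightarrow> i < N\<^sup>2 \<Longrightarrow> j < N \<Longrightarrow> j' < N \<Longrightarrow> j \<noteq> j' \<Longrightarrow>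
        y \<in> J (Suc k) (F k s i j) \<Longrightarrow> y' \<in> J (Suc k) (F k s i j') \<Longrightarrow> 1 / (X k * R) \<le> \<bar>y - y'\<bar>"
    and growth: "\<And>k. (X k * R) powr \<sigma> \<le> C * real N ^ k" and C: "C \<ge> 1"
  obtains g :: "real \<Rightarrow> real \<Rightarrow> real \<times> real" where
    "\<And>\<xi> \<xi>' \<eta> \<eta>'. {\<xi>, \<xi>', \<eta>, \<eta>'} \<subseteq> {0..<1} \<Longrightarrow> \<bar>\<xi> - \<xi>'\<bar> \<le> C\<^sup>2 * dist (g \<xi> \<eta>) (g \<xi>' \<eta>') powr \<sigma>"
    "\<And>\<xi> \<eta> \<eta>'. {\<xi>, \<eta>, \<eta>'} \<subseteq> {0..<1} \<Longrightarrow> \<bar>\<eta> - \<eta>'\<bar> \<le> C\<^sup>2 * dist (g \<xi> \<eta>) (g \<xi> \<eta>') powr \<sigma>"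
    "\<And>\<xi> \<eta> k. {\<xi>, \<eta>} \<subseteq> {0..<1} \<Longrightarrow> \<exists>s. valid k s \<and> fst (g \<xi> \<eta>) \<in> I k s \<and> snd (g \<xi> \<eta>) \<in> J k s"
proof -
  define st where "st \<xi> \<eta> = rec_nat s0 (\<lambda>k s. F k s (digit (N\<^sup>2) k \<xi>) (digit N k \<eta>))" for \<xi> \<eta>
  have st0: "st \<xi> \<eta> 0 = s0" and stS: "st \<xi> \<eta> (Suc k) = F k (st \<xi> \<eta> k) (digit (N\<^sup>2) k \<xi>) (digit N k \<eta>)" for \<xi> \<eta> k
    by (simp_all add: st_def)
  have N2: "N\<^sup>2 \<ge> 1" "N\<^sup>2 \<ge> 2"
  proof -
    have "2 * 1 \<le> N * N" using N by (intro mult_le_mono) auto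
    thus "N\<^sup>2 \<ge> 1" "N\<^sup>2 \<ge> 2" unfolding power2_eq_square by linarith+
  qed
  have dig: "digit (N\<^sup>2) k x < N\<^sup>2" "digit N k x < N" for k x using N N2 by (auto intro!: digit_less)
  have val: "valid k (st \<xi> \<eta> k)" for k \<xi> \<eta>
    by (induction k) (use start step dig in \<open>auto simp: st0 stS\<close>)
  define g where "g \<xi> \<eta> = ((SUP k. fst (st \<xi> \<eta> k)), (SUP k. snd (st \<xi> \<eta> k)))" for \<xi> \<eta>
  have nestI: "I (Suc k) (st \<xi> \<eta> (Suc k)) \<subseteq> I k (st \<xi> \<eta> k)" and nestJ: "J (Suc k) (st \<xi> \<eta> (Suc k)) \<subseteq> J k (st \<xi> \<eta> k)" for k \<xi> \<eta>
    using step[OF val dig] by (auto simp: stS)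
  have inI: "fst (g \<xi> \<eta>) \<in> I k (st \<xi> \<eta> k)" for \<xi> \<eta> k
    unfolding g_def fst_conv I_def
    by (rule nested_intervals) (use nestI in \<open>simp_all add: I_def less_imp_le[OF X]\<close>)
  have inJ: "snd (g \<xi> \<eta>) \<in> J k (st \<xi> \<eta> k)" for \<xi> \<eta> k
    unfolding g_def snd_conv J_def
    by (rule nested_intervals) (use nestJ in \<open>simp_all add: J_def less_imp_le[OF X]\<close>)
  have st_cong: "st \<xi> \<eta> k = st \<xi>' \<eta>' k"
    if "\<And>i. i < k \<Longrightarrow> digit (N\<^sup>2) i \<xi> = digit (N\<^sup>2) i \<xi>'" "\<And>i. i < k \<Longrightarrow> digit N i \<eta> = digit N i \<eta>'" for \<xi> \<xi>' \<eta> \<eta>' k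
    using that by (induction k) (auto simp: st0 stS)
  have XR: "X k * R > 0" for k using X R by (simp add: less_le_trans)
  \<comment> \<open>A distance at least \<open>1 / (X k R)\<close> pays for a difference of \<open>N\<close>-adic size \<open>N ^ (- k)\<close>.\<close>
  have pay: "1 / real N ^ k \<le> C * d powr \<sigma>" if d: "1 / (X k * R) \<le> d" for k d
  proof -
    have "p \<le> C * n \<Longrightarrow> 0 < p \<Longrightarrow> 0 < n \<Longrightarrow> 1 / n \<le> C / p" for p n :: real by (simp add: field_simps)
    from this[OF growth[of k]] have "1 / real N ^ k \<le> C / (X k * R) powr \<sigma>"
      using N XR[of k] X[of k] R by force
    also have "\<dots> = C * (1 / (X k * R)) powr \<sigma>" using XR[of k] by (simp add: powr_divide)
    also have "\<dots> \<le> C * d powr \<sigma>" using d XR[of k] \<sigma> C by (intro mult_left_mono powr_mono2) auto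
    finally show ?thesis .
  qed
  have pay2: "1 / real (N\<^sup>2) ^ k \<le> C\<^sup>2 * d powr \<sigma>" if d: "1 / (X k * R)\<^sup>2 \<le> d" for k d
  proof -
    have d0: "d > 0" using d XR[of k] by (meson less_le_trans zero_less_divide_1_iff zero_less_power)
    have "sqrt ((1 / (X k * R))\<^sup>2) \<le> sqrt d" using d by (intro real_sqrt_le_mono) (simp add: power_divide)
    hence "1 / (X k * R) \<le> sqrt d" using XR[of k] by simp
    hence "1 / real N ^ k \<le> C * sqrt d powr \<sigma>" by (rule pay)
    hence "(1 / real N ^ k)\<^sup>2 \<le> (C * sqrt d powr \<sigma>)\<^sup>2" using N by (intro power_mono) auto
    also have "\<dots> = C\<^sup>2 * d powr \<sigma>" using d0 by (simp add: power_mult_distrib power2_eq_square flip: powr_mult)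
    finally show ?thesis by (simp add: power_divide mult.commute flip: power_mult)
  qed
  show ?thesis
  proof (rule that[of g])
    fix \<xi> \<eta> \<eta>' :: real assume h: "{\<xi>, \<eta>, \<eta>'} \<subseteq> {0..<1}"
    show "\<bar>\<eta> - \<eta>'\<bar> \<le> C\<^sup>2 * dist (g \<xi> \<eta>) (g \<xi> \<eta>') powr \<sigma>"
    proof (cases "\<eta> = \<eta>'")
      case False
      define k where "k = (LEAST k. digit N k \<eta> \<noteq> digit N k \<eta>')"
      have k: "digit N k \<eta> \<noteq> digit N k \<eta>'" unfolding k_def by (rule LeastI_ex[OF digits_separate]) (use False h N in auto)
      have before: "digit N i \<eta> = digit N i \<eta>'" if "i < k" for i using that not_less_Least unfolding k_def by blast
      have same: "st \<xi> \<eta>' k = st \<xi> \<eta> k" by (rule st_cong) (use before in auto)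
      have "\<bar>\<eta> - \<eta>'\<bar> \<le> 1 / real N ^ k" by (rule digits_agree) (use N h before in auto)
      moreover have "1 / (X k * R) \<le> \<bar>snd (g \<xi> \<eta>) - snd (g \<xi> \<eta>')\<bar>"
        by (rule sep2[OF val dig(1) dig(2) dig(2) k]) (use inJ[of \<xi> \<eta> "Suc k"] inJ[of \<xi> \<eta>' "Suc k"] in \<open>simp_all add: stS same\<close>)
      hence "1 / (X k * R) \<le> dist (g \<xi> \<eta>) (g \<xi> \<eta>')"
        using dist_snd_le[of "g \<xi> \<eta>" "g \<xi> \<eta>'"] by (simp add: dist_real_def)
      hence "1 / real N ^ k \<le> C * dist (g \<xi> \<eta>) (g \<xi> \<eta>') powr \<sigma>" by (rule pay)
      moreover have "C * dist (g \<xi> \<eta>) (g \<xi> \<eta>') powr \<sigma> \<le> C\<^sup>2 * dist (g \<xi> \<eta>) (g \<xi> \<eta>') powr \<sigma>"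
        using C by (intro mult_right_mono) (auto simp: power2_eq_square)
      ultimately show ?thesis by linarith
    qed simp
  next
    fix \<xi> \<xi>' \<eta> \<eta>' :: real assume h: "{\<xi>, \<xi>', \<eta>, \<eta>'} \<subseteq> {0..<1}"
    show "\<bar>\<xi> - \<xi>'\<bar> \<le> C\<^sup>2 * dist (g \<xi> \<eta>) (g \<xi>' \<eta>') powr \<sigma>"
    proof (cases "\<xi> = \<xi>'")
      case False
      define Q where "Q k \<longleftrightarrow> digit (N\<^sup>2) k \<xi> \<noteq> digit (N\<^sup>2) k \<xi>' \<or> digit N k \<eta> \<noteq> digit N k \<eta>'" for k
      define k where "k = (LEAST k. Q k)"
      have "\<exists>k. Q k" using digits_separate[of "N\<^sup>2" \<xi> \<xi>'] False h N2 by (auto simp: Q_def)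
      hence k: "Q k" unfolding k_def by (rule LeastI_ex)
      have before: "digit (N\<^sup>2) i \<xi> = digit (N\<^sup>2) i \<xi>'" "digit N i \<eta> = digit N i \<eta>'" if "i < k" for i
        using that not_less_Least[of i Q] unfolding k_def Q_def by blast+
      have same: "st \<xi>' \<eta>' k = st \<xi> \<eta> k" by (rule st_cong) (use before in auto)
      have "\<bar>\<xi> - \<xi>'\<bar> \<le> 1 / real (N\<^sup>2) ^ k" by (rule digits_agree) (use N2 h before in auto)
      moreover have "1 / (X k * R)\<^sup>2 \<le> dist (g \<xi> \<eta>) (g \<xi>' \<eta>')"
      proof (cases "digit (N\<^sup>2) k \<xi> = digit (N\<^sup>2) k \<xi>'")
        case False
        have "1 / (X k * R)\<^sup>2 \<le> \<bar>fst (g \<xi> \<eta>) - fst (g \<xi>' \<eta>')\<bar>"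
          by (rule sep1[OF val dig(1) dig(1) dig(2) dig(2) False])
            (use inI[of \<xi> \<eta> "Suc k"] inI[of \<xi>' \<eta>' "Suc k"] in \<open>simp_all add: stS same\<close>)
        thus ?thesis using dist_fst_le[of "g \<xi> \<eta>" "g \<xi>' \<eta>'"] by (simp add: dist_real_def)
      next
        case True
        hence ne: "digit N k \<eta> \<noteq> digit N k \<eta>'" using k by (auto simp: Q_def)
        have "1 / (X k * R) \<le> \<bar>snd (g \<xi> \<eta>) - snd (g \<xi>' \<eta>')\<bar>"
          by (rule sep2[OF val dig(1) dig(2) dig(2) ne])
            (use inJ[of \<xi> \<eta> "Suc k"] inJ[of \<xi>' \<eta>' "Suc k"] True in \<open>simp_all add: stS same\<close>)
        moreover have "1 / (X k * R)\<^sup>2 \<le> 1 / (X k * R)"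
        proof (rule divide_left_mono)
          have "X k * R * 1 \<le> X k * R * (X k * R)" using X1[of k] XR[of k] by (intro mult_left_mono) auto
          thus "X k * R \<le> (X k * R)\<^sup>2" by (simp add: power2_eq_square)
        qed (simp, rule mult_pos_pos[OF zero_less_power[OF XR] XR])
        ultimately show ?thesis using dist_snd_le[of "g \<xi> \<eta>" "g \<xi>' \<eta>'"] by (simp add: dist_real_def)
      qed
      hence "1 / real (N\<^sup>2) ^ k \<le> C\<^sup>2 * dist (g \<xi> \<eta>) (g \<xi>' \<eta>') powr \<sigma>" by (rule pay2)
      ultimately show ?thesis by linarith
    qed simp
  next
    fix \<xi> \<eta> :: real and k assume "{\<xi>, \<eta>} \<subseteq> {0..<1}"
    show "\<exists>s. valid k s \<and> fst (g \<xi> \<eta>) \<in> I k s \<and> snd (g \<xi> \<eta>) \<in> J k s"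
      using val inI inJ by blast
  qed
qed


section \<open>Free and forced steps in the tree\<close>

lemma inhom_child:
  fixes a b c c1 R X v :: real and N i :: nat
  assumes R: "R = 8 * real N" and X: "X \<ge> 3" and b: "b = c / (4 * R)" "b \<le> a" "c > 0" "c \<le> 1" and c1: "c1 \<le> b / (4 * R)"
    and I: "\<And>\<beta> \<beta>'. \<beta> \<in> I \<Longrightarrow> \<beta>' \<in> I \<Longrightarrow> \<bar>\<beta> - \<beta>'\<bar> \<le> 1 / (X * R)\<^sup>2"
    and hom: "\<And>\<beta>. \<beta> \<in> I \<Longrightarrow> badly_approx c 0 (a * (X * R)) \<beta> 0"
    and i: "8 * i + 4 < 8 * N"
  defines "P \<equiv> \<lambda>d. \<forall>\<delta>\<in>{v + real d / (X * R) .. v + (real d + 1) / (X * R)}. \<forall>\<beta>\<in>I. badly_approx c1 (b * X) (b * (X * R)) \<beta> \<delta>"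
  shows "P (pick P i)"
proof (rule pick_works[OF _ i])
  fix d d' assume d: "d < 8 * N" "d' < 8 * N" "\<not> P d" "\<not> P d'"
  have N: "N \<ge> 1" using d(1) by (cases N) auto
  have e: "real e + 1 \<le> R" if "e < 8 * N" for e
  proof -
    have "real (e + 1) \<le> real (8 * N)" using that by (subst of_nat_le_iff) simp
    thus ?thesis by (simp add: R)
  qed
  show "\<bar>real d - real d'\<bar> \<le> 2"
    by (rule inhom_step_window[of R X b c a c1 I d d' v])
      (use N R X b c1 I hom e[OF d(1)] e[OF d(2)] d(3,4) in \<open>auto simp: P_def\<close>)
qed

text \<open>
  The set \<open>I\<close> stays fixed: it is so small already that all steps for \<open>\<delta>\<close> up to scale \<open>X * R ^ K\<close> can be made for
  all \<open>\<beta> \<in> I\<close> simultaneously.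
\<close>

lemma inhom_descend:
  fixes a b c c1 R X v :: real and N K :: nat
  assumes R: "R = 8 * real N" "N \<ge> 1" and X: "X \<ge> 3" and b: "b = c / (4 * R)" "b \<le> a" "c > 0" "c \<le> 1" and c1: "c1 \<le> b / (4 * R)"
    and I: "\<And>\<beta> \<beta>'. \<beta> \<in> I \<Longrightarrow> \<beta>' \<in> I \<Longrightarrow> \<bar>\<beta> - \<beta>'\<bar> \<le> 1 / (X * R ^ K)\<^sup>2"
    and hom: "\<And>\<beta>. \<beta> \<in> I \<Longrightarrow> badly_approx c 0 (a * (X * R ^ K)) \<beta> 0"
  shows "k \<le> K \<Longrightarrow> \<exists>v'. {v' .. v' + 1 / (X * R ^ k)} \<subseteq> {v .. v + 1 / X} \<and>
     (\<forall>\<delta>\<in>{v' .. v' + 1 / (X * R ^ k)}. \<forall>\<beta>\<in>I. badly_approx c1 (b * X) (b * (X * R ^ k)) \<beta> \<delta>)"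
proof (induction k)
  case 0
  show ?case by (intro exI[of _ v]) (auto simp: badly_approx_def)
next
  case (Suc k)
  have "k \<le> K" using Suc.prems by simp
  from Suc.IH[OF this] obtain v' where v': "{v' .. v' + 1 / (X * R ^ k)} \<subseteq> {v .. v + 1 / X}"
    "\<And>\<delta> \<beta>. \<delta>\<in>{v' .. v' + 1 / (X * R ^ k)} \<Longrightarrow> \<beta> \<in> I \<Longrightarrow> badly_approx c1 (b * X) (b * (X * R ^ k)) \<beta> \<delta>"
    by blast
  have R1: "R \<ge> 8" using R by simp
  define Y where "Y = X * R ^ k"
  have YX: "X \<le> Y" using X R1 mult_left_mono[of 1 "R ^ k" X] one_le_power[of R k] by (simp add: Y_def)
  have Y: "Y \<ge> 3" "Y > 0" using X YX by auto
  have YR: "Y * R = X * R ^ Suc k" by (simp add: Y_def mult_ac)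
  have YK: "Y * R \<le> X * R ^ K" unfolding YR using Suc.prems X R1 by (intro mult_left_mono power_increasing) auto
  have YR0: "Y * R > 0" using Y R1 by simp
  define P where "P d \<longleftrightarrow> (\<forall>\<delta>\<in>{v' + real d / (Y * R) .. v' + (real d + 1) / (Y * R)}. \<forall>\<beta>\<in>I. badly_approx c1 (b * Y) (b * (Y * R)) \<beta> \<delta>)" for d
  have a0: "a > 0" using b R1 by (auto intro: less_le_trans[rotated])
  have P: "P (pick P 0)" unfolding P_def
  proof (rule inhom_child[OF R(1) Y(1) b c1])
    show "\<bar>\<beta> - \<beta>'\<bar> \<le> 1 / (Y * R)\<^sup>2" if "\<beta> \<in> I" "\<beta>' \<in> I" for \<beta> \<beta>'
    proof -
      have "(Y * R)\<^sup>2 \<le> (X * R ^ K)\<^sup>2" using YK YR0 by (intro power_mono) auto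
      moreover have "X * R ^ K > 0" using YR0 YK by linarith
      ultimately have "1 / (X * R ^ K)\<^sup>2 \<le> 1 / (Y * R)\<^sup>2"
        by (intro divide_left_mono mult_pos_pos zero_less_power) (use X R1 Y in auto)
      thus ?thesis using I[OF that] by linarith
    qed
    show "badly_approx c 0 (a * (Y * R)) \<beta> 0" if "\<beta> \<in> I" for \<beta>
      by (rule badly_approx_mono[OF hom[OF that]]) (use YK a0 in auto)
    show "8 * 0 + 4 < 8 * N" using R by simp
  qed
  define d where "d = pick P 0"
  have "d \<le> 4" using pick_range(2)[of P 0] by (simp add: d_def)
  hence "real d + 1 \<le> R" using R1 by simp
  hence "(real d + 1) / (Y * R) \<le> R / (Y * R)" using YR0 by (intro divide_right_mono) auto
  hence top: "(real d + 1) / (Y * R) \<le> 1 / Y" using R1 by simp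
  have "real d / (Y * R) \<ge> 0" using YR0 by simp
  hence sub: "{v' + real d / (Y * R) .. v' + (real d + 1) / (Y * R)} \<subseteq> {v' .. v' + 1 / Y}" using top by auto
  have eq: "{v' + real d / (Y * R) .. v' + (real d + 1) / (Y * R)} = {v' + real d / (Y * R) .. v' + real d / (Y * R) + 1 / (X * R ^ Suc k)}"
    unfolding YR[symmetric] by (simp add: add_divide_distrib)
  show ?case
  proof (intro exI[of _ "v' + real d / (Y * R)"] conjI ballI)
    show "{v' + real d / (Y * R) .. v' + real d / (Y * R) + 1 / (X * R ^ Suc k)} \<subseteq> {v .. v + 1 / X}"
      unfolding eq[symmetric] using sub v'(1) unfolding Y_def by (rule order_trans)
    fix \<delta> \<beta> assume \<delta>: "\<delta> \<in> {v' + real d / (Y * R) .. v' + real d / (Y * R) + 1 / (X * R ^ Suc k)}" and \<beta>: "\<beta> \<in> I"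
    have \<delta>': "\<delta> \<in> {v' + real d / (Y * R) .. v' + (real d + 1) / (Y * R)}" using \<delta> unfolding eq .
    have "badly_approx c1 (b * X) (b * Y) \<beta> \<delta>" using v'(2)[OF _ \<beta>] sub \<delta>' unfolding Y_def by blast
    moreover have "badly_approx c1 (b * Y) (b * (Y * R)) \<beta> \<delta>" using P \<delta>' \<beta> unfolding P_def d_def[symmetric] by blast
    ultimately show "badly_approx c1 (b * X) (b * (X * R ^ Suc k)) \<beta> \<delta>"
      unfolding YR[symmetric] by (rule badly_approx_trans)
  qed
qed

definition box_I :: "real \<Rightarrow> real \<times> real \<Rightarrow> real set" where
  "box_I X s = {fst s .. fst s + 1 / X\<^sup>2}"

definition box_J :: "real \<Rightarrow> real \<times> real \<Rightarrow> real set" where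
  "box_J X s = {snd s .. snd s + 1 / X}"

text \<open>
  The inhomogeneous constants are \<open>b = c / (4 * R)\<close> and \<open>b / (4 * R)\<close>, as \<open>inhom_step_window\<close> requires for
  the homogeneous constant \<open>c = 1 / R ^ 7\<close>.
\<close>

definition good_box :: "real \<Rightarrow> real \<Rightarrow> real \<times> real \<Rightarrow> bool" where
  "good_box R X s \<longleftrightarrow>
     (\<forall>\<beta>\<in>box_I X s. badly_approx (1 / R ^ 7) 0 (1 / (4 * R\<^sup>2) * X) \<beta> 0 \<and>
        (\<forall>\<delta>\<in>box_J X s. badly_approx (1 / (16 * R ^ 9)) 0 (1 / (4 * R ^ 8) * X) \<beta> \<delta>))"

text \<open>
  The child interval for \<open>\<beta>\<close> is chosen first, by \<open>i\<close> alone, and the one for \<open>\<delta>\<close> afterwards, uniformly in \<open>\<beta>\<close>.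
\<close>

lemma free_step:
  fixes R :: real and N :: nat
  assumes R: "R = 8 * real N" "1048576 \<le> R" and X: "X \<ge> 3" and s: "good_box R X s"
  obtains F :: "nat \<Rightarrow> nat \<Rightarrow> real \<times> real" where
    "\<And>i j. i < N\<^sup>2 \<Longrightarrow> j < N \<Longrightarrow> good_box R (X * R) (F i j) \<and> box_I (X * R) (F i j) \<subseteq> box_I X s \<and> box_J (X * R) (F i j) \<subseteq> box_J X s"
    "\<And>i i' j j' x x'. i \<noteq> i' \<Longrightarrow> x \<in> box_I (X * R) (F i j) \<Longrightarrow> x' \<in> box_I (X * R) (F i' j') \<Longrightarrow> 1 / (X * R)\<^sup>2 \<le> \<bar>x - x'\<bar>"
    "\<And>i j j' y y'. j \<noteq> j' \<Longrightarrow> y \<in> box_J (X * R) (F i j) \<Longrightarrow> y' \<in> box_J (X * R) (F i j') \<Longrightarrow> 1 / (X * R) \<le> \<bar>y - y'\<bar>"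
proof -
  define a where "a = 1 / (4 * R\<^sup>2)"
  define cs where "cs = 1 / R ^ 7"
  define cF where "cF = 1 / (32 * R ^ 6)"
  define b where "b = 1 / (4 * R ^ 8)"
  define c1 where "c1 = 1 / (16 * R ^ 9)"
  have R0: "R > 0" "R \<ge> 1" using R by auto
  have X0: "X > 0" using X by simp
  have XR: "X * R > 0" using X0 R0 by simp
  have a: "0 < a" "a * R \<le> 1 / 2" unfolding a_def by (rule block_constants[OF R(2)])+
  have cF: "cF \<le> a\<^sup>2 / (2 * R\<^sup>2)" unfolding a_def cF_def by (rule block_constants[OF R(2)])
  have cs: "cs > 0" "cs \<le> 1" using R0 by (auto simp: cs_def one_le_power divide_le_eq_1)
  have csF: "cs \<le> cF" unfolding cs_def cF_def by (rule block_constants[OF R(2)])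
  have b: "b = cs / (4 * R)" using R0 by (simp add: b_def cs_def eval_nat_numeral)
  have ba: "b \<le> a" unfolding b_def a_def using R0 power_increasing[of 2 8 R] by (intro divide_left_mono) auto
  have c1: "c1 \<le> b / (4 * R)" using R0 by (simp add: b_def c1_def eval_nat_numeral)
  define PU where "PU d \<longleftrightarrow> (\<forall>\<beta>\<in>{fst s + real d / (X * R)\<^sup>2 .. fst s + (real d + 1) / (X * R)\<^sup>2}. badly_approx cF (a * X) (a * (X * R)) \<beta> 0)" for d
  define U where "U i = fst s + real (pick PU i) / (X * R)\<^sup>2" for i
  define IU where "IU i = {U i .. U i + 1 / (X * R)\<^sup>2}" for i
  define PV where "PV i d \<longleftrightarrow> (\<forall>\<delta>\<in>{snd s + real d / (X * R) .. snd s + (real d + 1) / (X * R)}. \<forall>\<beta>\<in>IU i. badly_approx c1 (b * X) (b * (X * R)) \<beta> \<delta>)" for i d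
  define V where "V i j = snd s + real (pick (PV i) j) / (X * R)" for i j
  define F where "F i j = (U i, V i j)" for i j
  have FI: "box_I (X * R) (F i j) = IU i" for i j by (simp add: box_I_def F_def IU_def)
  have FJ: "box_J (X * R) (F i j) = {V i j .. V i j + 1 / (X * R)}" for i j by (simp add: box_J_def F_def)
  have sepgen: "\<epsilon> \<le> \<bar>x - x'\<bar>" if "4 \<le> \<bar>real p - real p'\<bar>" "x \<in> {w + real p * \<epsilon> .. w + real p * \<epsilon> + \<epsilon>}" "x' \<in> {w + real p' * \<epsilon> .. w + real p' * \<epsilon> + \<epsilon>}" "\<epsilon> > 0"
    for p p' :: nat and x x' w \<epsilon> :: real
  proof -
    have "4 * \<epsilon> \<le> \<bar>real p - real p'\<bar> * \<epsilon>" using that by (intro mult_right_mono) auto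
    also have "\<dots> = \<bar>real p * \<epsilon> - real p' * \<epsilon>\<bar>" using that(4) by (simp add: abs_mult flip: left_diff_distrib)
    finally show ?thesis using that(2,3) unfolding atLeastAtMost_iff by linarith
  qed
  show ?thesis
  proof (rule that[of F])
    fix i j assume ij: "i < N\<^sup>2" "j < N"
    have pU: "PU (pick PU i)" unfolding PU_def by (rule hom_child[OF R(1) X0 a cF]) (use ij in linarith)
    have subI: "IU i \<subseteq> box_I X s"
    proof -
      have "pick PU i \<le> 8 * i + 4" by (rule pick_range)
      hence "pick PU i + 1 \<le> 64 * N\<^sup>2" using ij by linarith
      hence "real (pick PU i + 1) \<le> real (64 * N\<^sup>2)" by (simp only: of_nat_le_iff)
      hence "real (pick PU i) + 1 \<le> R\<^sup>2" by (simp add: R power_mult_distrib)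
      from cell_subset[OF X0 R0(1) _ this, of "fst s"] show ?thesis
        by (simp add: IU_def U_def box_I_def add_divide_distrib add.assoc)
    qed
    have homU: "badly_approx cs 0 (a * (X * R)) \<beta> 0" if "\<beta> \<in> IU i" for \<beta>
    proof (rule badly_approx_trans)
      show "badly_approx cs 0 (a * X) \<beta> 0" using s subI that by (auto simp: good_box_def cs_def a_def)
      have "badly_approx cF (a * X) (a * (X * R)) \<beta> 0"
        using pU that by (auto simp: PU_def IU_def U_def add_divide_distrib)
      thus "badly_approx cs (a * X) (a * (X * R)) \<beta> 0" by (rule badly_approx_mono) (use csF in auto)
    qed
    have pV: "PV i (pick (PV i) j)" unfolding PV_def
      by (rule inhom_child[OF R(1) X b ba cs c1]) (use homU ij in \<open>auto simp: IU_def abs_le_iff\<close>)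
    have subJ: "box_J (X * R) (F i j) \<subseteq> box_J X s"
    proof -
      have "pick (PV i) j \<le> 8 * j + 4" by (rule pick_range)
      hence "pick (PV i) j + 1 \<le> 8 * N" using ij by linarith
      hence "real (pick (PV i) j + 1) \<le> real (8 * N)" by (simp only: of_nat_le_iff)
      hence "(real (pick (PV i) j) + 1) / (X * R) \<le> R / (X * R)" using XR by (intro divide_right_mono) (auto simp: R)
      also have "\<dots> = 1 / X" using R0 by simp
      finally have "real (pick (PV i) j) / (X * R) + 1 / (X * R) \<le> 1 / X" by (simp add: add_divide_distrib)
      moreover have "0 \<le> real (pick (PV i) j) / (X * R)" using XR by simp
      ultimately show ?thesis unfolding FJ unfolding box_J_def V_def by auto
    qed
    have "good_box R (X * R) (F i j)"
      unfolding good_box_def FI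
    proof (intro ballI conjI)
      fix \<beta> assume \<beta>: "\<beta> \<in> IU i"
      show "badly_approx (1 / R ^ 7) 0 (1 / (4 * R\<^sup>2) * (X * R)) \<beta> 0" using homU[OF \<beta>] by (simp add: cs_def a_def)
      fix \<delta> assume \<delta>: "\<delta> \<in> box_J (X * R) (F i j)"
      have "badly_approx c1 0 (b * (X * R)) \<beta> \<delta>"
      proof (rule badly_approx_trans)
        show "badly_approx c1 0 (b * X) \<beta> \<delta>" using s subI subJ \<beta> \<delta> unfolding good_box_def c1_def b_def by blast
        show "badly_approx c1 (b * X) (b * (X * R)) \<beta> \<delta>"
          using pV \<beta> \<delta> by (auto simp: PV_def FJ V_def add_divide_distrib add.assoc)
      qed
      thus "badly_approx (1 / (16 * R ^ 9)) 0 (1 / (4 * R ^ 8) * (X * R)) \<beta> \<delta>" by (simp add: c1_def b_def)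
    qed
    thus "good_box R (X * R) (F i j) \<and> box_I (X * R) (F i j) \<subseteq> box_I X s \<and> box_J (X * R) (F i j) \<subseteq> box_J X s"
      using subI subJ FI by simp
  next
    fix i i' j j' :: nat and x x' assume h: "i \<noteq> i'" "x \<in> box_I (X * R) (F i j)" "x' \<in> box_I (X * R) (F i' j')"
    show "1 / (X * R)\<^sup>2 \<le> \<bar>x - x'\<bar>"
      by (rule sepgen[OF pick_separated[OF h(1), of PU], where w = "fst s"]) (use h XR in \<open>auto simp: FI IU_def U_def\<close>)
  next
    fix i j j' :: nat and y y' assume h: "j \<noteq> j'" "y \<in> box_J (X * R) (F i j)" "y' \<in> box_J (X * R) (F i j')"
    show "1 / (X * R) \<le> \<bar>y - y'\<bar>"
      by (rule sepgen[OF pick_separated[OF h(1), of "PV i"], where w = "snd s"]) (use h XR in \<open>auto simp: FJ V_def\<close>)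
  qed
qed

text \<open>
  The target for \<open>n * \<beta>\<close> is the left end of the interval for \<open>\<delta>\<close>, which has length at most \<open>1 / 2 ^ j\<close>; hence \<open>\<delta>\<close> can
  be refined after \<open>\<beta>\<close> without missing it.
\<close>

lemma forced_step:
  fixes R X :: real and j n N :: nat
  assumes R: "R = 8 * real N" "1048576 \<le> R" and X: "X \<ge> 3" and j: "j \<ge> 3" "R\<^sup>2 \<le> 2 ^ j" "2 ^ j \<le> X"
    and n: "X\<^sup>2 * R ^ (896 * j) \<le> real n" "real n \<le> X\<^sup>2 * R ^ (896 * j + 2)"
    and s: "good_box R X s"
  shows "\<exists>s'. good_box R (X * R ^ (736 * j)) s' \<and> box_I (X * R ^ (736 * j)) s' \<subseteq> box_I X s \<and> box_J (X * R ^ (736 * j)) s' \<subseteq> box_J X s \<and>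
    (\<forall>\<beta>\<in>box_I (X * R ^ (736 * j)) s'. \<forall>\<delta>\<in>box_J (X * R ^ (736 * j)) s'. \<exists>p::int. \<bar>real n * \<beta> - \<delta> - real_of_int p\<bar> \<le> 3 / 2 ^ j)"
proof -
  define K where "K = 736 * j"
  define Y where "Y = X * R ^ K"
  define a where "a = 1 / (4 * R\<^sup>2)"
  define cs where "cs = 1 / R ^ 7"
  define b where "b = 1 / (4 * R ^ 8)"
  define c1 where "c1 = 1 / (16 * R ^ 9)"
  have R0: "R > 0" "R \<ge> 1" using R by auto
  have N: "N \<ge> 1" using R by (cases N) auto
  have X0: "X > 0" "X \<ge> 1" using X by auto
  have Y0: "Y > 0" using X0 R0 by (simp add: Y_def)
  have cs: "cs > 0" "cs \<le> 1" using R0 by (auto simp: cs_def one_le_power divide_le_eq_1)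
  have b: "b = cs / (4 * R)" using R0 by (simp add: b_def cs_def eval_nat_numeral)
  have ba: "b \<le> a" unfolding b_def a_def using R0 power_increasing[of 2 8 R] by (intro divide_left_mono) auto
  have c1: "c1 \<le> b / (4 * R)" using R0 by (simp add: b_def c1_def eval_nat_numeral)
  have good: "badly_approx (1 / R ^ 7) 0 (1 / (4 * R\<^sup>2) * X) \<beta> 0" if "\<beta> \<in> {fst s .. fst s + 1 / X\<^sup>2}" for \<beta>
    using s that by (simp add: good_box_def box_I_def)
  obtain u' where u': "{u' .. u' + 1 / Y\<^sup>2} \<subseteq> {fst s .. fst s + 1 / X\<^sup>2}"
    "\<And>\<beta>. \<beta>\<in>{u' .. u' + 1 / Y\<^sup>2} \<Longrightarrow> badly_approx cs 0 (a * Y) \<beta> 0"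
    "\<And>\<beta>. \<beta>\<in>{u' .. u' + 1 / Y\<^sup>2} \<Longrightarrow> \<exists>p::int. \<bar>real n * \<beta> - snd s - real_of_int p\<bar> \<le> 2 / 2 ^ j"
    using forced_hom_step[where u = "fst s" and \<delta> = "snd s", OF R X0(2) j(1,2) n good]
    unfolding K_def[symmetric] Y_def[symmetric] cs_def[symmetric] a_def[symmetric] by blast
  have "\<exists>v'. {v' .. v' + 1 / (X * R ^ K)} \<subseteq> {snd s .. snd s + 1 / X} \<and>
     (\<forall>\<delta>\<in>{v' .. v' + 1 / (X * R ^ K)}. \<forall>\<beta>\<in>{u' .. u' + 1 / Y\<^sup>2}. badly_approx c1 (b * X) (b * (X * R ^ K)) \<beta> \<delta>)"
  proof (rule inhom_descend[OF R(1) N X b ba cs c1])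
    fix \<beta> \<beta>' assume "\<beta> \<in> {u' .. u' + 1 / Y\<^sup>2}" "\<beta>' \<in> {u' .. u' + 1 / Y\<^sup>2}"
    thus "\<bar>\<beta> - \<beta>'\<bar> \<le> 1 / (X * R ^ K)\<^sup>2" unfolding Y_def by (auto simp: abs_le_iff)
  next
    fix \<beta> assume "\<beta> \<in> {u' .. u' + 1 / Y\<^sup>2}"
    thus "badly_approx cs 0 (a * (X * R ^ K)) \<beta> 0" using u'(2) unfolding Y_def by blast
  qed simp
  then obtain v' where v': "{v' .. v' + 1 / Y} \<subseteq> {snd s .. snd s + 1 / X}"
    "\<And>\<delta> \<beta>. \<delta>\<in>{v' .. v' + 1 / Y} \<Longrightarrow> \<beta> \<in> {u' .. u' + 1 / Y\<^sup>2} \<Longrightarrow> badly_approx c1 (b * X) (b * Y) \<beta> \<delta>"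
    unfolding Y_def by blast
  show ?thesis unfolding K_def[symmetric] Y_def[symmetric]
  proof (intro exI[of _ "(u', v')"] conjI ballI)
    show I: "box_I Y (u', v') \<subseteq> box_I X s" using u'(1) by (simp add: box_I_def)
    show J: "box_J Y (u', v') \<subseteq> box_J X s" using v'(1) by (simp add: box_J_def)
    show "good_box R Y (u', v')"
      unfolding good_box_def
    proof (intro ballI conjI)
      fix \<beta> assume \<beta>: "\<beta> \<in> box_I Y (u', v')"
      show "badly_approx (1 / R ^ 7) 0 (1 / (4 * R\<^sup>2) * Y) \<beta> 0" using u'(2) \<beta> by (simp add: cs_def a_def box_I_def)
      fix \<delta> assume \<delta>: "\<delta> \<in> box_J Y (u', v')"
      have "badly_approx c1 0 (b * Y) \<beta> \<delta>"
      proof (rule badly_approx_trans)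
        show "badly_approx c1 0 (b * X) \<beta> \<delta>" using s I J \<beta> \<delta> unfolding good_box_def c1_def b_def by blast
        show "badly_approx c1 (b * X) (b * Y) \<beta> \<delta>" by (rule v'(2)) (use \<beta> \<delta> in \<open>auto simp: box_I_def box_J_def\<close>)
      qed
      thus "badly_approx (1 / (16 * R ^ 9)) 0 (1 / (4 * R ^ 8) * Y) \<beta> \<delta>" by (simp add: c1_def b_def)
    qed
    fix \<beta> \<delta> assume \<beta>: "\<beta> \<in> box_I Y (u', v')" and \<delta>: "\<delta> \<in> box_J Y (u', v')"
    obtain p :: int where p: "\<bar>real n * \<beta> - snd s - real_of_int p\<bar> \<le> 2 / 2 ^ j" using u'(3)[of \<beta>] \<beta> by (auto simp: box_I_def)
    have "\<delta> \<in> {snd s .. snd s + 1 / X}" using J \<delta> unfolding box_J_def by blast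
    hence "\<bar>\<delta> - snd s\<bar> \<le> 1 / X" by auto
    also have "\<dots> \<le> 1 / 2 ^ j" using j(3) X0 by (intro divide_left_mono) auto
    finally have "\<bar>real n * \<beta> - \<delta> - real_of_int p\<bar> \<le> 2 / 2 ^ j + 1 / 2 ^ j" using p by linarith
    thus "\<exists>p::int. \<bar>real n * \<beta> - \<delta> - real_of_int p\<bar> \<le> 3 / 2 ^ j" by auto
  qed
qed


section \<open>A sparse schedule of forced steps\<close>

lemma divergent_sum_not_below_inverse_squares:
  fixes \<psi> :: "nat \<Rightarrow> real"
  assumes nn: "\<And>t. t \<ge> 1 \<Longrightarrow> 0 \<le> \<psi> t" and div: "filterlim (\<lambda>N. \<Sum>t=1..N. \<psi> t) at_top sequentially"
  shows "infinite {t. t \<ge> 1 \<and> 1 / (real t)\<^sup>2 \<le> \<psi> t}"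
proof
  assume "finite {t. t \<ge> 1 \<and> 1 / (real t)\<^sup>2 \<le> \<psi> t}"
  then obtain B where B: "\<And>t. t \<ge> 1 \<Longrightarrow> 1 / (real t)\<^sup>2 \<le> \<psi> t \<Longrightarrow> t \<le> B"
    unfolding finite_nat_set_iff_bounded_le by auto
  have "summable (\<lambda>t. 1 / (real t)\<^sup>2)" using inverse_power_summable[of 2, where 'a = real] by (simp add: inverse_eq_divide)
  moreover have "eventually (\<lambda>t. norm (\<psi> t) \<le> 1 / (real t)\<^sup>2) sequentially"
    using eventually_gt_at_top[of "max B 1"]
  proof eventually_elim
    case (elim t)
    hence "\<not> 1 / (real t)\<^sup>2 \<le> \<psi> t" using B[of t] by auto
    thus ?case using nn[of t] elim by simp
  qed
  ultimately have "summable \<psi>" by (rule summable_comparison_test_ev[rotated])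
  hence "(\<lambda>N. \<Sum>t\<le>N. \<psi> t) \<longlonglongrightarrow> suminf \<psi>" by (rule summable_LIMSEQ')
  hence "(\<lambda>N. (\<Sum>t\<le>N. \<psi> t) - \<psi> 0) \<longlonglongrightarrow> suminf \<psi> - \<psi> 0" by (intro tendsto_intros)
  moreover have "(\<Sum>t\<le>N. \<psi> t) - \<psi> 0 = (\<Sum>t=1..N. \<psi> t)" for N
    by (simp add: sum.atMost_shift sum.atLeast1_atMost_eq lessThan_Suc_atMost) 
  ultimately have "(\<lambda>N. \<Sum>t=1..N. \<psi> t) \<longlonglongrightarrow> suminf \<psi> - \<psi> 0" by simp
  moreover have "filterlim (\<lambda>N. \<Sum>t=1..N. \<psi> t) at_infinity sequentially"
    using div by (rule filterlim_at_top_imp_at_infinity)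
  ultimately show False using not_tendsto_and_filterlim_at_infinity[OF sequentially_bot] by blast
qed

lemma lacunary_exponential:
  assumes "lacunary n" and pos: "\<And>t. t \<ge> 1 \<Longrightarrow> n t > 0"
  obtains c :: real where "c > 1" "\<And>t. c ^ t \<le> real (n (Suc t))"
proof -
  obtain c :: real where c: "c > 1" "\<And>t. t \<ge> 1 \<Longrightarrow> c * real (n t) \<le> real (n (t + 1))"
    using assms(1) unfolding lacunary_def by auto
  have "c ^ t \<le> real (n (Suc t))" for t
  proof (induction t)
    case 0
    show ?case using pos[of 1] by simp
  next
    case (Suc t)
    have "c ^ Suc t \<le> c * real (n (Suc t))" using Suc c by simp
    also have "\<dots> \<le> real (n (Suc (Suc t)))" using c(2)[of "Suc t"] by simp
    finally show ?case .
  qed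
  with c(1) show ?thesis by (rule that)
qed

text \<open>
  At level \<open>M\<close> a forced step with parameter \<open>j\<close> can realise the inequality for the index \<open>t\<close>.
\<close>

definition on_schedule :: "real \<Rightarrow> (nat \<Rightarrow> nat) \<Rightarrow> (nat \<Rightarrow> real) \<Rightarrow> nat \<Rightarrow> nat \<Rightarrow> nat \<Rightarrow> bool" where
  "on_schedule R n \<psi> M t j \<longleftrightarrow> t \<ge> 1 \<and> j \<ge> 3 \<and> R\<^sup>2 \<le> 2 ^ j \<and> 2 ^ j \<le> R ^ M \<and>
     (R ^ M)\<^sup>2 * R ^ (896 * j) \<le> real (n t) \<and> real (n t) \<le> (R ^ M)\<^sup>2 * R ^ (896 * j + 2) \<and> 3 / 2 ^ j \<le> \<psi> t"

lemma log_eventually_below_linear: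
  fixes A B D \<kappa> :: real
  assumes "\<kappa> > 0"
  shows "eventually (\<lambda>t::nat. A * (log 2 (3 * (real t)\<^sup>2) + B) + D \<le> \<kappa> * real t) sequentially"
proof -
  have l: "(\<lambda>t. ln (real t) / real t) \<longlonglongrightarrow> 0" by (rule lim_ln_over_n)
  have i: "(\<lambda>t. 1 / real t) \<longlonglongrightarrow> 0" by (rule lim_1_over_n)
  have "(\<lambda>t. (A * 2 / ln 2) * (ln (real t) / real t) + (A * ln 3 / ln 2 + A * B + D) * (1 / real t)) \<longlonglongrightarrow>
    (A * 2 / ln 2) * 0 + (A * ln 3 / ln 2 + A * B + D) * 0"
    by (intro tendsto_intros l i)
  hence "eventually (\<lambda>t. (A * 2 / ln 2) * (ln (real t) / real t) + (A * ln 3 / ln 2 + A * B + D) * (1 / real t) < \<kappa>) sequentially"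
    by (intro order_tendstoD) (use assms in auto)
  thus ?thesis using eventually_gt_at_top[of 0]
  proof eventually_elim
    case (elim t)
    have "log 2 (3 * (real t)\<^sup>2) = (ln 3 + 2 * ln (real t)) / ln 2"
      using elim(2) by (simp add: log_def ln_mult ln_realpow)
    hence "A * (log 2 (3 * (real t)\<^sup>2) + B) + D =
      ((A * 2 / ln 2) * (ln (real t) / real t) + (A * ln 3 / ln 2 + A * B + D) * (1 / real t)) * real t"
      using elim(2) by (simp add: field_simps)
    also have "\<dots> \<le> \<kappa> * real t" using elim by (intro mult_right_mono) auto
    finally show ?case .
  qed
qed

text \<open>
  An index \<open>t\<close> with \<open>\<psi> t \<ge> 1 / t\<^sup>2\<close> needs \<open>j\<close> of order \<open>ln t\<close>, whereas the level \<open>M\<close> at which \<open>n t\<close> falls into the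
  window is of order \<open>ln (n t)\<close>, hence at least of order \<open>t\<close>.
\<close>

lemma schedule_unbounded:
  fixes R \<epsilon> :: real and n :: "nat \<Rightarrow> nat" and \<psi> :: "nat \<Rightarrow> real"
  assumes R: "R \<ge> 8" and \<epsilon>: "\<epsilon> > 0" and pos: "\<And>t. t \<ge> 1 \<Longrightarrow> n t > 0" and lac: "lacunary n"
    and inf: "infinite {t. t \<ge> 1 \<and> 1 / (real t)\<^sup>2 \<le> \<psi> t}"
  shows "\<exists>M\<ge>M0. \<exists>t j. on_schedule R n \<psi> M t j \<and> 736 * real j \<le> \<epsilon> * real M"
proof -
  obtain c where c: "c > 1" "\<And>t. c ^ t \<le> real (n (Suc t))" using lacunary_exponential[OF lac pos] by blast
  obtain j1 :: nat where "R\<^sup>2 < 2 ^ j1" using real_arch_pow[of 2 "R\<^sup>2"] by auto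
  define j0 where "j0 = max j1 3"
  have j0: "R\<^sup>2 \<le> 2 ^ j0" "j0 \<ge> 3"
  proof -
    have "(2::real) ^ j1 \<le> 2 ^ j0" by (intro power_increasing) (auto simp: j0_def)
    thus "R\<^sup>2 \<le> 2 ^ j0" using \<open>R\<^sup>2 < 2 ^ j1\<close> by linarith
  qed (simp add: j0_def)
  define \<kappa> where "\<kappa> = log R c"
  have \<kappa>: "\<kappa> > 0" using R c by (simp add: \<kappa>_def)
  \<comment> \<open>\<open>A * j\<close> pays for the window \<open>896 * j\<close> and leaves \<open>M\<close> above both \<open>736 * j / \<epsilon>\<close> and \<open>j\<close>.\<close>
  define A where "A = 896 + 2 * (736 / \<epsilon> + 1)"
  have A: "A > 0" using \<epsilon> by (simp add: A_def add_pos_pos)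
  have ev: "eventually (\<lambda>t::nat. A * (log 2 (3 * (real t)\<^sup>2) + (1 + real j0)) + (2 + 2 * real M0 + \<kappa>) \<le> \<kappa> * real t) sequentially"
    by (rule log_eventually_below_linear[OF \<kappa>])
  then obtain t0 where t0: "\<And>t. t \<ge> t0 \<Longrightarrow> A * (log 2 (3 * (real t)\<^sup>2) + (1 + real j0)) + (2 + 2 * real M0 + \<kappa>) \<le> \<kappa> * real t"
    unfolding eventually_sequentially by blast
  obtain t where t: "t \<ge> 1" "t \<ge> t0" "1 / (real t)\<^sup>2 \<le> \<psi> t"
    using inf unfolding infinite_nat_iff_unbounded_le by blast
  define j where "j = nat \<lceil>log 2 (3 * (real t)\<^sup>2)\<rceil> + j0"
  have t3: "3 * (real t)\<^sup>2 \<ge> 1" using t(1) one_le_power[of "real t" 2] by linarith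
  have lg0: "0 \<le> log 2 (3 * (real t)\<^sup>2)" using t3 by (subst zero_le_log_cancel_iff) linarith+
  have jle: "real j \<le> log 2 (3 * (real t)\<^sup>2) + (1 + real j0)" using lg0 by (simp add: j_def)
  have jpow: "3 * (real t)\<^sup>2 \<le> 2 ^ j"
  proof -
    have "log 2 (3 * (real t)\<^sup>2) \<le> real (nat \<lceil>log 2 (3 * (real t)\<^sup>2)\<rceil>)" by (rule real_nat_ceiling_ge)
    also have "\<dots> \<le> real j" by (simp add: j_def)
    finally have "3 * (real t)\<^sup>2 \<le> 2 powr real j" using t(1) by (subst log_le_iff[symmetric]) auto
    thus ?thesis by (simp add: powr_realpow)
  qed
  have j3: "j \<ge> 3" "R\<^sup>2 \<le> 2 ^ j"
  proof -
    show "j \<ge> 3" using j0 by (simp add: j_def)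
    have "(2::real) ^ j0 \<le> 2 ^ j" by (intro power_increasing) (auto simp: j_def)
    thus "R\<^sup>2 \<le> 2 ^ j" using j0 by linarith
  qed
  have npos: "real (n t) > 0" using pos t by simp
  have logn: "\<kappa> * (real t - 1) \<le> log R (real (n t))"
  proof -
    have "c ^ (t - 1) \<le> real (n t)" using c(2)[of "t - 1"] t(1) by simp
    hence "log R (c ^ (t - 1)) \<le> log R (real (n t))" using R c npos by (subst log_le_cancel_iff) auto
    moreover have "log R (c ^ (t - 1)) = real (t - 1) * \<kappa>" using R c by (simp add: \<kappa>_def log_nat_power)
    ultimately show ?thesis using t(1) by (simp add: of_nat_diff mult.commute)
  qed
  define E where "E = nat \<lfloor>log R (real (n t))\<rfloor>"
  have big: "A * real j + 2 + 2 * real M0 \<le> log R (real (n t))"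
  proof -
    have "A * real j \<le> A * (log 2 (3 * (real t)\<^sup>2) + (1 + real j0))" using jle A by (intro mult_left_mono) auto
    thus ?thesis using t0[OF t(2)] logn by (simp add: right_diff_distrib)
  qed
  have "0 \<le> A * real j" using A by simp
  hence E: "real E \<le> log R (real (n t))" "log R (real (n t)) < real E + 1" using big by (auto simp: E_def)
  have En: "R ^ E \<le> real (n t)" "real (n t) \<le> R ^ (E + 1)"
  proof -
    have "R powr real E \<le> real (n t)" using E(1) R npos by (simp add: le_log_iff)
    thus "R ^ E \<le> real (n t)" using R by (simp add: powr_realpow)
    have "real (n t) \<le> R powr real (E + 1)" using E(2) R npos by (subst log_le_iff[symmetric]) auto
    thus "real (n t) \<le> R ^ (E + 1)" using R by (simp add: powr_realpow del: of_nat_Suc)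
  qed
  define M where "M = (E - 896 * j) div 2"
  have EA: "A * real j + 1 + 2 * real M0 \<le> real E" using big E by linarith
  have Aj: "A * real j = 896 * real j + 2 * (736 / \<epsilon>) * real j + 2 * real j" by (simp add: A_def algebra_simps)
  have ej: "0 \<le> 736 / \<epsilon> * real j" using \<epsilon> by simp
  have "real (896 * j) \<le> real E" using EA Aj ej by simp
  hence E896: "896 * j \<le> E" by (simp only: of_nat_le_iff)
  have M2: "2 * M + 896 * j \<le> E" "E \<le> 2 * M + 896 * j + 1" using E896 by (auto simp: M_def)
  have "real E \<le> real (2 * M + 896 * j + 1)" using M2(2) by (simp only: of_nat_le_iff)
  hence M1: "real M0 + 736 / \<epsilon> * real j + real j \<le> real M" using EA Aj by simp
  have MM0: "M \<ge> M0" and Mj: "M \<ge> j" and Me: "736 / \<epsilon> * real j \<le> real M" using M1 ej by linarith+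
  have R1: "R \<ge> 1" using R by simp
  have sched: "on_schedule R n \<psi> M t j"
    unfolding on_schedule_def
  proof (intro conjI)
    show "2 ^ j \<le> R ^ M"
    proof -
      have "2 ^ j \<le> R ^ j" using R by (intro power_mono) auto
      also have "\<dots> \<le> R ^ M" using R1 Mj by (intro power_increasing) auto
      finally show ?thesis .
    qed
    have "(R ^ M)\<^sup>2 * R ^ (896 * j) = R ^ (2 * M + 896 * j)" by (simp add: mult.commute flip: power_mult power_add)
    also have "\<dots> \<le> R ^ E" using R1 M2 by (intro power_increasing) auto
    finally show "(R ^ M)\<^sup>2 * R ^ (896 * j) \<le> real (n t)" using En by linarith
    have "R ^ (E + 1) \<le> R ^ (2 * M + (896 * j + 2))" using R1 M2 by (intro power_increasing) auto
    also have "\<dots> = (R ^ M)\<^sup>2 * R ^ (896 * j + 2)" by (simp only: power_add power_mult) (simp add: mult.commute flip: power_mult)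
    finally show "real (n t) \<le> (R ^ M)\<^sup>2 * R ^ (896 * j + 2)" using En by linarith
    have "3 / 2 ^ j \<le> 3 / (3 * (real t)\<^sup>2)" using jpow t(1) by (intro divide_left_mono) auto
    also have "\<dots> \<le> \<psi> t" using t by simp
    finally show "3 / 2 ^ j \<le> \<psi> t" .
  qed (use t j3 in auto)
  have "736 * real j \<le> \<epsilon> * real M" using Me \<epsilon> by (simp add: field_simps)
  with sched MM0 show ?thesis by blast
qed

text \<open>
  A forced step is made whenever it keeps the level at most \<open>(1 + \<epsilon>) * k + 1\<close>.  If this happened only finitely
  often, the level would exceed \<open>k\<close> by a constant from some point on, and any sufficiently high level admitting a
  short forced step would be used.
\<close>

lemma greedy_schedule:
  fixes R \<epsilon> :: real and n :: "nat \<Rightarrow> nat" and \<psi> :: "nat \<Rightarrow> real"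
  assumes R: "R \<ge> 8" and \<epsilon>: "\<epsilon> > 0"
    and unb: "\<And>M0 \<epsilon>. \<epsilon> > 0 \<Longrightarrow> \<exists>M\<ge>M0. \<exists>t j. on_schedule R n \<psi> M t j \<and> 736 * real j \<le> \<epsilon> * real M"
  obtains m :: "nat \<Rightarrow> nat" and sc :: "nat \<Rightarrow> nat option" where
    "m 0 = 1" "\<And>k. sc k = None \<Longrightarrow> m (Suc k) = m k + 1"
    "\<And>k t. sc k = Some t \<Longrightarrow> \<exists>j. on_schedule R n \<psi> (m k + 1) t j \<and> m (Suc k) = m k + 1 + 736 * j"
    "\<And>k. real (m k) \<le> (1 + \<epsilon>) * real k + 1"
    "infinite {t. \<exists>k. sc k = Some t}"
proof -
  define P where "P k M tj \<longleftrightarrow> on_schedule R n \<psi> (M + 1) (fst tj) (snd tj) \<and> real (M + 1 + 736 * snd tj) \<le> (1 + \<epsilon>) * real (k + 1) + 1" for k M and tj :: "nat \<times> nat"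
  define opt where "opt k M = (if \<exists>tj. P k M tj then Some (SOME tj. P k M tj) else None)" for k M
  have opt: "opt k M = Some tj \<Longrightarrow> P k M tj" for k M tj
    unfolding opt_def by (auto split: if_splits intro: someI2_ex)
  have optN: "opt k M = None \<Longrightarrow> \<not> P k M tj" for k M tj
    unfolding opt_def by (auto split: if_splits simp del: split_paired_All split_paired_Ex)
  define m where "m = rec_nat 1 (\<lambda>k M. M + 1 + (case opt k M of None \<Rightarrow> 0 | Some tj \<Rightarrow> 736 * snd tj))"
  have m0: "m 0 = 1" and mS: "m (Suc k) = m k + 1 + (case opt k (m k) of None \<Rightarrow> 0 | Some tj \<Rightarrow> 736 * snd tj)" for k
    by (simp_all add: m_def)
  define sc where "sc k = map_option fst (opt k (m k))" for k
  have bound: "real (m k) \<le> (1 + \<epsilon>) * real k + 1" for k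
  proof (induction k)
    case (Suc k)
    show ?case
    proof (cases "opt k (m k)")
      case None
      thus ?thesis using Suc \<epsilon> by (simp add: mS algebra_simps)
    next
      case (Some tj)
      thus ?thesis using opt[OF Some] by (simp add: mS P_def add.commute)
    qed
  qed (simp add: m0)
  have mk: "k + 1 \<le> m k" for k by (induction k) (auto simp: m0 mS)
  have some: "\<exists>j. on_schedule R n \<psi> (m k + 1) t j \<and> m (Suc k) = m k + 1 + 736 * j" if "sc k = Some t" for k t
    using that opt[of k "m k"] by (auto simp: sc_def mS P_def)
  have none: "m (Suc k) = m k + 1" if "sc k = None" for k using that by (simp add: sc_def mS)
  have "infinite {t. \<exists>k. sc k = Some t}"
  proof
    assume fin: "finite {t. \<exists>k. sc k = Some t}"
    define B where "B = Max (insert 0 (n ` {t. \<exists>k. sc k = Some t}))"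
    have le: "k < B" if k: "sc k = Some t" for k t
    proof -
      have "n t \<le> B" unfolding B_def by (rule Max_ge) (use fin k in auto)
      obtain j where j: "on_schedule R n \<psi> (m k + 1) t j" using some[OF k] by blast
      have R1: "R \<ge> 1" using R by simp
      have "real k + 1 \<le> real (m k)" using mk[of k] by linarith
      also have "real (m k) < 2 ^ m k" by (rule of_nat_less_two_power)
      also have "(2::real) ^ m k \<le> R ^ m k" using R by (intro power_mono) auto
      also have "\<dots> \<le> R ^ (2 * (m k + 1) + 896 * j)" using R1 by (intro power_increasing) auto
      also have "\<dots> = (R ^ (m k + 1))\<^sup>2 * R ^ (896 * j)" by (simp only: power_add[symmetric] power_mult[symmetric] mult.commute)
      also have "\<dots> \<le> real (n t)" using j by (simp add: on_schedule_def)
      also have "\<dots> \<le> real B" using \<open>n t \<le> B\<close> by simp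
      finally show "k < B" by simp
    qed
    have None: "sc k = None" if "k \<ge> B" for k
    proof (rule ccontr)
      assume "sc k \<noteq> None"
      then obtain t where "sc k = Some t" by auto
      from le[OF this] that show False by simp
    qed
    define d where "d = m B - B"
    have mB: "m (B + i) = B + i + d" for i
    proof (induction i)
      case 0
      show ?case using mk[of B] by (simp add: d_def)
    next
      case (Suc i)
      thus ?case using none[OF None, of "B + i"] by simp
    qed
    obtain M t j where M: "M \<ge> nat \<lceil>2 * (1 + \<epsilon>) * real d / \<epsilon>\<rceil> + B + d + 1" "on_schedule R n \<psi> M t j" "736 * real j \<le> \<epsilon> / 2 * real M"
      using unb[of "\<epsilon> / 2"] \<epsilon> by (metis half_gt_zero)
    \<comment> \<open>Step \<open>B + i\<close> starts at level \<open>M - 1\<close>, and its free step leads to level \<open>M\<close>.\<close>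
  define i where "i = M - 1 - d - B"
    have Mi: "M = B + i + d + 1" using M(1) by (simp add: i_def)
    have "2 * (1 + \<epsilon>) * real d / \<epsilon> \<le> real (nat \<lceil>2 * (1 + \<epsilon>) * real d / \<epsilon>\<rceil>)" by (rule real_nat_ceiling_ge)
    also have "\<dots> \<le> real M" by (subst of_nat_le_iff) (use M(1) in linarith)
    finally have "(1 + \<epsilon>) * real d \<le> \<epsilon> / 2 * real M" using \<epsilon> by (simp add: field_simps)
    hence "real M + 736 * real j \<le> (1 + \<epsilon>) * (real M - real d) + 1"
      using M(3) by (simp add: algebra_simps)
    hence "P (B + i) (m (B + i)) (t, j)"
      using M(2) by (simp add: P_def mB Mi algebra_simps)
    moreover have "opt (B + i) (m (B + i)) = None" using None[of "B + i"] by (simp add: sc_def)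
    ultimately show False using optN by blast
  qed
  with m0 none some bound show ?thesis by (rule that)
qed

lemma dist_int_ge:
  fixes c y :: real
  shows "(\<And>p::int. c \<le> \<bar>y - p\<bar>) \<Longrightarrow> c \<le> dist_int y"
  unfolding dist_int_def infdist_def by (auto intro!: cINF_greatest simp: dist_real_def Ints_def)

lemma dist_int_le:
  fixes y :: real
  shows "dist_int y \<le> \<bar>y - of_int p\<bar>"
  unfolding dist_int_def using infdist_le[of "real_of_int p" \<int> y] by (simp add: dist_real_def)

text \<open>
  The conditions on finite blocks of denominators add up to the infima in the definitions of \<^const>\<open>Bad\<close> and
  \<^const>\<open>Bad_inhom\<close>.
\<close>

lemma INF_dist_int_pos:
  assumes c: "c > 0" and good: "\<And>T. \<exists>T'\<ge>T. badly_approx c 0 T' \<beta> \<delta>"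
  shows "(INF n\<in>{1::nat..}. real n * dist_int (real n * \<beta> - \<delta>)) > 0"
proof -
  have "c \<le> (INF n\<in>{1::nat..}. real n * dist_int (real n * \<beta> - \<delta>))"
  proof (rule cINF_greatest)
    fix k :: nat assume k: "k \<in> {1..}"
    obtain T' where T': "T' \<ge> real k" "badly_approx c 0 T' \<beta> \<delta>" using good by blast
    have "c / real k \<le> dist_int (real k * \<beta> - \<delta>)"
    proof (rule dist_int_ge)
      fix p :: int
      have "c \<le> real_of_int (int k) * \<bar>real_of_int (int k) * \<beta> - p - \<delta>\<bar>"
        by (rule badly_approxD[OF T'(2)]) (use k T' in auto)
      hence "c \<le> \<bar>real k * \<beta> - \<delta> - p\<bar> * real k" by (simp add: algebra_simps)
      thus "c / real k \<le> \<bar>real k * \<beta> - \<delta> - p\<bar>" using k by (simp add: divide_le_eq)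
    qed
    thus "c \<le> real k * dist_int (real k * \<beta> - \<delta>)" using k by (simp add: divide_le_eq mult.commute)
  qed auto
  thus ?thesis using c by linarith
qed

text \<open>
  Of the \<open>R = 8 * N\<close> children of an interval for \<open>\<delta>\<close> only \<open>N\<close> are kept; in terms of dimension the loss is negligible for
  large \<open>N\<close>.
\<close>

lemma scale_with_small_loss:
  fixes s :: real
  assumes "0 < s" "s < 1"
  obtains N :: nat where "N \<ge> 131072" "(8 * real N) powr s \<le> real N"
proof -
  have "filterlim (\<lambda>N. real N powr (1 - s)) at_top sequentially"
    by (rule filterlim_compose[OF _ filterlim_real_sequentially])
      (use assms in \<open>auto intro: real_powr_at_top\<close>)
  hence "eventually (\<lambda>N. 8 powr s \<le> real N powr (1 - s)) sequentially" by (simp add: filterlim_at_top)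
  hence "eventually (\<lambda>N. 8 powr s \<le> real N powr (1 - s) \<and> N \<ge> 131072) sequentially"
    using eventually_ge_at_top by (rule eventually_conj)
  then obtain N where N: "8 powr s \<le> real N powr (1 - s)" "N \<ge> 131072"
    using eventually_happens by fastforce
  have "(8 * real N) powr s = 8 powr s * real N powr s" by (simp add: powr_mult)
  also have "\<dots> \<le> real N powr (1 - s) * real N powr s" using N by (intro mult_right_mono) auto
  also have "\<dots> = real N" using N by (simp flip: powr_add)
  finally show ?thesis using that N by blast
qed

text \<open>
  Each step of the tree is a free step, followed by a forced step if the schedule says so.  A forced step carries no
  digit of the code, but as the level stays below \<open>(1 + \<epsilon>) * k + 1\<close> with \<open>\<sigma> * (1 + \<epsilon>) < 1\<close>, the \<open>k\<close> digits read so
  far still determine a point to the accuracy that the exponent \<open>\<sigma>\<close> requires.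
\<close>

lemma solutions_positive_measure:
  fixes n :: "nat \<Rightarrow> nat" and \<psi> :: "nat \<Rightarrow> real" and \<sigma> d :: real
  assumes pos: "\<And>t. t \<ge> 1 \<Longrightarrow> n t > 0" and lac: "lacunary n"
    and inf: "infinite {t. t \<ge> 1 \<and> 1 / (real t)\<^sup>2 \<le> \<psi> t}" and \<sigma>: "0 < \<sigma>" "\<sigma> < 1" and d: "0 \<le> d" "d \<le> 2 * \<sigma>"
  shows "hausdorff_measure d {x \<in> Bad_pairs \<inter> ({0..1} \<times> {0..1}).
    infinite {t. t \<ge> 1 \<and> dist_int (real (n t) * fst x - snd x) \<le> \<psi> t}} \<noteq> 0"
proof -
  \<comment> \<open>With this choice \<open>s = \<sigma> * (1 + \<epsilon>)\<close> is halfway between \<open>\<sigma>\<close> and 1.\<close>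
  define \<epsilon> where "\<epsilon> = (1 / \<sigma> - 1) / 2"
  have \<epsilon>: "\<epsilon> > 0" using \<sigma> by (simp add: \<epsilon>_def)
  define s where "s = \<sigma> * (1 + \<epsilon>)"
  have "s = (\<sigma> + 1) / 2" using \<sigma> by (simp add: s_def \<epsilon>_def field_simps)
  hence s: "0 < s" "s < 1" using \<sigma> by auto
  obtain N :: nat where N: "N \<ge> 131072" "(8 * real N) powr s \<le> real N" using scale_with_small_loss[OF s] by blast
  define R where "R = 8 * real N"
  have R: "R = 8 * real N" "1048576 \<le> R" "R \<ge> 8" "R \<ge> 1" "R > 0" using N by (auto simp: R_def)
  obtain m sc where m: "m 0 = (1::nat)" and none: "\<And>k. sc k = None \<Longrightarrow> m (Suc k) = m k + 1"
    and some: "\<And>k t. sc k = Some t \<Longrightarrow> \<exists>j. on_schedule R n \<psi> (m k + 1) t j \<and> m (Suc k) = m k + 1 + 736 * j"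
    and mle: "\<And>k. real (m k) \<le> (1 + \<epsilon>) * real k + 1" and inft: "infinite {t. \<exists>k. sc k = Some t}"
    using greedy_schedule[OF R(3) \<epsilon>, of n \<psi>] schedule_unbounded[OF R(3) _ pos lac inf] by blast
  define X where "X k = R ^ m k" for k
  have mk: "k + 1 \<le> m k" for k
  proof (induction k)
    case (Suc k)
    show ?case
    proof (cases "sc k")
      case None thus ?thesis using none[OF None] Suc by simp
    next
      case (Some t) thus ?thesis using some[OF Some] Suc by auto
    qed
  qed (simp add: m)
  have Xge: "real k \<le> X k" "R \<le> X k" for k
  proof -
    have "real k \<le> real (m k)" using mk[of k] by simp
    also have "\<dots> \<le> 2 ^ m k" using of_nat_less_two_power[of "m k"] by (rule less_imp_le)
    also have "\<dots> \<le> R ^ m k" using R by (intro power_mono) auto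
    finally show "real k \<le> X k" by (simp add: X_def)
    have "R ^ 1 \<le> R ^ m k" using R mk[of k] by (intro power_increasing) auto
    thus "R \<le> X k" by (simp add: X_def)
  qed
  have X3: "X k \<ge> 3" "X k > 0" for k using Xge(2)[of k] R by auto
  define hit where "hit k b \<longleftrightarrow> (\<forall>k' t. k = Suc k' \<longrightarrow> sc k' = Some t \<longrightarrow>
      (\<forall>\<beta>\<in>box_I (X k) b. \<forall>\<delta>\<in>box_J (X k) b. dist_int (real (n t) * \<beta> - \<delta>) \<le> \<psi> t))" for k and b :: "real \<times> real"
  define valid where "valid k b \<longleftrightarrow> good_box R (X k) b \<and> box_I (X k) b \<subseteq> {0..1} \<and> box_J (X k) b \<subseteq> {0..1} \<and> hit k b" for k b
  define spec where "spec k b F \<longleftrightarrow>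
     (\<forall>i j. i < N\<^sup>2 \<longrightarrow> j < N \<longrightarrow> valid (Suc k) (F i j) \<and> box_I (X (Suc k)) (F i j) \<subseteq> box_I (X k) b \<and> box_J (X (Suc k)) (F i j) \<subseteq> box_J (X k) b) \<and>
     (\<forall>i i' j j' x x'. i < N\<^sup>2 \<longrightarrow> i' < N\<^sup>2 \<longrightarrow> j < N \<longrightarrow> j' < N \<longrightarrow> i \<noteq> i' \<longrightarrow> x \<in> box_I (X (Suc k)) (F i j) \<longrightarrow>
        x' \<in> box_I (X (Suc k)) (F i' j') \<longrightarrow> 1 / (X k * R)\<^sup>2 \<le> \<bar>x - x'\<bar>) \<and>
     (\<forall>i j j' y y'. i < N\<^sup>2 \<longrightarrow> j < N \<longrightarrow> j' < N \<longrightarrow> j \<noteq> j' \<longrightarrow> y \<in> box_J (X (Suc k)) (F i j) \<longrightarrow>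
        y' \<in> box_J (X (Suc k)) (F i j') \<longrightarrow> 1 / (X k * R) \<le> \<bar>y - y'\<bar>)" for k b and F :: "nat \<Rightarrow> nat \<Rightarrow> real \<times> real"
  have ex: "\<exists>F. spec k b F" if v: "valid k b" for k b
  proof -
    obtain F where F: "\<And>i j. i < N\<^sup>2 \<Longrightarrow> j < N \<Longrightarrow> good_box R (X k * R) (F i j) \<and> box_I (X k * R) (F i j) \<subseteq> box_I (X k) b \<and> box_J (X k * R) (F i j) \<subseteq> box_J (X k) b"
      "\<And>i i' j j' x x'. i \<noteq> i' \<Longrightarrow> x \<in> box_I (X k * R) (F i j) \<Longrightarrow> x' \<in> box_I (X k * R) (F i' j') \<Longrightarrow> 1 / (X k * R)\<^sup>2 \<le> \<bar>x - x'\<bar>"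
      "\<And>i j j' y y'. j \<noteq> j' \<Longrightarrow> y \<in> box_J (X k * R) (F i j) \<Longrightarrow> y' \<in> box_J (X k * R) (F i j') \<Longrightarrow> 1 / (X k * R) \<le> \<bar>y - y'\<bar>"
      using free_step[OF R(1,2) X3(1)[of k], of b] v unfolding valid_def by blast
    have "\<exists>b'. good_box R (X (Suc k)) b' \<and> hit (Suc k) b' \<and> box_I (X (Suc k)) b' \<subseteq> box_I (X k * R) (F i j) \<and> box_J (X (Suc k)) b' \<subseteq> box_J (X k * R) (F i j)"
      if ij: "i < N\<^sup>2" "j < N" for i j
    proof (cases "sc k")
      case None
      have "X (Suc k) = X k * R" using none[OF None] by (simp add: X_def)
      thus ?thesis using F(1)[OF ij] None by (intro exI[of _ "F i j"]) (auto simp: hit_def)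
    next
      case (Some t)
      obtain l where l: "on_schedule R n \<psi> (m k + 1) t l" "m (Suc k) = m k + 1 + 736 * l" using some[OF Some] by blast
      have XS: "X (Suc k) = X k * R * R ^ (736 * l)" using l(2) by (simp add: X_def power_add)
      have Y: "R ^ (m k + 1) = X k * R" by (simp add: X_def)
      have "X k * 1 \<le> X k * R" using X3[of k] R by (intro mult_left_mono) auto
      hence Y3: "X k * R \<ge> 3" using X3[of k] by linarith
      have sch: "l \<ge> 3" "R\<^sup>2 \<le> 2 ^ l" "2 ^ l \<le> X k * R" "(X k * R)\<^sup>2 * R ^ (896 * l) \<le> real (n t)"
        "real (n t) \<le> (X k * R)\<^sup>2 * R ^ (896 * l + 2)" "3 / 2 ^ l \<le> \<psi> t"
        using l(1) unfolding on_schedule_def Y by auto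
      obtain b' where b': "good_box R (X (Suc k)) b'" "box_I (X (Suc k)) b' \<subseteq> box_I (X k * R) (F i j)" "box_J (X (Suc k)) b' \<subseteq> box_J (X k * R) (F i j)"
        "\<And>\<beta> \<delta>. \<beta>\<in>box_I (X (Suc k)) b' \<Longrightarrow> \<delta>\<in>box_J (X (Suc k)) b' \<Longrightarrow> \<exists>p::int. \<bar>real (n t) * \<beta> - \<delta> - real_of_int p\<bar> \<le> 3 / 2 ^ l"
        using forced_step[OF R(1,2) Y3 sch(1,2,3,4,5), of "F i j"] F(1)[OF ij] unfolding XS[symmetric] by blast
      have "dist_int (real (n t) * \<beta> - \<delta>) \<le> \<psi> t" if in_box: "\<beta>\<in>box_I (X (Suc k)) b'" "\<delta>\<in>box_J (X (Suc k)) b'" for \<beta> \<delta>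
      proof -
        obtain p :: int where "\<bar>real (n t) * \<beta> - \<delta> - real_of_int p\<bar> \<le> 3 / 2 ^ l" using b'(4)[OF in_box] by blast
        thus ?thesis using sch(6) dist_int_le[of "real (n t) * \<beta> - \<delta>" p] by linarith
      qed
      hence "hit (Suc k) b'" using Some by (auto simp: hit_def)
      thus ?thesis using b' by blast
    qed
    hence "\<forall>i j. \<exists>b'. i < N\<^sup>2 \<longrightarrow> j < N \<longrightarrow> good_box R (X (Suc k)) b' \<and> hit (Suc k) b' \<and> box_I (X (Suc k)) b' \<subseteq> box_I (X k * R) (F i j) \<and> box_J (X (Suc k)) b' \<subseteq> box_J (X k * R) (F i j)"
      by blast
    then obtain G where G: "\<And>i j. i < N\<^sup>2 \<Longrightarrow> j < N \<Longrightarrow> good_box R (X (Suc k)) (G i j) \<and> hit (Suc k) (G i j) \<and> box_I (X (Suc k)) (G i j) \<subseteq> box_I (X k * R) (F i j) \<and> box_J (X (Suc k)) (G i j) \<subseteq> box_J (X k * R) (F i j)"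
      by metis
    have "spec k b G"
      unfolding spec_def
    proof (intro conjI allI impI)
      fix i j assume ij: "i < N\<^sup>2" "j < N"
      show "valid (Suc k) (G i j)" "box_I (X (Suc k)) (G i j) \<subseteq> box_I (X k) b" "box_J (X (Suc k)) (G i j) \<subseteq> box_J (X k) b"
        using G[OF ij] F(1)[OF ij] v unfolding valid_def by blast+
    next
      fix i i' j j' x x' assume "i < N\<^sup>2" "i' < N\<^sup>2" "j < N" "j' < N" "i \<noteq> i'" "x \<in> box_I (X (Suc k)) (G i j)" "x' \<in> box_I (X (Suc k)) (G i' j')"
      thus "1 / (X k * R)\<^sup>2 \<le> \<bar>x - x'\<bar>" using F(2)[of i i' x j x' j'] G[of i j] G[of i' j'] by blast
    next
      fix i j j' y y' assume "i < N\<^sup>2" "j < N" "j' < N" "j \<noteq> j'" "y \<in> box_J (X (Suc k)) (G i j)" "y' \<in> box_J (X (Suc k)) (G i j')"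
      thus "1 / (X k * R) \<le> \<bar>y - y'\<bar>" using F(3)[of j j' y i y'] G[of i j] G[of i j'] by blast
    qed
    thus ?thesis by blast
  qed
  have "\<forall>k b. \<exists>F. valid k b \<longrightarrow> spec k b F" using ex by blast
  then obtain F where F: "\<And>k b. valid k b \<Longrightarrow> spec k b (F k b)" by metis
  have start: "valid 0 (0, 0)"
  proof -
    have x0: "X 0 = R" by (simp add: X_def m)
    have l1: "1 / (4 * R\<^sup>2) * R < 1" "1 / (4 * R ^ 8) * R < 1"
    proof -
      have "1 / (4 * R\<^sup>2) * R = 1 / (4 * R)" using R by (simp add: power2_eq_square)
      thus "1 / (4 * R\<^sup>2) * R < 1" using R by simp
      have "1 / (4 * R ^ 8) * R = 1 / (4 * R ^ 7)" using R(5) by (simp add: eval_nat_numeral)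
      moreover have "1 \<le> R ^ 7" using R(4) by (rule one_le_power)
      ultimately show "1 / (4 * R ^ 8) * R < 1" using R(5) by (simp add: divide_less_eq)
    qed
    have "1 \<le> R\<^sup>2" using R(4) by (rule one_le_power)
    hence "1 / R\<^sup>2 \<le> 1" "1 / R \<le> 1" using R(4,5) by (auto simp: divide_le_eq)
    thus ?thesis using badly_approx_vacuous[OF l1(1)] badly_approx_vacuous[OF l1(2)]
      unfolding valid_def good_box_def hit_def x0 by (auto simp: box_I_def box_J_def)
  qed
  define C where "C = R powr (2 * \<sigma>)"
  have C: "C \<ge> 1" using R \<sigma> by (simp add: C_def ge_one_powr_ge_zero)
  have growth: "(X k * R) powr \<sigma> \<le> C * real N ^ k" for k
  proof -
    have "X k * R = R powr (real (m k) + 1)" using R by (simp add: X_def powr_add powr_realpow)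
    hence "(X k * R) powr \<sigma> = R powr ((real (m k) + 1) * \<sigma>)" by (simp add: powr_powr)
    also have "\<dots> \<le> R powr (((1 + \<epsilon>) * real k + 2) * \<sigma>)"
      using R \<sigma> mle[of k] by (intro powr_mono mult_right_mono) auto
    also have "((1 + \<epsilon>) * real k + 2) * \<sigma> = 2 * \<sigma> + s * real k" by (simp add: s_def algebra_simps)
    also have "R powr (2 * \<sigma> + s * real k) = C * (R powr s) ^ k"
      using R by (simp add: C_def powr_add powr_powr[symmetric] powr_realpow)
    also have "\<dots> \<le> C * real N ^ k" using N(2) C by (intro mult_left_mono power_mono) (auto simp: R_def)
    finally show ?thesis .
  qed
  obtain g where g: "\<And>\<xi> \<xi>' \<eta> \<eta>'. {\<xi>, \<xi>', \<eta>, \<eta>'} \<subseteq> {0..<1} \<Longrightarrow> \<bar>\<xi> - \<xi>'\<bar> \<le> C\<^sup>2 * dist (g \<xi> \<eta>) (g \<xi>' \<eta>') powr \<sigma>"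
    "\<And>\<xi> \<eta> \<eta>'. {\<xi>, \<eta>, \<eta>'} \<subseteq> {0..<1} \<Longrightarrow> \<bar>\<eta> - \<eta>'\<bar> \<le> C\<^sup>2 * dist (g \<xi> \<eta>) (g \<xi> \<eta>') powr \<sigma>"
    "\<And>\<xi> \<eta> k. {\<xi>, \<eta>} \<subseteq> {0..<1} \<Longrightarrow> \<exists>b. valid k b \<and> fst (g \<xi> \<eta>) \<in> {fst b .. fst b + 1 / (X k)\<^sup>2} \<and> snd (g \<xi> \<eta>) \<in> {snd b .. snd b + 1 / X k}"
  proof (rule separated_tree_coding[where X = X and N = N and R = R and \<sigma> = \<sigma> and C = C and valid = valid and ?s0.0 = "(0, 0)" and F = F])
    show "N \<ge> 2" using N by simp
    show "1 \<le> X k * R" for k using mult_mono[of 1 "X k" 1 R] X3[of k] R by simp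
  qed (use X3 R \<sigma> C start growth F in \<open>auto simp: spec_def box_I_def box_J_def\<close>)
  have boxes: "\<exists>b. valid k b \<and> fst (g \<xi> \<eta>) \<in> box_I (X k) b \<and> snd (g \<xi> \<eta>) \<in> box_J (X k) b" if "{\<xi>, \<eta>} \<subseteq> {0..<1}" for \<xi> \<eta> k
    using g(3)[OF that] unfolding box_I_def box_J_def .
  show ?thesis
  proof (rule hausdorff_measure_pos_of_expanding[OF _ \<sigma>(1) g(1,2) _ d])
    show "C\<^sup>2 > 0" using C by simp
    fix \<xi> \<eta> :: real assume h: "{\<xi>, \<eta>} \<subseteq> {0..<1}"
    define \<beta> \<delta> where bd: "\<beta> = fst (g \<xi> \<eta>)" "\<delta> = snd (g \<xi> \<eta>)"
    have good: "\<exists>T'\<ge>T. badly_approx (1 / R ^ 7) 0 T' \<beta> 0 \<and> badly_approx (1 / (16 * R ^ 9)) 0 T' \<beta> \<delta>" for T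
    proof -
      obtain k :: nat where k: "4 * R ^ 8 * T \<le> real k" using real_arch_simple by blast
      obtain b where b: "valid k b" "\<beta> \<in> box_I (X k) b" "\<delta> \<in> box_J (X k) b" using boxes[OF h, of k] unfolding bd by blast
      have gb: "badly_approx (1 / R ^ 7) 0 (1 / (4 * R\<^sup>2) * X k) \<beta> 0" "badly_approx (1 / (16 * R ^ 9)) 0 (1 / (4 * R ^ 8) * X k) \<beta> \<delta>"
        using b unfolding valid_def good_box_def by auto
      have "1 / (4 * R ^ 8) \<le> 1 / (4 * R\<^sup>2)" using R power_increasing[of 2 8 R] by (intro divide_left_mono) auto
      hence "1 / (4 * R ^ 8) * X k \<le> 1 / (4 * R\<^sup>2) * X k" using X3[of k] by (intro mult_right_mono) auto
      hence "badly_approx (1 / R ^ 7) 0 (1 / (4 * R ^ 8) * X k) \<beta> 0" by (intro badly_approx_mono[OF gb(1)]) auto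
      moreover have "T \<le> 1 / (4 * R ^ 8) * X k"
      proof -
        have "4 * R ^ 8 * T \<le> X k" using k Xge(1)[of k] by linarith
        thus ?thesis using R by (simp add: le_divide_eq mult.commute)
      qed
      ultimately show ?thesis using gb(2) by blast
    qed
    have "\<beta> \<in> Bad" unfolding Bad_def using INF_dist_int_pos[of "1 / R ^ 7" \<beta> 0] good R by auto
    moreover have "\<beta> \<in> Bad_inhom \<delta>" unfolding Bad_inhom_def using INF_dist_int_pos[of "1 / (16 * R ^ 9)" \<beta> \<delta>] good R by auto
    moreover have "\<beta> \<in> {0..1}" "\<delta> \<in> {0..1}" using boxes[OF h, of 0] unfolding bd valid_def by blast+
    moreover have "infinite {t. t \<ge> 1 \<and> dist_int (real (n t) * \<beta> - \<delta>) \<le> \<psi> t}"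
    proof (rule infinite_super[OF _ inft], clarify)
      fix t k assume k: "sc k = Some t"
      obtain b where b: "valid (Suc k) b" "\<beta> \<in> box_I (X (Suc k)) b" "\<delta> \<in> box_J (X (Suc k)) b"
        using boxes[OF h, of "Suc k"] unfolding bd by blast
      have "t \<ge> 1" using some[OF k] unfolding on_schedule_def by blast
      thus "t \<ge> 1 \<and> dist_int (real (n t) * \<beta> - \<delta>) \<le> \<psi> t" using b k unfolding valid_def hit_def by blast
    qed
    moreover have "g \<xi> \<eta> = (\<beta>, \<delta>)" by (simp add: bd)
    ultimately show "g \<xi> \<eta> \<in> {x \<in> Bad_pairs \<inter> ({0..1} \<times> {0..1}).
       infinite {t. t \<ge> 1 \<and> dist_int (real (n t) * fst x - snd x) \<le> \<psi> t}}"
      by (simp add: Bad_pairs_def)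
  qed
qed

theorem theorem1p6:
  fixes n :: "nat \<Rightarrow> nat" and \<psi> :: "nat \<Rightarrow> real"
  assumes "\<And>t. t \<ge> 1 \<Longrightarrow> n t > 0"
    and "lacunary n"
    and "\<And>t. t \<ge> 1 \<Longrightarrow> 0 \<le> \<psi> t \<and> \<psi> t \<le> 1"
    and "filterlim (\<lambda>N. \<Sum>t=1..N. \<psi> t) at_top sequentially"
  shows "\<exists>G \<subseteq> Bad_pairs. hausdorff_dim G = 2 \<and>
           (\<forall>(\<beta>, \<delta>) \<in> G. infinite {t. t \<ge> 1 \<and> dist_int (real (n t) * \<beta> - \<delta>) \<le> \<psi> t})"
proof -
  define G where "G = {x \<in> Bad_pairs \<inter> ({0..1} \<times> {0..1}). infinite {t. t \<ge> 1 \<and> dist_int (real (n t) * fst x - snd x) \<le> \<psi> t}}"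
  have inf: "infinite {t. t \<ge> 1 \<and> 1 / (real t)\<^sup>2 \<le> \<psi> t}"
    by (rule divergent_sum_not_below_inverse_squares) (use assms(3,4) in auto)
  have "hausdorff_dim G = 2"
  proof (rule hausdorff_dim_eq_2)
    show "G \<subseteq> {0..1} \<times> {0..1}" by (auto simp: G_def)
    fix s :: real assume s: "0 \<le> s" "s < 2"
    define \<sigma> where "\<sigma> = (s / 2 + 1) / 2"
    have \<sigma>: "0 < \<sigma>" "\<sigma> < 1" "s \<le> 2 * \<sigma>" using s by (auto simp: \<sigma>_def)
    show "hausdorff_measure s G \<noteq> 0"
      unfolding G_def by (rule solutions_positive_measure[OF assms(1,2) inf \<sigma>(1,2) s(1) \<sigma>(3)])
  qed
  thus ?thesis by (intro exI[of _ G]) (auto simp: G_def)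
qed

end
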